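(* Let $\mathcal{A}$ be an essential elliptic arrangement in $E^{\times n}$, where $E$ is a complex elliptic curve. Then the complement $U(\mathcal{A})=E^{\times n}\setminus\bigcup_{H\in\mathcal{A}}H$ is a Stein manifold.
   Context: Write $E$ as an additive group. An elliptic arrangement in $E^{\times n}$ is a finite collection $\mathcal{A}=\{H_1,\dots,H_m\}$ of codimension-one subvarieties $H_i=f_i^{-1}(\zeta_i)$, where $\zeta_i\in E$ and $f_i\colon E^{\times n}\to E$ is the homomorphism $f_i(x_1,\dots,x_n)=\sum_{j=1}^n a_{ij}x_j$ for an integer matrix $(a_{ij})$ of size $m\times n$ (with nonzero rows). The corank of $\mathcal{A}$ is $n-\operatorname{rank}(a_{ij})$, and $\mathcal{A}$ is essential if its corank is $0$. A complex manifold is Stein if it can be realized as a closed complex submanifold of some $\mathbb{C}^k$. *)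

theory Defs
  imports "HOL-Analysis.Analysis" "HOL-Algebra.Coset" "Jordan_Normal_Form.DL_Rank"
begin

section \<open>Complex manifolds\<close>

text \<open>
  The space \<open>\<complex>\<^sup>k\<close> for a variable number \<open>k\<close> is modelled in the same way as the library's
  \<^const>\<open>Euclidean_space\<close>: as the sequences vanishing from index \<open>k\<close> on, with the subspace
  topology of the product topology.  In particular \<open>\<complex>\<^sup>d \<subseteq> \<complex>\<^sup>k\<close> is the standard coordinate
  subspace when \<open>d \<le> k\<close>.
\<close>

type_synonym cvec = "nat \<Rightarrow> complex"

definition cspace :: "nat \<Rightarrow> cvec set" where
  "cspace k = {x. \<forall>i\<ge>k. x i = 0}"

definition cspace_top :: "nat \<Rightarrow> cvec topology" where
  "cspace_top k = top_of_set (cspace k)"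

text \<open>
  Complex Frechet differentiability at every point of an open set \<open>W \<subseteq> \<complex>\<^sup>m\<close>; the
  \<open>c i\<close> are the partial derivatives, and the norm on \<open>\<complex>\<^sup>m\<close> is the sum norm.
\<close>

definition holomorphic_fun :: "nat \<Rightarrow> (cvec \<Rightarrow> complex) \<Rightarrow> cvec set \<Rightarrow> bool" where
  "holomorphic_fun m f W \<longleftrightarrow>
     openin (cspace_top m) W \<and>
     (\<forall>p\<in>W. \<exists>c :: nat \<Rightarrow> complex.
        ((\<lambda>x. (f x - f p - (\<Sum>i<m. c i * (x i - p i))) / of_real (\<Sum>i<m. cmod (x i - p i)))
           \<longlongrightarrow> 0) (at p within W))"

definition holomorphic_vec :: "nat \<Rightarrow> nat \<Rightarrow> (cvec \<Rightarrow> cvec) \<Rightarrow> cvec set \<Rightarrow> bool" where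
  "holomorphic_vec m k F W \<longleftrightarrow>
     openin (cspace_top m) W \<and> F ` W \<subseteq> cspace k \<and> (\<forall>j<k. holomorphic_fun m (\<lambda>x. F x j) W)"

text \<open>A chart \<open>(U, \<phi>)\<close>; the values of \<open>\<phi>\<close> outside \<open>U\<close> are irrelevant.\<close>

type_synonym 'a chart = "'a set \<times> ('a \<Rightarrow> cvec)"

record 'a cmanifold =
  mtop :: "'a topology"
  mdim :: nat
  atlas :: "'a chart set"

definition is_chart :: "'a topology \<Rightarrow> nat \<Rightarrow> 'a chart \<Rightarrow> bool" where
  "is_chart X d c \<longleftrightarrow> (case c of (U, \<phi>) \<Rightarrow>
     openin X U \<and> openin (cspace_top d) (\<phi> ` U) \<and>
     homeomorphic_map (subtopology X U) (subtopology (cspace_top d) (\<phi> ` U)) \<phi>)"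

definition complex_manifold :: "'a cmanifold \<Rightarrow> bool" where
  "complex_manifold M \<longleftrightarrow>
     Hausdorff_space (mtop M) \<and> second_countable (mtop M) \<and>
     (\<forall>c\<in>atlas M. is_chart (mtop M) (mdim M) c) \<and>
     (\<Union>(U, \<phi>)\<in>atlas M. U) = topspace (mtop M) \<and>
     (\<forall>(U, \<phi>)\<in>atlas M. \<forall>(V, \<psi>)\<in>atlas M.
        holomorphic_vec (mdim M) (mdim M) (\<psi> \<circ> inv_into U \<phi>) (\<phi> ` (U \<inter> V)))"

definition holomorphic_map :: "'a cmanifold \<Rightarrow> 'b cmanifold \<Rightarrow> ('a \<Rightarrow> 'b) \<Rightarrow> bool" where
  "holomorphic_map M N f \<longleftrightarrow>
     continuous_map (mtop M) (mtop N) f \<and>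
     (\<forall>(U, \<phi>)\<in>atlas M. \<forall>(V, \<psi>)\<in>atlas N.
        holomorphic_vec (mdim M) (mdim N) (\<psi> \<circ> f \<circ> inv_into U \<phi>) (\<phi> ` {x \<in> U. f x \<in> V}))"

definition biholomorphic :: "'a cmanifold \<Rightarrow> 'b cmanifold \<Rightarrow> bool" where
  "biholomorphic M N \<longleftrightarrow>
     (\<exists>f g. holomorphic_map M N f \<and> holomorphic_map N M g \<and>
        (\<forall>x\<in>topspace (mtop M). g (f x) = x) \<and> (\<forall>y\<in>topspace (mtop N). f (g y) = y))"

definition open_submanifold :: "'a cmanifold \<Rightarrow> 'a set \<Rightarrow> 'a cmanifold" where
  "open_submanifold M S =
     \<lparr>mtop = subtopology (mtop M) S, mdim = mdim M,
      atlas = (\<lambda>(U, \<phi>). (U \<inter> S, \<phi>)) ` atlas M\<rparr>"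


section \<open>Closed submanifolds of affine space and Stein manifolds\<close>

definition cspace_biholomorphism :: "nat \<Rightarrow> cvec set \<Rightarrow> (cvec \<Rightarrow> cvec) \<Rightarrow> bool" where
  "cspace_biholomorphism k W \<psi> \<longleftrightarrow>
     holomorphic_vec k k \<psi> W \<and> inj_on \<psi> W \<and> holomorphic_vec k k (inv_into W \<psi>) (\<psi> ` W)"

text \<open>
  \<open>(W, \<psi>)\<close> is a holomorphic coordinate system on an open set \<open>W\<close> of \<open>\<complex>\<^sup>k\<close> in which
  \<open>S\<close> is the coordinate subspace \<open>\<complex>\<^sup>d\<close>.
\<close>

definition adapted_chart :: "nat \<Rightarrow> nat \<Rightarrow> cvec set \<Rightarrow> cvec set \<Rightarrow> (cvec \<Rightarrow> cvec) \<Rightarrow> bool" where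
  "adapted_chart k d S W \<psi> \<longleftrightarrow>
     cspace_biholomorphism k W \<psi> \<and> \<psi> ` (W \<inter> S) = \<psi> ` W \<inter> cspace d"

definition closed_complex_submanifold :: "nat \<Rightarrow> nat \<Rightarrow> cvec set \<Rightarrow> bool" where
  "closed_complex_submanifold k d S \<longleftrightarrow>
     d \<le> k \<and> closedin (cspace_top k) S \<and> (\<forall>p\<in>S. \<exists>W \<psi>. p \<in> W \<and> adapted_chart k d S W \<psi>)"

definition submanifold_structure :: "nat \<Rightarrow> nat \<Rightarrow> cvec set \<Rightarrow> cvec cmanifold" where
  "submanifold_structure k d S =
     \<lparr>mtop = subtopology (cspace_top k) S, mdim = d,
      atlas = {(W \<inter> S, \<psi>) |W \<psi>. adapted_chart k d S W \<psi>}\<rparr>"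

definition stein_manifold :: "'a cmanifold \<Rightarrow> bool" where
  "stein_manifold M \<longleftrightarrow>
     complex_manifold M \<and>
     (\<exists>k d S. closed_complex_submanifold k d S \<and> biholomorphic M (submanifold_structure k d S))"


section \<open>Complex elliptic curves and their powers\<close>

definition is_lattice :: "complex set \<Rightarrow> bool" where
  "is_lattice \<Lambda> \<longleftrightarrow>
     (\<exists>\<omega>1 \<omega>2 :: complex. \<omega>1 \<noteq> \<omega>2 \<and> independent {\<omega>1, \<omega>2} \<and>
        \<Lambda> = {of_int a * \<omega>1 + of_int b * \<omega>2 |a b. True})"

definition complex_add :: "complex monoid" where
  "complex_add = \<lparr>carrier = UNIV, mult = (+), one = 0\<rparr>"

text \<open>
  The additive group \<open>E = \<complex>/\<Lambda>\<close>.  HOL-Algebra writes groups multiplicatively, so the integer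
  multiple \<open>a x\<close> in \<open>E\<close> appears below as \<open>x [^] a\<close> and a finite sum as \<^const>\<open>finprod\<close>.
\<close>

definition elliptic_curve :: "complex set \<Rightarrow> complex set monoid" where
  "elliptic_curve \<Lambda> = complex_add Mod \<Lambda>"

definition curve_proj :: "complex set \<Rightarrow> complex \<Rightarrow> complex set" where
  "curve_proj \<Lambda> z = \<Lambda> #>\<^bsub>complex_add\<^esub> z"

text \<open>The quotient topology of \<open>\<complex> \<rightarrow> \<complex>/\<Lambda>\<close>.\<close>

definition elliptic_curve_top :: "complex set \<Rightarrow> complex set topology" where
  "elliptic_curve_top \<Lambda> =
     topology (\<lambda>U. U \<subseteq> carrier (elliptic_curve \<Lambda>) \<and> open (curve_proj \<Lambda> -` U))"

text \<open>Points of \<open>E\<^sup>n\<close> are the extensional functions \<open>{..<n} \<rightarrow> E\<close>.\<close>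

definition power_proj :: "complex set \<Rightarrow> nat \<Rightarrow> cvec \<Rightarrow> (nat \<Rightarrow> complex set)" where
  "power_proj \<Lambda> n z = (\<lambda>j\<in>{..<n}. curve_proj \<Lambda> (z j))"

text \<open>
  \<open>E\<^sup>n\<close> carries the product topology; its charts are the local inverses of the covering
  \<open>\<complex>\<^sup>n \<rightarrow> E\<^sup>n\<close>.
\<close>

definition elliptic_power :: "complex set \<Rightarrow> nat \<Rightarrow> (nat \<Rightarrow> complex set) cmanifold" where
  "elliptic_power \<Lambda> n =
     \<lparr>mtop = product_topology (\<lambda>_. elliptic_curve_top \<Lambda>) {..<n}, mdim = n,
      atlas = {(power_proj \<Lambda> n ` V, inv_into V (power_proj \<Lambda> n)) |V.
                 openin (cspace_top n) V \<and> inj_on (power_proj \<Lambda> n) V}\<rparr>"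

lemma subgroup_lattice:
  assumes "is_lattice \<Lambda>"
  shows "subgroup \<Lambda> complex_add"
proof -
  have "group complex_add"
    by (rule groupI) (auto simp: complex_add_def algebra_simps intro: exI [of _ "- _"])
  moreover obtain \<omega>1 \<omega>2 where L: "\<Lambda> = {of_int a * \<omega>1 + of_int b * \<omega>2 |a b. True}"
    using assms by (auto simp: is_lattice_def)
  have "0 \<in> \<Lambda>"
    unfolding L by (rule CollectI, rule exI [of _ 0], rule exI [of _ 0]) simp
  moreover have "- x \<in> \<Lambda>" if "x \<in> \<Lambda>" for x
  proof -
    from that obtain a b where "x = of_int a * \<omega>1 + of_int b * \<omega>2" unfolding L by blast
    then have "- x = of_int (- a) * \<omega>1 + of_int (- b) * \<omega>2" by simp
    then show ?thesis unfolding L by blast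
  qed
  moreover have "x + y \<in> \<Lambda>" if "x \<in> \<Lambda>" "y \<in> \<Lambda>" for x y
  proof -
    from that obtain a b c d where "x = of_int a * \<omega>1 + of_int b * \<omega>2"
      "y = of_int c * \<omega>1 + of_int d * \<omega>2" unfolding L by blast
    then have "x + y = of_int (a + c) * \<omega>1 + of_int (b + d) * \<omega>2" by (simp add: algebra_simps)
    then show ?thesis unfolding L by blast
  qed
  moreover have "inv\<^bsub>complex_add\<^esub> x = - x" for x
    using \<open>group complex_add\<close>
    by (intro group.inv_equality) (auto simp: complex_add_def)
  ultimately show ?thesis
    by (intro group.subgroupI) (auto simp: complex_add_def)
qed

lemma comm_group_elliptic_curve:
  assumes "is_lattice \<Lambda>"
  shows "comm_group (elliptic_curve \<Lambda>)"
proof -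
  have "comm_group complex_add"
    by (rule comm_groupI) (auto simp: complex_add_def algebra_simps intro: exI [of _ "- _"])
  then show ?thesis
    unfolding elliptic_curve_def
    by (intro comm_group.abelian_FactGroup subgroup_lattice assms)
qed

lemma openin_elliptic_curve_top:
  "openin (elliptic_curve_top \<Lambda>) U \<longleftrightarrow>
     U \<subseteq> carrier (elliptic_curve \<Lambda>) \<and> open (curve_proj \<Lambda> -` U)"
proof -
  have "istopology (\<lambda>U. U \<subseteq> carrier (elliptic_curve \<Lambda>) \<and> open (curve_proj \<Lambda> -` U))"
    unfolding istopology_def by (auto simp: vimage_Union)
  then show ?thesis by (simp add: elliptic_curve_top_def)
qed

lemma topspace_elliptic_power:
  "topspace (mtop (elliptic_power \<Lambda> n)) = (\<Pi>\<^sub>E j\<in>{..<n}. carrier (elliptic_curve \<Lambda>))"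
proof -
  have "curve_proj \<Lambda> -` carrier (elliptic_curve \<Lambda>) = UNIV"
    by (auto simp: elliptic_curve_def carrier_FactGroup curve_proj_def complex_add_def)
  then have "topspace (elliptic_curve_top \<Lambda>) = carrier (elliptic_curve \<Lambda>)"
    by (auto simp: topspace_def openin_elliptic_curve_top)
  then show ?thesis by (simp add: elliptic_power_def)
qed


section \<open>Elliptic arrangements\<close>

text \<open>
  An arrangement in \<open>E\<^sup>n\<close> is given by an integer matrix \<open>A\<close> with \<open>n\<close> columns and nonzero rows,
  together with one point \<open>\<zeta> i\<close> of \<open>E\<close> for each row \<open>i\<close>.
\<close>

definition elliptic_arrangement :: "complex set \<Rightarrow> nat \<Rightarrow> int mat \<Rightarrow> (nat \<Rightarrow> complex set) \<Rightarrow> bool" where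
  "elliptic_arrangement \<Lambda> n A \<zeta> \<longleftrightarrow>
     dim_col A = n \<and>
     (\<forall>i<dim_row A. (\<exists>j<n. A $$ (i, j) \<noteq> 0) \<and> \<zeta> i \<in> carrier (elliptic_curve \<Lambda>))"

definition arrangement_hom :: "complex set \<Rightarrow> int mat \<Rightarrow> nat \<Rightarrow> (nat \<Rightarrow> complex set) \<Rightarrow> complex set" where
  "arrangement_hom \<Lambda> A i x =
     finprod (elliptic_curve \<Lambda>) (\<lambda>j. x j [^]\<^bsub>elliptic_curve \<Lambda>\<^esub> (A $$ (i, j))) {..<dim_col A}"

definition hypersurface ::
    "complex set \<Rightarrow> nat \<Rightarrow> int mat \<Rightarrow> (nat \<Rightarrow> complex set) \<Rightarrow> nat \<Rightarrow> (nat \<Rightarrow> complex set) set" where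
  "hypersurface \<Lambda> n A \<zeta> i =
     {x \<in> topspace (mtop (elliptic_power \<Lambda> n)). arrangement_hom \<Lambda> A i x = \<zeta> i}"

definition arrangement ::
    "complex set \<Rightarrow> nat \<Rightarrow> int mat \<Rightarrow> (nat \<Rightarrow> complex set) \<Rightarrow> (nat \<Rightarrow> complex set) set set" where
  "arrangement \<Lambda> n A \<zeta> = hypersurface \<Lambda> n A \<zeta> ` {..<dim_row A}"

definition arrangement_complement ::
    "complex set \<Rightarrow> nat \<Rightarrow> int mat \<Rightarrow> (nat \<Rightarrow> complex set) \<Rightarrow> (nat \<Rightarrow> complex set) set" where
  "arrangement_complement \<Lambda> n A \<zeta> =
     topspace (mtop (elliptic_power \<Lambda> n)) - \<Union> (arrangement \<Lambda> n A \<zeta>)"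

definition corank :: "int mat \<Rightarrow> nat" where
  "corank A = dim_col A - vec_space.rank (dim_row A) (map_mat rat_of_int A)"

definition essential :: "int mat \<Rightarrow> bool" where
  "essential A \<longleftrightarrow> corank A = 0"

end

theory Submission
  imports Defs "HOL-Complex_Analysis.Conformal_Mappings"
begin

text \<open>
  For a unitary character \<open>e\<close> of the lattice \<open>\<Lambda>\<close> and \<open>k \<ge> 4\<close> the sum
  \<open>F\<^sub>e\<^sub>,\<^sub>k(w) = \<Sum>\<^bsub>\<lambda>\<in>\<Lambda>\<^esub> e(\<lambda>) / (w - \<lambda>)\<^sup>k\<close> converges off \<open>\<Lambda>\<close>, satisfies \<open>F\<^sub>e\<^sub>,\<^sub>k' = - k F\<^sub>e\<^sub>,\<^sub>k\<^sub>+\<^sub>1\<close>, is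
  multiplied by \<open>e(\<lambda>)\<close> under translation by \<open>\<lambda>\<close>, and has poles exactly along \<open>\<Lambda>\<close>.  By the identity
  theorem and compactness of \<open>\<complex>/\<Lambda>\<close>, finitely many exponents \<open>k\<close> suffice to make the functions
  \<open>F\<^sub>e\<^sub>,\<^sub>k\<close> without common zero, and the functions \<open>F\<^sub>1\<^sub>,\<^sub>k\<close> a closed embedding of \<open>E - {0}\<close>.

  The functions \<open>F\<^sub>1\<^sub>,\<^sub>k(f\<^sub>i - \<zeta>\<^sub>i)\<close> therefore define a proper immersion of the complement \<open>U(\<A>)\<close> whose
  fibres are contained in the cosets of the finite kernel of \<open>(f\<^sub>i)\<close>.  To separate the points of a coset,
  choose \<open>n\<close> independent rows, with inverse matrix \<open>C\<close>.  A product over these rows of functions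
  \<open>F\<^sub>e\<^sub>,\<^sub>k(f\<^sub>i - \<zeta>\<^sub>i)\<close>, with one character for each row, still descends to \<open>E\<^sup>n\<close> provided that the product of the
  characters is trivial on the image of \<open>\<Lambda>\<^sup>n\<close>; the rows of \<open>C\<close> yield enough such characters to detect
  every nontrivial element of the kernel.  Altogether this is a closed holomorphic embedding of \<open>U(\<A>)\<close>
  in some \<open>\<complex>\<^sup>N\<close>.  No inverse function theorem in several variables is needed: locally, \<open>n\<close> of the functions
  are injective functions of one variable composed with an invertible affine map.
\<close>

section \<open>Holomorphic functions of several variables\<close>

text \<open>An embedding in C^N has finitely many components, whereas the identity theorem only
  handles all exponents at once: differentiation raises the exponent by one, so the values of all
  exponents at a point amount to a Taylor series there. Compactness of the period cell then bounds
  the exponent; the delicate points are those of the lattice, where values blow up. The untwisted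
  sums see z only through the classes f_i(z), hence never separate points that differ by an element
  of the kernel. A single twisted sum could do so, but it is multivalued on E^n. Let B be the block
  of n independent rows and C = B^-1. On lambda = B d the characters exp(2 pi i C_ji
  coord(lambda_i)) multiply to exp(2 pi i coord(d_j)), where coord is either real coordinate with
  respect to the periods: this is 1 when d_j is a period, and the two coordinates together detect
  any other d_j. Exponents start at 4 because every term is then dominated by a product of two
  inverse squares, which makes absolute convergence elementary.\<close>

definition has_cderiv :: "nat \<Rightarrow> (cvec \<Rightarrow> complex) \<Rightarrow> (nat \<Rightarrow> complex) \<Rightarrow> cvec \<Rightarrow> cvec set \<Rightarrow> bool" where
  "has_cderiv m f c p W \<longleftrightarrow>
     (\<forall>e>0. \<forall>\<^sub>F x in at p within W.
        cmod (f x - f p - (\<Sum>i<m. c i * (x i - p i))) \<le> e * (\<Sum>i<m. cmod (x i - p i)))"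

lemma mult_half_divide_cancel: "(a::real) > 0 \<Longrightarrow> a * (e / (2 * a) * x) = e / 2 * x"
  by simp

lemma cspace_eq_iff: "x \<in> cspace m \<Longrightarrow> y \<in> cspace m \<Longrightarrow> x = y \<longleftrightarrow> (\<forall>i<m. x i = y i)"
  unfolding cspace_def fun_eq_iff by (metis (mono_tags, lifting) mem_Collect_eq not_less)

lemma sum_cmod_diff_pos:
  assumes "x \<in> cspace m" "p \<in> cspace m" "x \<noteq> p"
  shows "(\<Sum>i<m. cmod (x i - p i)) > 0"
proof -
  obtain i where "i < m" "x i \<noteq> p i" using assms cspace_eq_iff by blast
  then show ?thesis by (intro sum_pos2[of _ i]) auto
qed

text \<open>The denominator is positive for \<open>x\<close> other than \<open>p\<close>, since
  distinct points of \<open>cspace m\<close> differ in a coordinate below \<open>m\<close>. Clearing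
  it gives an inequality that also holds at \<open>p\<close> itself and is easier to add and to
  compose. Passing back to a strict bound costs a factor 2 in \<open>e\<close>.\<close>

lemma holomorphic_fun_iff:
  "holomorphic_fun m f W \<longleftrightarrow> openin (cspace_top m) W \<and> (\<forall>p\<in>W. \<exists>c. has_cderiv m f c p W)"
proof -
  have "((\<lambda>x. (f x - f p - (\<Sum>i<m. c i * (x i - p i))) / of_real (\<Sum>i<m. cmod (x i - p i))) \<longlongrightarrow> 0) (at p within W)
     \<longleftrightarrow> has_cderiv m f c p W" if W: "W \<subseteq> cspace m" and p: "p \<in> W" for p c
  proof -
    let ?N = "\<lambda>x. cmod (f x - f p - (\<Sum>i<m. c i * (x i - p i)))" and ?D = "\<lambda>x. (\<Sum>i<m. cmod (x i - p i))"
    have ev: "\<forall>\<^sub>F x in at p within W. ?D x > 0"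
      using W p by (auto simp: eventually_at_filter intro!: sum_cmod_diff_pos always_eventually)
    have "((\<lambda>x. (f x - f p - (\<Sum>i<m. c i * (x i - p i))) / of_real (?D x)) \<longlongrightarrow> 0) (at p within W)
      \<longleftrightarrow> (\<forall>e>0. \<forall>\<^sub>F x in at p within W. ?N x / ?D x < e)" (is "?L \<longleftrightarrow> _")
      by (simp add: tendsto_iff dist_norm norm_divide sum_nonneg flip: of_real_sum)
    also have "\<dots> \<longleftrightarrow> has_cderiv m f c p W"
    proof
      assume *: "\<forall>e>0. \<forall>\<^sub>F x in at p within W. ?N x / ?D x < e"
      show "has_cderiv m f c p W"
        unfolding has_cderiv_def
      proof (intro allI impI)
        fix e :: real assume "e > 0"
        with * have "\<forall>\<^sub>F x in at p within W. ?N x / ?D x < e" by blast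
        with ev show "\<forall>\<^sub>F x in at p within W. ?N x \<le> e * ?D x"
          by eventually_elim (simp add: field_simps)
      qed
    next
      assume *: "has_cderiv m f c p W"
      show "\<forall>e>0. \<forall>\<^sub>F x in at p within W. ?N x / ?D x < e"
      proof (intro allI impI)
        fix e :: real assume "e > 0"
        then have "\<forall>\<^sub>F x in at p within W. ?N x \<le> (e/2) * ?D x" using * unfolding has_cderiv_def by (meson half_gt_zero)
        with ev show "\<forall>\<^sub>F x in at p within W. ?N x / ?D x < e"
        proof eventually_elim
          case (elim x)
          then have "?N x < e * ?D x" using \<open>e > 0\<close> by (smt (verit) field_sum_of_halves mult_pos_pos distrib_right half_gt_zero)
          then show ?case using elim by (simp add: field_simps)
        qed
      qed
    qed
    finally show ?thesis .
  qed
  moreover have "openin (cspace_top m) W \<Longrightarrow> W \<subseteq> cspace m"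
    by (metis cspace_top_def openin_imp_subset)
  ultimately show ?thesis unfolding holomorphic_fun_def by blast
qed

lemma openin_cspace_top: "openin (cspace_top m) W \<longleftrightarrow> (\<exists>T. open T \<and> W = cspace m \<inter> T)"
  by (auto simp: cspace_top_def openin_open)

lemma openin_cspace_subset: "openin (cspace_top m) W \<Longrightarrow> W \<subseteq> cspace m"
  by (auto simp: openin_cspace_top)

lemma topspace_cspace_top [simp]: "topspace (cspace_top m) = cspace m"
  by (simp add: cspace_top_def)

lemma has_cderiv_mono: "has_cderiv m f c p W \<Longrightarrow> V \<subseteq> W \<Longrightarrow> has_cderiv m f c p V"
  unfolding has_cderiv_def by (meson at_le filter_leD)

text \<open>\<open>V\<close> is the trace on \<open>cspace m\<close> of an open set around
  \<open>p\<close>, so the filters \<open>at p within V\<close> and \<open>at p within W\<close>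
  coincide; locality of holomorphy rests on this.\<close>

lemma has_cderiv_local:
  assumes "has_cderiv m f c p V" "p \<in> V" "V \<subseteq> W" "openin (cspace_top m) V" "W \<subseteq> cspace m"
    and "\<And>x. x \<in> V \<Longrightarrow> g x = f x"
  shows "has_cderiv m g c p W"
proof -
  obtain T where T: "open T" "V = cspace m \<inter> T" using assms(4) by (auto simp: openin_cspace_top)
  have "at p within W = at p within V"
    by (rule at_within_nhd[of _ T]) (use T assms in auto)
  moreover have "\<forall>\<^sub>F x in at p within V. x \<in> V" by (simp add: eventually_at_filter)
  ultimately show ?thesis using assms(1,2,6) unfolding has_cderiv_def
    by (auto intro: eventually_mono[OF eventually_conj])
qed

lemma holomorphic_fun_openin: "holomorphic_fun m f W \<Longrightarrow> openin (cspace_top m) W"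
  by (simp add: holomorphic_fun_def)

lemma holomorphic_fun_subset:
  "holomorphic_fun m f W \<Longrightarrow> openin (cspace_top m) V \<Longrightarrow> V \<subseteq> W \<Longrightarrow> holomorphic_fun m f V"
  unfolding holomorphic_fun_iff using has_cderiv_mono by blast

lemma holomorphic_fun_local:
  assumes "openin (cspace_top m) W"
    and "\<And>p. p \<in> W \<Longrightarrow> \<exists>V f. p \<in> V \<and> V \<subseteq> W \<and> holomorphic_fun m f V \<and> (\<forall>x\<in>V. g x = f x)"
  shows "holomorphic_fun m g W"
  unfolding holomorphic_fun_iff
proof (intro conjI ballI assms(1))
  fix p assume "p \<in> W"
  then obtain V f where "p \<in> V" "V \<subseteq> W" "holomorphic_fun m f V" "\<forall>x\<in>V. g x = f x" using assms(2) by metis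
  moreover from this obtain c where "has_cderiv m f c p V" by (auto simp: holomorphic_fun_iff)
  ultimately show "\<exists>c. has_cderiv m g c p W"
    using has_cderiv_local[of m f c p V W g] assms(1) openin_cspace_subset
    by (metis holomorphic_fun_openin)
qed

lemma holomorphic_fun_cong:
  "holomorphic_fun m f W \<Longrightarrow> (\<And>x. x \<in> W \<Longrightarrow> g x = f x) \<Longrightarrow> holomorphic_fun m g W"
  by (rule holomorphic_fun_local) (auto simp: holomorphic_fun_openin)

lemma tendsto_cvec_coord: "((f :: 'b \<Rightarrow> cvec) \<longlongrightarrow> l) F \<Longrightarrow> ((\<lambda>x. f x i) \<longlongrightarrow> l i) F"
  by (rule continuous_on_tendsto_compose[OF continuous_on_product_coordinates]) auto

lemma sum_cmod_tendsto_0: "((\<lambda>x::cvec. \<Sum>i<m. cmod (x i - p i)) \<longlongrightarrow> 0) (at p within W)"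
proof -
  have "((\<lambda>x::cvec. \<Sum>i<m. cmod (x i - p i)) \<longlongrightarrow> (\<Sum>i<m. cmod (p i - p i))) (at p within W)"
    by (intro tendsto_intros tendsto_cvec_coord tendsto_ident_at)
  then show ?thesis by simp
qed

text \<open>Differentiability with \<open>e = 1\<close> bounds the remainder, and the linear part
  contributes the sum of the \<open>cmod (c i)\<close>. Both chain rules need this linear growth,
  and continuity follows from it.\<close>

lemma has_cderiv_lipschitz:
  assumes "has_cderiv m f c p W"
  shows "\<exists>B>0. \<forall>\<^sub>F x in at p within W. cmod (f x - f p) \<le> B * (\<Sum>i<m. cmod (x i - p i))"
proof (intro exI conjI)
  let ?B = "1 + (\<Sum>i<m. cmod (c i))"
  show "?B > 0" by (simp add: add_pos_nonneg sum_nonneg)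
  have "\<forall>\<^sub>F x in at p within W. cmod (f x - f p - (\<Sum>i<m. c i * (x i - p i))) \<le> 1 * (\<Sum>i<m. cmod (x i - p i))"
    using assms[unfolded has_cderiv_def, rule_format, of 1] by simp
  then show "\<forall>\<^sub>F x in at p within W. cmod (f x - f p) \<le> ?B * (\<Sum>i<m. cmod (x i - p i))"
  proof eventually_elim
    case (elim x)
    have "cmod (\<Sum>i<m. c i * (x i - p i)) \<le> (\<Sum>i<m. cmod (c i) * cmod (x i - p i))"
      by (rule sum_norm_le) (simp add: norm_mult)
    also have "\<dots> \<le> (\<Sum>i<m. cmod (c i) * (\<Sum>i<m. cmod (x i - p i)))"
      by (intro sum_mono mult_left_mono member_le_sum) auto
    finally have "cmod (\<Sum>i<m. c i * (x i - p i)) \<le> (\<Sum>i<m. cmod (c i)) * (\<Sum>i<m. cmod (x i - p i))"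
      by (simp add: sum_distrib_right)
    moreover have "cmod (f x - f p) \<le> cmod (f x - f p - (\<Sum>i<m. c i * (x i - p i))) + cmod (\<Sum>i<m. c i * (x i - p i))"
      by (metis diff_add_cancel norm_triangle_ineq)
    ultimately show ?case using elim by (simp add: algebra_simps)
  qed
qed

lemma has_cderiv_tendsto:
  assumes "has_cderiv m f c p W"
  shows "(f \<longlongrightarrow> f p) (at p within W)"
proof -
  obtain B where B: "B > 0" "\<forall>\<^sub>F x in at p within W. cmod (f x - f p) \<le> B * (\<Sum>i<m. cmod (x i - p i))"
    using has_cderiv_lipschitz[OF assms] by blast
  have "((\<lambda>x::cvec. B * (\<Sum>i<m. cmod (x i - p i))) \<longlongrightarrow> 0) (at p within W)"
    using tendsto_mult_right_zero[OF sum_cmod_tendsto_0] by blast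
  with B(2) have "((\<lambda>x. f x - f p) \<longlongrightarrow> 0) (at p within W)"
    by (rule Lim_null_comparison)
  then show ?thesis using LIM_zero_cancel by blast
qed

lemma holomorphic_fun_continuous: "holomorphic_fun m f W \<Longrightarrow> continuous_on W f"
proof (unfold continuous_on_def, rule ballI)
  fix p assume "holomorphic_fun m f W" "p \<in> W"
  then obtain c where "has_cderiv m f c p W" by (auto simp: holomorphic_fun_iff)
  then show "(f \<longlongrightarrow> f p) (at p within W)" by (rule has_cderiv_tendsto)
qed

lemma continuous_on_cvec: "(\<And>i. continuous_on W (\<lambda>x. F x i)) \<Longrightarrow> continuous_on W (F :: 'a::topological_space \<Rightarrow> cvec)"
  by (rule continuous_on_coordinatewise_then_product)

lemma holomorphic_vec_continuous:
  assumes "holomorphic_vec m k F W" shows "continuous_on W F"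
proof (rule continuous_on_cvec)
  fix i show "continuous_on W (\<lambda>x. F x i)"
  proof (cases "i < k")
    case True then show ?thesis using assms by (auto simp: holomorphic_vec_def intro: holomorphic_fun_continuous)
  next
    case False
    have "F x i = 0" if "x \<in> W" for x
      using assms that False by (fastforce simp: holomorphic_vec_def cspace_def)
    then show ?thesis by (simp cong: continuous_on_cong)
  qed
qed

lemma holomorphic_vec_continuous_map:
  assumes "holomorphic_vec m k F W"
  shows "continuous_map (subtopology (cspace_top m) W) (cspace_top k) F"
proof -
  have "W \<subseteq> cspace m" "F ` W \<subseteq> cspace k" using assms openin_cspace_subset by (auto simp: holomorphic_vec_def)
  moreover from this have "subtopology (cspace_top m) W = top_of_set W"
    by (simp add: cspace_top_def subtopology_subtopology Int_absorb1)
  ultimately show ?thesis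
    using holomorphic_vec_continuous[OF assms] by (simp add: cspace_top_def continuous_map_in_subtopology image_subset_iff_funcset)
qed

lemma holomorphic_vec_openin_vimage:
  assumes "holomorphic_vec m k F W" "openin (cspace_top k) V"
  shows "openin (cspace_top m) {x \<in> W. F x \<in> V}"
proof -
  have "W \<subseteq> cspace m" "openin (cspace_top m) W" using assms openin_cspace_subset by (auto simp: holomorphic_vec_def)
  moreover from openin_continuous_map_preimage[OF holomorphic_vec_continuous_map[OF assms(1)] assms(2)]
  have "openin (subtopology (cspace_top m) W) {x \<in> W. F x \<in> V}"
    using calculation by (simp add: Int_absorb1)
  ultimately show ?thesis using openin_trans_full by blast
qed

lemma holomorphic_fun_compose:
  assumes f: "holomorphic_fun k f V" and G: "holomorphic_vec m k G W" and GW: "G ` W \<subseteq> V"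
  shows "holomorphic_fun m (\<lambda>x. f (G x)) W"
  unfolding holomorphic_fun_iff
proof (intro conjI ballI)
  show "openin (cspace_top m) W" using G by (simp add: holomorphic_vec_def)
  fix p assume p: "p \<in> W"
  have "\<forall>j. \<exists>c. j < k \<longrightarrow> has_cderiv m (\<lambda>x. G x j) c p W"
    using G p by (auto simp: holomorphic_vec_def holomorphic_fun_iff)
  then obtain D where D: "\<And>j. j < k \<Longrightarrow> has_cderiv m (\<lambda>x. G x j) (D j) p W" by metis
  obtain c where c: "has_cderiv k f c (G p) V" using f p GW by (auto simp: holomorphic_fun_iff)
  let ?N = "\<lambda>x. \<Sum>i<m. cmod (x i - p i)"
  define L where "L x = (\<Sum>i<m. (\<Sum>j<k. c j * D j i) * (x i - p i))" for x
  have "\<forall>j\<in>{..<k}. \<exists>B>0. \<forall>\<^sub>F x in at p within W. cmod (G x j - G p j) \<le> B * ?N x"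
    using has_cderiv_lipschitz[OF D] by auto
  from bchoice[OF this] obtain B where B: "\<And>j. j < k \<Longrightarrow> B j > 0"
      "\<And>j. j < k \<Longrightarrow> \<forall>\<^sub>F x in at p within W. cmod (G x j - G p j) \<le> B j * ?N x"
    by auto
  define BB where "BB = 1 + (\<Sum>j<k. B j)"
  have BB: "BB > 0" unfolding BB_def using B(1) by (intro add_pos_nonneg sum_nonneg) (auto simp: less_imp_le)
  have sumB: "\<forall>\<^sub>F x in at p within W. (\<Sum>j<k. cmod (G x j - G p j)) \<le> BB * ?N x"
  proof -
    have "\<forall>\<^sub>F x in at p within W. \<forall>j\<in>{..<k}. cmod (G x j - G p j) \<le> B j * ?N x"
      by (rule eventually_ball_finite) (use B in auto)
    then show ?thesis
    proof eventually_elim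
      case (elim x)
      then have "(\<Sum>j<k. cmod (G x j - G p j)) \<le> (\<Sum>j<k. B j * ?N x)" by (intro sum_mono) auto
      also have "\<dots> \<le> BB * ?N x" by (simp add: BB_def algebra_simps sum_distrib_right[symmetric] sum_nonneg)
      finally show ?case .
    qed
  qed
  have "has_cderiv m (\<lambda>x. f (G x)) (\<lambda>i. \<Sum>j<k. c j * D j i) p W"
    unfolding has_cderiv_def L_def[symmetric]
  proof (intro allI impI)
    fix e :: real assume e: "e > 0"
    \<comment> \<open>The outer remainder is amplified by at most \<open>BB\<close>, the inner ones
      by the sum of the \<open>cmod (c j)\<close>; each gets half of \<open>e\<close>. The summand 1
      in both bounds keeps the divisors positive.\<close>
    define e1 where "e1 = e / (2 * BB)"
    define e2 where "e2 = e / (2 * (1 + (\<Sum>j<k. cmod (c j))))"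
    have C: "1 + (\<Sum>j<k. cmod (c j)) > 0" by (simp add: add_pos_nonneg sum_nonneg)
    have e1: "e1 > 0" and e2: "e2 > 0" using e BB C by (auto simp: e1_def e2_def)
    have Gt: "(G \<longlongrightarrow> G p) (at p within W)"
      using holomorphic_vec_continuous[OF G] p by (auto simp: continuous_on_def)
    have "\<forall>\<^sub>F y in at (G p) within V. cmod (f y - f (G p) - (\<Sum>j<k. c j * (y j - G p j))) \<le> e1 * (\<Sum>j<k. cmod (y j - G p j))"
      using c e1 by (auto simp: has_cderiv_def)
    \<comment> \<open>\<open>G\<close> may take the value \<open>G p\<close> at points other than
      \<open>p\<close>, so the punctured filter has to be replaced by \<open>nhds\<close>; at
      \<open>G p\<close> both sides of the inequality are 0.\<close>
    then have "\<forall>\<^sub>F y in nhds (G p). y \<in> V \<longrightarrow> cmod (f y - f (G p) - (\<Sum>j<k. c j * (y j - G p j))) \<le> e1 * (\<Sum>j<k. cmod (y j - G p j))"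
      unfolding eventually_at_filter by eventually_elim (auto intro!: mult_nonneg_nonneg simp: less_imp_le[OF e1])
    from eventually_compose_filterlim[OF this Gt]
    have 1: "\<forall>\<^sub>F x in at p within W. G x \<in> V \<longrightarrow> cmod (f (G x) - f (G p) - (\<Sum>j<k. c j * (G x j - G p j))) \<le> e1 * (\<Sum>j<k. cmod (G x j - G p j))" .
    have 2: "\<forall>\<^sub>F x in at p within W. \<forall>j\<in>{..<k}. cmod (G x j - G p j - (\<Sum>i<m. D j i * (x i - p i))) \<le> e2 * ?N x"
      by (rule eventually_ball_finite) (use D e2 in \<open>auto simp: has_cderiv_def\<close>)
    have 3: "\<forall>\<^sub>F x in at p within W. x \<in> W" by (simp add: eventually_at_filter)
    from 1 2 3 sumB show "\<forall>\<^sub>F x in at p within W. cmod (f (G x) - f (G p) - L x) \<le> e * ?N x"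
    proof eventually_elim
      case (elim x)
      have L: "L x = (\<Sum>j<k. c j * (\<Sum>i<m. D j i * (x i - p i)))"
        unfolding L_def by (simp add: sum_distrib_left sum_distrib_right mult.assoc) (rule sum.swap)
      have "f (G x) - f (G p) - L x = (f (G x) - f (G p) - (\<Sum>j<k. c j * (G x j - G p j)))
          + (\<Sum>j<k. c j * (G x j - G p j - (\<Sum>i<m. D j i * (x i - p i))))"
        unfolding L by (simp add: right_diff_distrib sum_subtractf)
      then have "cmod (f (G x) - f (G p) - L x) \<le> cmod (f (G x) - f (G p) - (\<Sum>j<k. c j * (G x j - G p j)))
          + cmod (\<Sum>j<k. c j * (G x j - G p j - (\<Sum>i<m. D j i * (x i - p i))))" (is "_ \<le> ?a + ?b")
        by (simp only: norm_triangle_ineq)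
      moreover have "?a \<le> e1 * (BB * ?N x)"
      proof -
        have "?a \<le> e1 * (\<Sum>j<k. cmod (G x j - G p j))" using elim GW by auto
        also have "\<dots> \<le> e1 * (BB * ?N x)" using elim e1 by (intro mult_left_mono) auto
        finally show ?thesis .
      qed
      moreover have "?b \<le> (\<Sum>j<k. cmod (c j) * (e2 * ?N x))"
        using elim by (intro sum_norm_le) (auto simp: norm_mult intro!: mult_left_mono)
      moreover have "(\<Sum>j<k. cmod (c j) * (e2 * ?N x)) \<le> (1 + (\<Sum>j<k. cmod (c j))) * (e2 * ?N x)"
        unfolding sum_distrib_right[symmetric] using e2 by (intro mult_right_mono) (auto intro!: always_eventually mult_nonneg_nonneg sum_nonneg)
      moreover have "e1 * (BB * ?N x) = e / 2 * ?N x" using BB by (simp add: e1_def)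
      moreover have "(1 + (\<Sum>j<k. cmod (c j))) * (e2 * ?N x) = e / 2 * ?N x" unfolding e2_def by (rule mult_half_divide_cancel[OF C])
      ultimately show ?case by linarith
    qed
  qed
  then show "\<exists>c. has_cderiv m (\<lambda>x. f (G x)) c p W" by blast
qed

lemma holomorphic_vec_compose:
  assumes F: "holomorphic_vec k l F V" and G: "holomorphic_vec m k G W" and GW: "G ` W \<subseteq> V"
  shows "holomorphic_vec m l (\<lambda>x. F (G x)) W"
  unfolding holomorphic_vec_def
proof (intro conjI allI impI)
  show "openin (cspace_top m) W" using G by (simp add: holomorphic_vec_def)
  show "(\<lambda>x. F (G x)) ` W \<subseteq> cspace l" using F GW by (auto simp: holomorphic_vec_def)
  fix j assume "j < l"
  then have "holomorphic_fun k (\<lambda>y. F y j) V" using F by (simp add: holomorphic_vec_def)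
  from holomorphic_fun_compose[OF this G GW] show "holomorphic_fun m (\<lambda>x. F (G x) j) W" .
qed

lemma holomorphic_vec_subset:
  "holomorphic_vec m k F W \<Longrightarrow> openin (cspace_top m) V \<Longrightarrow> V \<subseteq> W \<Longrightarrow> holomorphic_vec m k F V"
  unfolding holomorphic_vec_def using holomorphic_fun_subset by blast

lemma holomorphic_vec_cong:
  "holomorphic_vec m k F W \<Longrightarrow> (\<And>x. x \<in> W \<Longrightarrow> G x = F x) \<Longrightarrow> holomorphic_vec m k G W"
  unfolding holomorphic_vec_def by (auto simp: image_subset_iff intro: holomorphic_fun_cong)

lemma holomorphic_vec_local:
  assumes W: "openin (cspace_top m) W"
    and loc: "\<And>p. p \<in> W \<Longrightarrow> \<exists>V F. p \<in> V \<and> V \<subseteq> W \<and> holomorphic_vec m k F V \<and> (\<forall>x\<in>V. G x = F x)"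
  shows "holomorphic_vec m k G W"
  unfolding holomorphic_vec_def
proof (intro conjI allI impI W)
  show "G ` W \<subseteq> cspace k"
    using loc by (fastforce simp: holomorphic_vec_def image_subset_iff)
  fix j assume "j < k"
  show "holomorphic_fun m (\<lambda>x. G x j) W"
  proof (rule holomorphic_fun_local[OF W])
    fix p assume "p \<in> W"
    from loc[OF this] obtain V F where "p \<in> V" "V \<subseteq> W" "holomorphic_vec m k F V" "\<forall>x\<in>V. G x = F x" by blast
    with \<open>j < k\<close> show "\<exists>V f. p \<in> V \<and> V \<subseteq> W \<and> holomorphic_fun m f V \<and> (\<forall>x\<in>V. G x j = f x)"
      by (intro exI[of _ V] exI[of _ "\<lambda>x. F x j"]) (auto simp: holomorphic_vec_def)
  qed
qed

text \<open>The outer function has one variable and a \<open>has_field_derivative\<close> fact, so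
  this is the gate through which one-variable complex analysis enters the calculus of several
  variables.\<close>

lemma has_cderiv_compose1:
  assumes f: "has_cderiv m f c p W" and h: "(h has_field_derivative d) (at (f p))"
  shows "has_cderiv m (\<lambda>x. h (f x)) (\<lambda>i. d * c i) p W"
  unfolding has_cderiv_def
proof (intro allI impI)
  fix e :: real assume e: "e > 0"
  let ?N = "\<lambda>x. \<Sum>i<m. cmod (x i - p i)"
  obtain B where B: "B > 0" "\<forall>\<^sub>F x in at p within W. cmod (f x - f p) \<le> B * ?N x"
    using has_cderiv_lipschitz[OF f] by blast
  define e1 where "e1 = e / (2 * B)"
  define e2 where "e2 = e / (2 * (1 + cmod d))"
  have C: "1 + cmod d > 0" by (simp add: add_pos_nonneg)
  have e1: "e1 > 0" and e2: "e2 > 0" using e B C by (auto simp: e1_def e2_def)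
  have "(h has_derivative (*) d) (at (f p))" using h by (simp add: has_field_derivative_def)
  then have "\<exists>\<delta>>0. \<forall>y. norm (y - f p) < \<delta> \<longrightarrow> cmod (h y - h (f p) - d * (y - f p)) \<le> e1 * norm (y - f p)"
    using e1 by (auto simp: has_derivative_at_alt)
  then have "\<forall>\<^sub>F y in nhds (f p). cmod (h y - h (f p) - d * (y - f p)) \<le> e1 * cmod (y - f p)"
    by (auto simp: eventually_nhds_metric dist_norm)
  from eventually_compose_filterlim[OF this has_cderiv_tendsto[OF f]]
  have 1: "\<forall>\<^sub>F x in at p within W. cmod (h (f x) - h (f p) - d * (f x - f p)) \<le> e1 * cmod (f x - f p)" .
  have 2: "\<forall>\<^sub>F x in at p within W. cmod (f x - f p - (\<Sum>i<m. c i * (x i - p i))) \<le> e2 * ?N x"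
    using f e2 by (auto simp: has_cderiv_def)
  from 1 2 B(2) show "\<forall>\<^sub>F x in at p within W. cmod (h (f x) - h (f p) - (\<Sum>i<m. d * c i * (x i - p i))) \<le> e * ?N x"
  proof eventually_elim
    case (elim x)
    have "h (f x) - h (f p) - (\<Sum>i<m. d * c i * (x i - p i))
      = (h (f x) - h (f p) - d * (f x - f p)) + d * (f x - f p - (\<Sum>i<m. c i * (x i - p i)))"
      by (simp add: sum_distrib_left algebra_simps)
    then have "cmod (h (f x) - h (f p) - (\<Sum>i<m. d * c i * (x i - p i)))
      \<le> cmod (h (f x) - h (f p) - d * (f x - f p)) + cmod (d * (f x - f p - (\<Sum>i<m. c i * (x i - p i))))"
      by (simp only: norm_triangle_ineq)
    also have "\<dots> \<le> e1 * (B * ?N x) + (1 + cmod d) * (e2 * ?N x)"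
    proof (intro add_mono)
      show "cmod (h (f x) - h (f p) - d * (f x - f p)) \<le> e1 * (B * ?N x)"
        using elim e1 by (meson mult_left_mono order_trans less_imp_le)
      show "cmod (d * (f x - f p - (\<Sum>i<m. c i * (x i - p i)))) \<le> (1 + cmod d) * (e2 * ?N x)"
        unfolding norm_mult using elim by (intro mult_mono) auto
    qed
    also have "e1 * (B * ?N x) = e / 2 * ?N x" using B by (simp add: e1_def)
    also have "(1 + cmod d) * (e2 * ?N x) = e / 2 * ?N x" unfolding e2_def by (rule mult_half_divide_cancel[OF C])
    also have "e / 2 * ?N x + e / 2 * ?N x = e * ?N x" by simp
    finally show ?case .
  qed
qed

lemma holomorphic_fun_compose1:
  assumes "holomorphic_fun m f W" "\<And>x. x \<in> W \<Longrightarrow> h field_differentiable (at (f x))"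
  shows "holomorphic_fun m (\<lambda>x. h (f x)) W"
  unfolding holomorphic_fun_iff
proof (intro conjI ballI)
  show "openin (cspace_top m) W" using assms(1) by (rule holomorphic_fun_openin)
  fix p assume p: "p \<in> W"
  then obtain c where "has_cderiv m f c p W" using assms(1) by (auto simp: holomorphic_fun_iff)
  moreover obtain d where "(h has_field_derivative d) (at (f p))"
    using assms(2)[OF p] by (auto simp: field_differentiable_def)
  ultimately show "\<exists>c. has_cderiv m (\<lambda>x. h (f x)) c p W" using has_cderiv_compose1 by blast
qed

section \<open>Sums and products of holomorphic functions\<close>

lemma holomorphic_fun_const: "openin (cspace_top m) W \<Longrightarrow> holomorphic_fun m (\<lambda>x. a) W"
  unfolding holomorphic_fun_iff
  by (auto simp: has_cderiv_def intro!: exI[of _ "\<lambda>_. 0"] always_eventually mult_nonneg_nonneg sum_nonneg)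

lemma holomorphic_fun_coord:
  assumes "openin (cspace_top m) W" shows "holomorphic_fun m (\<lambda>x. x i) W"
proof (cases "i < m")
  case True
  have "has_cderiv m (\<lambda>x. x i) (\<lambda>j. if j = i then 1 else 0) p W" for p
    using True by (auto simp: has_cderiv_def if_distrib[of "\<lambda>a. a * _"] cong: if_cong intro!: always_eventually mult_nonneg_nonneg sum_nonneg)
  then show ?thesis using assms by (auto simp: holomorphic_fun_iff)
next
  case False
  show ?thesis
    by (rule holomorphic_fun_cong[OF holomorphic_fun_const[OF assms, of 0]])
       (use False openin_cspace_subset[OF assms] in \<open>auto simp: cspace_def not_less\<close>)
qed

lemma holomorphic_fun_add:
  assumes "holomorphic_fun m f W" "holomorphic_fun m g W"
  shows "holomorphic_fun m (\<lambda>x. f x + g x) W"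
  unfolding holomorphic_fun_iff
proof (intro conjI ballI)
  show "openin (cspace_top m) W" using assms(1) by (rule holomorphic_fun_openin)
  fix p assume p: "p \<in> W"
  then obtain c d where c: "has_cderiv m f c p W" and d: "has_cderiv m g d p W"
    using assms by (meson holomorphic_fun_iff)
  have "has_cderiv m (\<lambda>x. f x + g x) (\<lambda>i. c i + d i) p W"
    unfolding has_cderiv_def
  proof (intro allI impI)
    fix e :: real assume "e > 0"
    then have "e / 2 > 0" by simp
    with c d have "\<forall>\<^sub>F x in at p within W. cmod (f x - f p - (\<Sum>i<m. c i * (x i - p i))) \<le> (e/2) * (\<Sum>i<m. cmod (x i - p i))"
      "\<forall>\<^sub>F x in at p within W. cmod (g x - g p - (\<Sum>i<m. d i * (x i - p i))) \<le> (e/2) * (\<Sum>i<m. cmod (x i - p i))"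
      unfolding has_cderiv_def by blast+
    then show "\<forall>\<^sub>F x in at p within W. cmod (f x + g x - (f p + g p) - (\<Sum>i<m. (c i + d i) * (x i - p i))) \<le> e * (\<Sum>i<m. cmod (x i - p i))"
    proof eventually_elim
      case (elim x)
      have "f x + g x - (f p + g p) - (\<Sum>i<m. (c i + d i) * (x i - p i)) =
        (f x - f p - (\<Sum>i<m. c i * (x i - p i))) + (g x - g p - (\<Sum>i<m. d i * (x i - p i)))"
        by (simp add: sum.distrib distrib_right)
      then have "cmod (f x + g x - (f p + g p) - (\<Sum>i<m. (c i + d i) * (x i - p i))) \<le>
        cmod (f x - f p - (\<Sum>i<m. c i * (x i - p i))) + cmod (g x - g p - (\<Sum>i<m. d i * (x i - p i)))"
        by (simp only: norm_triangle_ineq)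
      then show ?case using elim by (simp add: field_simps)
    qed
  qed
  then show "\<exists>c. has_cderiv m (\<lambda>x. f x + g x) c p W" by blast
qed

lemma holomorphic_fun_cmult: "holomorphic_fun m f W \<Longrightarrow> holomorphic_fun m (\<lambda>x. a * f x) W"
  by (rule holomorphic_fun_compose1) (auto intro!: derivative_intros)

lemma holomorphic_fun_diff:
  assumes "holomorphic_fun m f W" "holomorphic_fun m g W" shows "holomorphic_fun m (\<lambda>x. f x - g x) W"
  using holomorphic_fun_add[OF assms(1) holomorphic_fun_cmult[OF assms(2), of "-1"]] by simp

text \<open>Polarization reduces products to the square function of one variable.\<close>

lemma holomorphic_fun_mult:
  assumes f: "holomorphic_fun m f W" and g: "holomorphic_fun m g W" shows "holomorphic_fun m (\<lambda>x. f x * g x) W"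
proof -
  have sq: "holomorphic_fun m (\<lambda>x. (h x)\<^sup>2) W" if "holomorphic_fun m h W" for h
    using that by (rule holomorphic_fun_compose1[where h = "\<lambda>z. z\<^sup>2"]) (auto intro!: derivative_intros simp: field_differentiable_power)
  have "holomorphic_fun m (\<lambda>x. (1/4) * ((f x + g x)\<^sup>2 - (f x - g x)\<^sup>2)) W"
    by (intro holomorphic_fun_cmult holomorphic_fun_diff sq holomorphic_fun_add f g)
  then show ?thesis by (rule holomorphic_fun_cong) (simp add: power2_eq_square algebra_simps)
qed

lemma holomorphic_fun_sum:
  assumes "openin (cspace_top m) W" "\<And>i. i \<in> I \<Longrightarrow> holomorphic_fun m (f i) W"
  shows "holomorphic_fun m (\<lambda>x. \<Sum>i\<in>I. f i x) W"
  using assms(2)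
proof (induction I rule: infinite_finite_induct)
  case (insert i I)
  then show ?case unfolding sum.insert[OF insert(1,2)] by (intro holomorphic_fun_add) auto
qed (simp_all only: sum.infinite sum.empty simp_thms not_False_eq_True holomorphic_fun_const[OF assms(1)])

lemma holomorphic_fun_prod:
  assumes "openin (cspace_top m) W" "\<And>i. i \<in> I \<Longrightarrow> holomorphic_fun m (f i) W"
  shows "holomorphic_fun m (\<lambda>x. \<Prod>i\<in>I. f i x) W"
  using assms(2)
proof (induction I rule: infinite_finite_induct)
  case (insert i I)
  then show ?case unfolding prod.insert[OF insert(1,2)] by (intro holomorphic_fun_mult) auto
qed (simp_all only: prod.infinite prod.empty simp_thms not_False_eq_True holomorphic_fun_const[OF assms(1)])

section \<open>Closed holomorphic embeddings\<close>

definition coord_proj :: "nat \<Rightarrow> (nat \<Rightarrow> nat) \<Rightarrow> cvec \<Rightarrow> cvec" where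
  "coord_proj d c y = (\<lambda>i. if i < d then y (c i) else 0)"

lemma coord_proj_in_cspace [simp]: "coord_proj d c y \<in> cspace d"
  by (simp add: coord_proj_def cspace_def)

lemma holomorphic_vec_coord_proj:
  assumes "openin (cspace_top m) W" shows "holomorphic_vec m d (coord_proj d c) W"
  unfolding holomorphic_vec_def
proof (intro conjI allI impI assms)
  fix j assume "j < d"
  then show "holomorphic_fun m (\<lambda>x. coord_proj d c x j) W"
    using holomorphic_fun_coord[OF assms, of "c j"] by (simp add: coord_proj_def)
qed (auto simp: image_subset_iff)

lemma openin_cspace [simp]: "openin (cspace_top m) (cspace m)"
  using openin_topspace[of "cspace_top m"] by simp

text \<open>An adapted chart must send the submanifold to the first \<open>d\<close> coordinates,
  while the coordinates that parametrize it sit at arbitrary places \<open>c i\<close>; the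
  permutation moves them to the front.\<close>

lemma extend_injection_to_permutation:
  fixes c :: "nat \<Rightarrow> nat"
  assumes "inj_on c {..<d}" "c ` {..<d} \<subseteq> {..<N}"
  shows "\<exists>\<pi>. bij_betw \<pi> {..<N} {..<N} \<and> (\<forall>i<d. \<pi> i = c i)"
proof -
  have dN: "d \<le> N" using card_inj_on_le[OF assms] by simp
  have "card {d..<N} = card ({..<N} - c ` {..<d})"
    using assms by (simp add: card_Diff_subset card_image)
  then obtain g where g: "bij_betw g {d..<N} ({..<N} - c ` {..<d})"
    using finite_same_card_bij[of "{d..<N}" "{..<N} - c ` {..<d}"] by auto
  define \<pi> where "\<pi> i = (if i < d then c i else g i)" for i
  have "bij_betw \<pi> {..<d} (c ` {..<d})"
    using assms(1) by (auto simp: bij_betw_def \<pi>_def inj_on_def)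
  moreover have "bij_betw \<pi> {d..<N} ({..<N} - c ` {..<d})"
    using g by (subst bij_betw_cong[of _ _ g]) (auto simp: \<pi>_def)
  ultimately have "bij_betw \<pi> ({..<d} \<union> {d..<N}) (c ` {..<d} \<union> ({..<N} - c ` {..<d}))"
    by (rule bij_betw_combine) auto
  moreover have "{..<d} \<union> {d..<N} = {..<N}" using dN by auto
  moreover have "c ` {..<d} \<union> ({..<N} - c ` {..<d}) = {..<N}" using assms(2) by auto
  ultimately show ?thesis by (intro exI[of _ \<pi>]) (auto simp: \<pi>_def)
qed

text \<open>Inside \<open>W'\<close> the set \<open>S\<close> is the graph of \<open>h\<close> over
  the coordinates selected by \<open>c\<close>. Subtracting \<open>h\<close> from the other
  coordinates flattens the graph, and adding it back is an explicit holomorphic inverse.\<close>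

lemma graph_adapted_chart:
  assumes inj: "inj_on c {..<d}" "c ` {..<d} \<subseteq> {..<N}"
    and h: "holomorphic_vec d N h D" and Yh: "\<And>a. a \<in> D \<Longrightarrow> coord_proj d c (h a) = a"
    and W': "openin (cspace_top N) W'" and hD: "h ` D = W' \<inter> S" and p: "p \<in> W' \<inter> S"
  shows "\<exists>W \<psi>. p \<in> W \<and> adapted_chart N d S W \<psi>"
proof -
  obtain \<pi> where \<pi>: "bij_betw \<pi> {..<N} {..<N}" and \<pi>c: "\<And>i. i < d \<Longrightarrow> \<pi> i = c i"
    using extend_injection_to_permutation[OF inj] by blast
  have dN: "d \<le> N" using card_inj_on_le[OF inj] by simp
  define \<rho> where "\<rho> = inv_into {..<N} \<pi>"
  have \<rho>: "\<rho> l < N" "\<pi> (\<rho> l) = l" if "l < N" for l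
    using \<pi> that unfolding \<rho>_def
    by (metis bij_betw_def inv_into_into lessThan_iff) (metis \<pi> bij_betw_inv_into_right lessThan_iff that)
  have \<rho>\<pi>: "\<rho> (\<pi> i) = i" "\<pi> i < N" if "i < N" for i
    using \<pi> that unfolding \<rho>_def
    by (metis bij_betw_inv_into_left lessThan_iff) (metis \<pi> bij_betwE lessThan_iff that)
  have D: "openin (cspace_top d) D" "D \<subseteq> cspace d" and hN: "\<And>a. a \<in> D \<Longrightarrow> h a \<in> cspace N"
    using h openin_cspace_subset by (auto simp: holomorphic_vec_def)
  let ?Y = "coord_proj d c" and ?tr = "coord_proj d (\<lambda>i. i)"
  define W where "W = {y \<in> W'. ?Y y \<in> D}"
  have W: "openin (cspace_top N) W"
    unfolding W_def by (rule holomorphic_vec_openin_vimage[OF holomorphic_vec_coord_proj[OF W'] D(1)])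
  define \<psi> where "\<psi> y = (\<lambda>i. if i < d then y (c i) else if i < N then y (\<pi> i) - h (?Y y) (\<pi> i) else 0)" for y :: cvec
  \<comment> \<open>At a selected place (\<rho> l < d) the value of \<open>h\<close> already is the
    parameter, because \<open>h\<close> is a section of the selection map; adding
    \<open>x (\<rho> l)\<close> there would count it twice.\<close>
  define \<xi> where "\<xi> x = (\<lambda>l. if l < N then h (?tr x) l + (if \<rho> l < d then 0 else x (\<rho> l)) else 0)" for x :: cvec
  define W2 where "W2 = {x \<in> cspace N. ?tr x \<in> D}"
  have W2: "openin (cspace_top N) W2"
    unfolding W2_def by (rule holomorphic_vec_openin_vimage[OF holomorphic_vec_coord_proj D(1)]) simp
  have hY: "holomorphic_vec N N (\<lambda>y. h (?Y y)) W"
    by (rule holomorphic_vec_compose[OF h holomorphic_vec_coord_proj[OF W]]) (auto simp: W_def)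
  have htr: "holomorphic_vec N N (\<lambda>y. h (?tr y)) W2"
    by (rule holomorphic_vec_compose[OF h holomorphic_vec_coord_proj[OF W2]]) (auto simp: W2_def)
  have \<psi>h: "holomorphic_vec N N \<psi> W"
    unfolding holomorphic_vec_def
  proof (intro conjI allI impI W)
    show "\<psi> ` W \<subseteq> cspace N" using dN by (auto simp: \<psi>_def cspace_def)
    fix j assume j: "j < N"
    have "holomorphic_fun N (\<lambda>y. h (?Y y) (\<pi> j)) W"
      using hY \<rho>\<pi>(2)[OF j] by (simp add: holomorphic_vec_def)
    then show "holomorphic_fun N (\<lambda>x. \<psi> x j) W"
      unfolding \<psi>_def using j
      by (cases "j < d") (simp_all add: holomorphic_fun_coord[OF W] holomorphic_fun_diff)
  qed
  have \<xi>h: "holomorphic_vec N N \<xi> W2"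
    unfolding holomorphic_vec_def
  proof (intro conjI allI impI W2)
    show "\<xi> ` W2 \<subseteq> cspace N" by (auto simp: \<xi>_def cspace_def)
    fix j assume j: "j < N"
    have "holomorphic_fun N (\<lambda>y. h (?tr y) j) W2"
      using htr j by (simp add: holomorphic_vec_def)
    then show "holomorphic_fun N (\<lambda>x. \<xi> x j) W2"
      unfolding \<xi>_def using j
      by (cases "\<rho> j < d") (simp_all add: holomorphic_fun_coord[OF W2] holomorphic_fun_add)
  qed
  \<comment> \<open>This is the full image of \<open>\<psi>\<close>: membership of
    \<open>\<xi> x\<close> in \<open>W'\<close> is the one condition that the domain
    \<open>W2\<close> of \<open>\<xi>\<close> does not yet contain.\<close>
  define V where "V = {x \<in> W2. \<xi> x \<in> W'}"
  have V: "openin (cspace_top N) V" unfolding V_def by (rule holomorphic_vec_openin_vimage[OF \<xi>h W'])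
  have tr\<psi>: "?tr (\<psi> y) = ?Y y" for y by (auto simp: coord_proj_def \<psi>_def)
  have \<xi>\<psi>: "\<xi> (\<psi> y) = y" if "y \<in> W" for y
  proof
    fix l
    have Yy: "?Y y \<in> D" and yN: "y \<in> cspace N" using that openin_cspace_subset[OF W'] by (auto simp: W_def)
    show "\<xi> (\<psi> y) l = y l"
    proof (cases "l < N")
      case True
      show ?thesis
      proof (cases "\<rho> l < d")
        case rl: True
        then have "l = c (\<rho> l)" using \<pi>c \<rho>(2)[OF True] by metis
        moreover have "h (?Y y) (c (\<rho> l)) = ?Y y (\<rho> l)"
          using fun_cong[OF Yh[OF Yy], of "\<rho> l"] rl by (simp add: coord_proj_def)
        moreover have "?Y y (\<rho> l) = y (c (\<rho> l))" using rl by (simp add: coord_proj_def)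
        ultimately show ?thesis using True rl by (simp add: \<xi>_def tr\<psi>)
      next
        case False
        then show ?thesis using True \<rho>[OF True] by (simp add: \<xi>_def tr\<psi>) (simp add: \<psi>_def)
      qed
    next
      case False
      then show ?thesis using yN by (simp add: \<xi>_def cspace_def)
    qed
  qed
  have Y\<xi>: "?Y (\<xi> x) = ?tr x" if "x \<in> W2" for x
  proof
    fix i
    have "?tr x \<in> D" using that by (simp add: W2_def)
    then have *: "?Y (h (?tr x)) = ?tr x" by (rule Yh)
    show "?Y (\<xi> x) i = ?tr x i"
    proof (cases "i < d")
      case True
      then have ci: "c i < N" "\<rho> (c i) = i" using \<rho>\<pi>[of i] \<pi>c[OF True] dN by auto
      then have "\<xi> x (c i) = h (?tr x) (c i)" using True by (simp add: \<xi>_def)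
      then show ?thesis using fun_cong[OF *, of i] True by (simp add: coord_proj_def)
    qed (simp add: coord_proj_def)
  qed
  have \<psi>\<xi>: "\<psi> (\<xi> x) = x" if "x \<in> W2" for x
  proof
    fix i
    show "\<psi> (\<xi> x) i = x i"
    proof (cases "i < d")
      case True
      then show ?thesis using fun_cong[OF Y\<xi>[OF that], of i] by (simp add: \<psi>_def coord_proj_def)
    next
      case False
      then have "\<psi> (\<xi> x) i = (if i < N then \<xi> x (\<pi> i) - h (?tr x) (\<pi> i) else 0)"
        by (simp add: \<psi>_def Y\<xi>[OF that])
      with False show ?thesis using that \<rho>\<pi>[of i] by (auto simp: \<xi>_def W2_def cspace_def)
    qed
  qed
  have \<psi>V: "\<psi> y \<in> V" if "y \<in> W" for y
    using \<psi>h that \<xi>\<psi>[OF that] by (auto simp: V_def W2_def tr\<psi> W_def holomorphic_vec_def)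
  have \<xi>W: "\<xi> x \<in> W" if "x \<in> V" for x
    using that Y\<xi>[of x] by (auto simp: V_def W_def W2_def)
  have im: "\<psi> ` W = V"
  proof
    show "\<psi> ` W \<subseteq> V" using \<psi>V by blast
    show "V \<subseteq> \<psi> ` W" using \<psi>\<xi> \<xi>W by (metis (no_types, lifting) V_def imageI mem_Collect_eq subsetI)
  qed
  have injW: "inj_on \<psi> W" by (metis inj_onI \<xi>\<psi>)
  have "inv_into W \<psi> x = \<xi> x" if "x \<in> V" for x
    using inv_into_f_f[OF injW \<xi>W[OF that]] \<psi>\<xi>[of x] that by (simp add: V_def)
  then have "holomorphic_vec N N (inv_into W \<psi>) (\<psi> ` W)"
    unfolding im by (intro holomorphic_vec_cong[OF holomorphic_vec_subset[OF \<xi>h V]]) (auto simp: V_def)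
  then have "cspace_biholomorphism N W \<psi>"
    using \<psi>h injW by (simp add: cspace_biholomorphism_def)
  moreover have "\<psi> ` (W \<inter> S) = \<psi> ` W \<inter> cspace d"
  proof
    have "\<psi> y \<in> cspace d" if "y \<in> W" "y \<in> S" for y
    proof -
      have "y \<in> h ` D" using that hD by (auto simp: W_def)
      then have "h (?Y y) = y" using Yh by auto
      then show ?thesis by (simp add: \<psi>_def cspace_def)
    qed
    then show "\<psi> ` (W \<inter> S) \<subseteq> \<psi> ` W \<inter> cspace d" by auto
    have "y \<in> S" if y: "y \<in> W" "\<psi> y \<in> cspace d" for y
    proof -
      have YD: "?Y y \<in> D" using y by (simp add: W_def)
      have "\<xi> (\<psi> y) l = h (?Y y) l" for l
        using y(2) hN[OF YD] by (auto simp: \<xi>_def tr\<psi> cspace_def)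
      then have "y = h (?Y y)" using \<xi>\<psi>[OF y(1)] by auto
      then show ?thesis using YD hD by blast
    qed
    then show "\<psi> ` W \<inter> cspace d \<subseteq> \<psi> ` (W \<inter> S)" by auto
  qed
  moreover have "p \<in> W"
  proof -
    have "p \<in> h ` D" using p hD by blast
    then show ?thesis using p Yh by (auto simp: W_def)
  qed
  ultimately show ?thesis by (auto simp: adapted_chart_def)
qed

lemma chart_inj: "is_chart X d (U, \<phi>) \<Longrightarrow> inj_on \<phi> U"
  unfolding is_chart_def using homeomorphic_imp_injective_map openin_subset
  by (fastforce simp: Int_absorb1)

lemma chart_openin:
  assumes "is_chart X d (U, \<phi>)" "openin X V" "V \<subseteq> U"
  shows "openin (cspace_top d) (\<phi> ` V)"
proof -
  have "open_map (subtopology X U) (subtopology (cspace_top d) (\<phi> ` U)) \<phi>" "openin (cspace_top d) (\<phi> ` U)"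
    using assms(1) by (auto simp: is_chart_def homeomorphic_imp_open_map)
  moreover have "openin (subtopology X U) V" using assms by (metis openin_subset_topspace_eq openin_subtopology_Int2 Int_absorb2 inf_commute)
  ultimately show ?thesis using openin_trans_full by (metis open_map_def)
qed

lemma holomorphic_mapI:
  assumes "continuous_map (mtop M) (mtop N) f"
    and "\<And>U \<phi> V \<psi>. (U, \<phi>) \<in> atlas M \<Longrightarrow> (V, \<psi>) \<in> atlas N \<Longrightarrow>
      holomorphic_vec (mdim M) (mdim N) (\<psi> \<circ> f \<circ> inv_into U \<phi>) (\<phi> ` {x \<in> U. f x \<in> V})"
  shows "holomorphic_map M N f"
  using assms unfolding holomorphic_map_def by auto

text \<open>Closedness of the map does double duty: the image is closed, and an injective continuous
  closed map is a homeomorphism onto its image. In \<open>loc\<close>, some \<open>mdim M\<close>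
  components of \<open>\<Phi>\<close> determine a chart through a holomorphic \<open>T\<close>; this
  yields the graph description of the image as well as the holomorphy of the inverse.\<close>

lemma stein_criterion:
  fixes M :: "'a cmanifold" and \<Phi> :: "'a \<Rightarrow> cvec"
  assumes M: "complex_manifold M" and dN: "mdim M \<le> N"
    and hol: "\<And>U \<phi>. (U, \<phi>) \<in> atlas M \<Longrightarrow> holomorphic_vec (mdim M) N (\<lambda>x. \<Phi> (inv_into U \<phi> x)) (\<phi> ` U)"
    and inj: "inj_on \<Phi> (topspace (mtop M))"
    and closed: "closed_map (mtop M) (cspace_top N) \<Phi>"
    and loc: "\<And>p. p \<in> topspace (mtop M) \<Longrightarrow> \<exists>U \<phi> c T. (U, \<phi>) \<in> atlas M \<and> p \<in> U \<and>
      inj_on c {..<mdim M} \<and> c ` {..<mdim M} \<subseteq> {..<N} \<and>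
      holomorphic_vec (mdim M) (mdim M) T ((\<lambda>u. coord_proj (mdim M) c (\<Phi> u)) ` U) \<and>
      (\<forall>u\<in>U. T (coord_proj (mdim M) c (\<Phi> u)) = \<phi> u)"
  shows "stein_manifold M"
proof -
  define X where "X = mtop M"
  define d where "d = mdim M"
  define S where "S = \<Phi> ` topspace X"
  have chart: "\<And>U \<phi>. (U, \<phi>) \<in> atlas M \<Longrightarrow> is_chart X d (U, \<phi>)"
    and cover: "(\<Union>(U, \<phi>)\<in>atlas M. U) = topspace X"
    and trans: "\<And>U \<phi> V \<psi>. (U, \<phi>) \<in> atlas M \<Longrightarrow> (V, \<psi>) \<in> atlas M \<Longrightarrow>
        holomorphic_vec d d (\<psi> \<circ> inv_into U \<phi>) (\<phi> ` (U \<inter> V))"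
    using M unfolding complex_manifold_def X_def d_def by auto
  have Uo: "openin X U" "U \<subseteq> topspace X" if "(U, \<phi>) \<in> atlas M" for U \<phi>
    using chart[OF that] openin_subset by (auto simp: is_chart_def)
  have cont: "continuous_map X (cspace_top N) \<Phi>"
  proof (rule pasting_lemma[where I = "atlas M" and T = fst and f = "\<lambda>_. \<Phi>"])
    fix c assume c: "c \<in> atlas M"
    obtain U \<phi> where [simp]: "c = (U, \<phi>)" by fastforce
    note c = c[simplified]
    show "openin X (fst c)" using Uo(1)[OF c] by simp
    have "continuous_map (subtopology X U) (subtopology (cspace_top d) (\<phi> ` U)) \<phi>"
      using chart[OF c] Uo(2)[OF c] by (auto simp: is_chart_def intro: homeomorphic_imp_continuous_map)
    from continuous_map_compose[OF this holomorphic_vec_continuous_map[OF hol[OF c, folded d_def]]]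
    have "continuous_map (subtopology X U) (cspace_top N) ((\<lambda>x. \<Phi> (inv_into U \<phi> x)) \<circ> \<phi>)" .
    then have "continuous_map (subtopology X U) (cspace_top N) \<Phi>"
      by (rule continuous_map_eq) (use Uo(2)[OF c] chart_inj[OF chart[OF c]] in auto)
    then show "continuous_map (subtopology X (fst c)) (cspace_top N) \<Phi>" by simp
  next
    fix x assume "x \<in> topspace X"
    then show "\<exists>j. j \<in> atlas M \<and> x \<in> fst j \<and> \<Phi> x = \<Phi> x" using cover by fastforce
  qed auto
  have closedS: "closedin (cspace_top N) S"
    using closed unfolding S_def X_def closed_map_def by blast
  have SN: "S \<subseteq> cspace N" using closedin_subset[OF closedS] by simp
  have homeo: "homeomorphic_map X (subtopology (cspace_top N) S) \<Phi>"
  proof (rule bijective_closed_imp_homeomorphic_map)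
    show "continuous_map X (subtopology (cspace_top N) S) \<Phi>"
      using cont by (simp add: continuous_map_in_subtopology S_def)
    show "closed_map X (subtopology (cspace_top N) S) \<Phi>"
      using closed unfolding X_def[symmetric] by (rule closed_map_into_subtopology) (auto simp: S_def)
    show "\<Phi> ` topspace X = topspace (subtopology (cspace_top N) S)"
      using SN by (auto simp: S_def)
    show "inj_on \<Phi> (topspace X)" using inj by (simp add: X_def)
  qed
  have open_im: "\<exists>W'. openin (cspace_top N) W' \<and> \<Phi> ` V = W' \<inter> S" if "openin X V" for V
  proof -
    have "openin (subtopology (cspace_top N) S) (\<Phi> ` V)"
      using homeomorphic_imp_open_map[OF homeo] that by (simp add: open_map_def)
    then show ?thesis by (auto simp: openin_subtopology)
  qed
  define g where "g = inv_into (topspace X) \<Phi>"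
  have g\<Phi>: "g (\<Phi> u) = u" if "u \<in> topspace X" for u
    using inj that by (simp add: g_def X_def)
  have \<Phi>g: "\<Phi> (g y) = y" "g y \<in> topspace X" if "y \<in> S" for y
    using that by (auto simp: g_def S_def f_inv_into_f inv_into_into)
  have adapted: "\<exists>W \<psi>. p \<in> W \<and> adapted_chart N d S W \<psi>" if pS: "p \<in> S" for p
  proof -
    obtain U \<phi> c T where U: "(U, \<phi>) \<in> atlas M" "g p \<in> U"
      and c: "inj_on c {..<d}" "c ` {..<d} \<subseteq> {..<N}"
      and T: "holomorphic_vec d d T ((\<lambda>u. coord_proj d c (\<Phi> u)) ` U)"
      and T\<phi>: "\<And>u. u \<in> U \<Longrightarrow> T (coord_proj d c (\<Phi> u)) = \<phi> u"
      using loc[OF \<Phi>g(2)[OF pS, unfolded X_def], folded d_def] by auto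
    define D where "D = (\<lambda>u. coord_proj d c (\<Phi> u)) ` U"
    \<comment> \<open>Going from the selected components through \<open>T\<close> and the chart back
      to the manifold reconstructs all components: near \<open>p\<close> the set \<open>S\<close> is
      the graph of \<open>h\<close>.\<close>
    define h where "h a = \<Phi> (inv_into U \<phi> (T a))" for a
    have hh: "h (coord_proj d c (\<Phi> u)) = \<Phi> u" if "u \<in> U" for u
      using that chart_inj[OF chart[OF U(1)]] by (simp add: h_def T\<phi>)
    have "holomorphic_vec d N h D"
      unfolding h_def
      by (rule holomorphic_vec_compose[OF hol[OF U(1), folded d_def] T[folded D_def]]) (auto simp: D_def T\<phi>)
    moreover have "coord_proj d c (h a) = a" if "a \<in> D" for a
      using that hh by (auto simp: D_def)
    moreover obtain W' where W': "openin (cspace_top N) W'" "\<Phi> ` U = W' \<inter> S"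
      using open_im[OF Uo(1)[OF U(1)]] by blast
    moreover have "h ` D = W' \<inter> S" unfolding W'(2)[symmetric] using hh by (auto simp: D_def image_image)
    moreover have "p \<in> W' \<inter> S" using W'(2) U(2) \<Phi>g(1)[OF pS] by (metis imageI)
    ultimately show ?thesis by (intro graph_adapted_chart[OF c]) 
  qed
  have sub: "closed_complex_submanifold N d S"
    using dN adapted closedS by (simp add: closed_complex_submanifold_def d_def)
  let ?S = "submanifold_structure N d S"
  have f: "holomorphic_map M ?S \<Phi>"
  proof (rule holomorphic_mapI)
    show "continuous_map (mtop M) (mtop ?S) \<Phi>"
      using homeomorphic_imp_continuous_map[OF homeo] by (simp add: X_def submanifold_structure_def)
    fix U \<phi> WS \<psi> assume c1: "(U, \<phi>) \<in> atlas M" and c2: "(WS, \<psi>) \<in> atlas ?S"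
    obtain W where WS: "WS = W \<inter> S" and W: "adapted_chart N d S W \<psi>"
      using c2 by (auto simp: submanifold_structure_def)
    have \<psi>: "holomorphic_vec N N \<psi> W" and \<psi>S: "\<psi> ` (W \<inter> S) \<subseteq> cspace d"
      using W by (auto simp: adapted_chart_def cspace_biholomorphism_def)
    have Wo: "openin (cspace_top N) W" using \<psi> by (simp add: holomorphic_vec_def)
    let ?V = "{x \<in> U. \<Phi> x \<in> W \<inter> S}"
    have V: "?V = {x \<in> topspace X. \<Phi> x \<in> W} \<inter> U" using Uo(2)[OF c1] by (auto simp: S_def)
    have "openin X ?V" unfolding V
      by (intro openin_Int openin_continuous_map_preimage[OF cont Wo] Uo(1)[OF c1])
    then have o: "openin (cspace_top d) (\<phi> ` ?V)" by (rule chart_openin[OF chart[OF c1]]) auto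
    have inv: "inv_into U \<phi> (\<phi> x) = x" if "x \<in> U" for x
      using chart_inj[OF chart[OF c1]] that by simp
    have "holomorphic_vec d N (\<lambda>x. \<psi> (\<Phi> (inv_into U \<phi> x))) (\<phi> ` ?V)"
      by (rule holomorphic_vec_compose[OF \<psi> holomorphic_vec_subset[OF hol[OF c1, folded d_def] o]])
        (auto simp: inv)
    then have "holomorphic_vec d d (\<psi> \<circ> \<Phi> \<circ> inv_into U \<phi>) (\<phi> ` ?V)"
      using \<psi>S dN unfolding holomorphic_vec_def o_def d_def[symmetric] by (auto simp: inv)
    then show "holomorphic_vec (mdim M) (mdim ?S) (\<psi> \<circ> \<Phi> \<circ> inv_into U \<phi>) (\<phi> ` {x \<in> U. \<Phi> x \<in> WS})"
      by (simp add: submanifold_structure_def d_def WS)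
  qed
  have gh: "holomorphic_map ?S M g"
  proof (rule holomorphic_mapI)
    have "homeomorphic_maps X (subtopology (cspace_top N) S) \<Phi> g"
    proof -
      obtain g' where g': "homeomorphic_maps X (subtopology (cspace_top N) S) \<Phi> g'"
        using homeo homeomorphic_map_maps by blast
      then have "continuous_map (subtopology (cspace_top N) S) X g'" "\<And>y. y \<in> S \<Longrightarrow> \<Phi> (g' y) = y"
        using SN by (auto simp: homeomorphic_maps_def)
      moreover have "g y = g' y" if "y \<in> S" for y
      proof -
        have "g' y \<in> topspace X" using calculation(1) SN that by (auto simp: continuous_map_def Pi_iff)
        then show ?thesis using g\<Phi> calculation(2)[OF that] by metis
      qed
      ultimately show ?thesis using g' SN
        by (auto simp: homeomorphic_maps_def g\<Phi> \<Phi>g intro: continuous_map_eq[of _ _ g'])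
    qed
    then show "continuous_map (mtop ?S) (mtop M) g"
      by (simp add: homeomorphic_maps_def submanifold_structure_def X_def)
    fix WS \<psi> V \<phi>' assume c1: "(WS, \<psi>) \<in> atlas ?S" and c2: "(V, \<phi>') \<in> atlas M"
    obtain W where WS: "WS = W \<inter> S" and W: "adapted_chart N d S W \<psi>"
      using c1 by (auto simp: submanifold_structure_def)
    have \<psi>: "holomorphic_vec N N \<psi> W" and \<psi>S: "\<psi> ` (W \<inter> S) = \<psi> ` W \<inter> cspace d"
      and inj\<psi>: "inj_on \<psi> W" and \<psi>i: "holomorphic_vec N N (inv_into W \<psi>) (\<psi> ` W)"
      using W by (auto simp: adapted_chart_def cspace_biholomorphism_def)
    \<comment> \<open>The chart image must be open in \<open>cspace d\<close>. The inverse of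
      \<open>\<psi>\<close> is only known to be holomorphic in dimension \<open>N\<close>, so an
      open set of \<open>cspace N\<close> is produced first and then cut with
      \<open>cspace d\<close>.\<close>
    have op: "openin (cspace_top d) (\<psi> ` {y \<in> W \<inter> S. g y \<in> Q})" if Q: "openin X Q" for Q
    proof -
      obtain Q' where Q': "openin (cspace_top N) Q'" "\<Phi> ` Q = Q' \<inter> S" using open_im[OF Q] by blast
      have gQ: "g y \<in> Q \<longleftrightarrow> y \<in> Q'" if "y \<in> S" for y
      proof
        assume "g y \<in> Q"
        then have "\<Phi> (g y) \<in> \<Phi> ` Q" by (rule imageI)
        then show "y \<in> Q'" using Q'(2) \<Phi>g(1)[OF that] by simp
      next
        assume "y \<in> Q'"
        with that Q'(2) obtain u where "u \<in> Q" "y = \<Phi> u" by blast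
        then show "g y \<in> Q" using g\<Phi>[of u] openin_subset[OF Q] by auto
      qed
      have "\<psi> ` {y \<in> W \<inter> S. g y \<in> Q} = {x \<in> \<psi> ` W. inv_into W \<psi> x \<in> Q'} \<inter> cspace d"
      proof (intro equalityI subsetI)
        fix x assume "x \<in> \<psi> ` {y \<in> W \<inter> S. g y \<in> Q}"
        then obtain y where "x = \<psi> y" "y \<in> W" "y \<in> S" "g y \<in> Q" by blast
        then show "x \<in> {x \<in> \<psi> ` W. inv_into W \<psi> x \<in> Q'} \<inter> cspace d"
          using \<psi>S inj\<psi> gQ by auto
      next
        fix x assume x: "x \<in> {x \<in> \<psi> ` W. inv_into W \<psi> x \<in> Q'} \<inter> cspace d"
        then have "x \<in> \<psi> ` (W \<inter> S)" unfolding \<psi>S by blast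
        then obtain y where "x = \<psi> y" "y \<in> W" "y \<in> S" by blast
        then show "x \<in> \<psi> ` {y \<in> W \<inter> S. g y \<in> Q}" using x inj\<psi> gQ by auto
      qed
      moreover obtain O' where O': "open O'" "{x \<in> \<psi> ` W. inv_into W \<psi> x \<in> Q'} = cspace N \<inter> O'"
        using holomorphic_vec_openin_vimage[OF \<psi>i Q'(1)] by (auto simp: openin_cspace_top)
      moreover have "cspace N \<inter> O' \<inter> cspace d = cspace d \<inter> O'"
        using dN by (auto simp: cspace_def d_def)
      ultimately have "\<psi> ` {y \<in> W \<inter> S. g y \<in> Q} = cspace d \<inter> O'" by simp
      with O'(1) show ?thesis unfolding openin_cspace_top by (intro exI[of _ O'] conjI)
    qed
    have inv1: "inv_into (W \<inter> S) \<psi> (\<psi> y) = y" "inv_into W \<psi> (\<psi> y) = y" if "y \<in> W \<inter> S" for y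
      using inj\<psi> that by (auto intro!: inv_into_f_f intro: inj_on_subset)
    have "holomorphic_vec d d (\<lambda>x. \<phi>' (g (inv_into (W \<inter> S) \<psi> x))) (\<psi> ` {y \<in> W \<inter> S. g y \<in> V})"
    \<comment> \<open>Near \<open>p\<close>, applying \<open>T\<close> to the selected coordinates
      of \<open>y\<close> gives \<open>\<phi> (g y)\<close>, which is therefore holomorphic in
      \<open>y\<close>; a transition map of \<open>M\<close> then changes \<open>\<phi>\<close> to
      the prescribed \<open>\<phi>'\<close>.\<close>
    proof (rule holomorphic_vec_local[OF op[OF Uo(1)[OF c2]]])
      fix q assume "q \<in> \<psi> ` {y \<in> W \<inter> S. g y \<in> V}"
      then obtain p where p: "q = \<psi> p" "p \<in> W" "p \<in> S" "g p \<in> V" by blast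
      obtain U \<phi> c T where U: "(U, \<phi>) \<in> atlas M" "g p \<in> U"
        and T: "holomorphic_vec d d T ((\<lambda>u. coord_proj d c (\<Phi> u)) ` U)"
        and T\<phi>: "\<And>u. u \<in> U \<Longrightarrow> T (coord_proj d c (\<Phi> u)) = \<phi> u"
        using loc[OF \<Phi>g(2)[OF p(3), unfolded X_def], folded d_def] by auto
      let ?O = "\<psi> ` {y \<in> W \<inter> S. g y \<in> U \<inter> V}"
      have O: "openin (cspace_top d) ?O" by (intro op openin_Int Uo(1)[OF c2] Uo(1)[OF U(1)])
      have inv: "inv_into U \<phi> (\<phi> x) = x" if "x \<in> U" for x
        using chart_inj[OF chart[OF U(1)]] that by simp
      have id: "holomorphic_vec d N (\<lambda>x. x) ?O"
        unfolding holomorphic_vec_def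
      proof (intro conjI allI impI O holomorphic_fun_coord)
        show "(\<lambda>x. x) ` ?O \<subseteq> cspace N"
          using openin_cspace_subset[OF O] dN by (fastforce simp: cspace_def d_def)
      qed
      have 1: "holomorphic_vec d N (inv_into W \<psi>) ?O"
        by (rule holomorphic_vec_compose[OF \<psi>i id]) auto
      have 2: "holomorphic_vec d d (\<lambda>x. coord_proj d c (inv_into W \<psi> x)) ?O"
        by (rule holomorphic_vec_compose[OF holomorphic_vec_coord_proj[OF openin_cspace] 1])
           (use 1 in \<open>auto simp: holomorphic_vec_def\<close>)
      have im: "coord_proj d c y \<in> (\<lambda>u. coord_proj d c (\<Phi> u)) ` U" "T (coord_proj d c y) = \<phi> (g y)" if "y \<in> S" "g y \<in> U" for y
        using \<Phi>g[OF that(1)] that(2) T\<phi>[OF that(2)] by (auto intro!: image_eqI[of _ _ "g y"])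
      have 3: "holomorphic_vec d d (\<lambda>x. T (coord_proj d c (inv_into W \<psi> x))) ?O"
        by (rule holomorphic_vec_compose[OF T 2]) (auto simp: inv1 im)
      have 4: "holomorphic_vec d d (\<lambda>x. (\<phi>' \<circ> inv_into U \<phi>) (T (coord_proj d c (inv_into W \<psi> x)))) ?O"
        by (rule holomorphic_vec_compose[OF trans[OF U(1) c2] 3]) (auto simp: inv1 im)
      show "\<exists>V' F. q \<in> V' \<and> V' \<subseteq> \<psi> ` {y \<in> W \<inter> S. g y \<in> V} \<and> holomorphic_vec d d F V' \<and>
          (\<forall>x\<in>V'. \<phi>' (g (inv_into (W \<inter> S) \<psi> x)) = F x)"
      proof (intro exI conjI)
        show "q \<in> ?O" using p U(2) by blast
        show "?O \<subseteq> \<psi> ` {y \<in> W \<inter> S. g y \<in> V}" by blast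
        show "holomorphic_vec d d (\<lambda>x. (\<phi>' \<circ> inv_into U \<phi>) (T (coord_proj d c (inv_into W \<psi> x)))) ?O" by (rule 4)
      qed (auto simp: inv1 im inv)
    qed
    then show "holomorphic_vec (mdim ?S) (mdim M) (\<phi>' \<circ> g \<circ> inv_into WS \<psi>) (\<psi> ` {x \<in> WS. g x \<in> V})"
      by (simp add: submanifold_structure_def d_def o_def WS)
  qed
  have "biholomorphic M ?S"
    unfolding biholomorphic_def
    using f gh g\<Phi> \<Phi>g(1) SN by (intro exI[of _ \<Phi>] exI[of _ g]) (auto simp: X_def submanifold_structure_def)
  then show ?thesis using M sub by (auto simp: stein_manifold_def)
qed

section \<open>Twisted Eisenstein sums\<close>

text \<open>On \<open>S\<close> the \<open>n\<close>-th derivative of \<open>g k0\<close> is a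
  constant multiple of \<open>g (k0 + n)\<close>, so the hypothesis at \<open>z\<close> annihilates
  the whole Taylor series there; only the existence of the constant matters.\<close>

lemma identity_theorem_derivative_chain:
  fixes g :: "nat \<Rightarrow> complex \<Rightarrow> complex"
  assumes S: "open S" "connected S" and zw: "z \<in> S" "w \<in> S"
    and der: "\<And>k s. k \<ge> k0 \<Longrightarrow> s \<in> S \<Longrightarrow> (g k has_field_derivative c k * g (Suc k) s) (at s)"
    and zero: "\<And>k. k \<ge> k0 \<Longrightarrow> g k z = 0"
  shows "g k0 w = 0"
proof -
  have hd: "\<exists>C. \<forall>s\<in>S. (deriv ^^ n) (g k0) s = C * g (k0 + n) s" for n
  proof (induction n)
    case 0 then show ?case by (intro exI[of _ 1]) simp
  next
    case (Suc n)
    then obtain C where C: "\<And>s. s \<in> S \<Longrightarrow> (deriv ^^ n) (g k0) s = C * g (k0 + n) s" by blast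
    have "(deriv ^^ Suc n) (g k0) s = (C * c (k0 + n)) * g (k0 + Suc n) s" if "s \<in> S" for s
    proof -
      have "((\<lambda>s. C * g (k0 + n) s) has_field_derivative C * (c (k0 + n) * g (Suc (k0 + n)) s)) (at s)"
        by (intro DERIV_cmult der that) simp
      then have "((deriv ^^ n) (g k0) has_field_derivative C * (c (k0 + n) * g (Suc (k0 + n)) s)) (at s)"
        by (rule has_field_derivative_transform_within_open[OF _ S(1) that]) (simp add: C)
      then show ?thesis by (simp add: DERIV_imp_deriv)
    qed
    then show ?case by blast
  qed
  have "g k0 holomorphic_on S"
    using der[of k0] S(1) by (auto simp: holomorphic_on_open)
  moreover have "(deriv ^^ n) (g k0) z = 0" for n
    using hd[of n] zw(1) zero[of "k0 + n"] by auto
  ultimately show ?thesis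
    by (rule holomorphic_fun_eq_0_on_connected[OF _ S _ zw])
qed

text \<open>Monotonicity in \<open>K\<close> lets the maximum over a finite subcover serve
  everywhere. This turns the local existence of suitable exponents into one bound.\<close>

lemma compact_uniform_bound:
  fixes Q :: "nat \<Rightarrow> 'a::topological_space \<Rightarrow> bool"
  assumes P: "compact P" and loc: "\<And>p. p \<in> P \<Longrightarrow> \<exists>K. \<forall>\<^sub>F w in nhds p. Q K w"
    and mono: "\<And>K K' w. K \<le> K' \<Longrightarrow> Q K w \<Longrightarrow> Q K' w"
  shows "\<exists>K. \<forall>w\<in>P. Q K w"
proof -
  have "\<forall>p\<in>P. \<exists>K N. open N \<and> p \<in> N \<and> (\<forall>w\<in>N. Q K w)"
    using loc by (simp add: eventually_nhds)
  then obtain K N where KN: "\<And>p. p \<in> P \<Longrightarrow> open (N p) \<and> p \<in> N p \<and> (\<forall>w\<in>N p. Q (K p) w)"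
    by metis
  obtain C where C: "C \<subseteq> P" "finite C" "P \<subseteq> (\<Union>p\<in>C. N p)"
  proof (rule compactE_image[OF P, of P N])
    show "open (N p)" if "p \<in> P" for p using KN[OF that] by blast
    show "P \<subseteq> (\<Union>p\<in>P. N p)" using KN by blast
  qed
  have "Q (Max (insert 0 (K ` C))) w" if "w \<in> P" for w
  proof -
    from that C obtain p where p: "p \<in> C" "w \<in> N p" by blast
    have "K p \<le> Max (insert 0 (K ` C))" using p C(2) by (intro Max_ge) auto
    moreover have "Q (K p) w" using KN p C(1) by blast
    ultimately show ?thesis by (rule mono)
  qed
  then show ?thesis by blast
qed

section \<open>Summability over pairs of integers\<close>

lemma summable_inverse_square_int: "(\<lambda>m::int. 1 / (1 + \<bar>real_of_int m\<bar>) ^ 2) summable_on UNIV"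
proof -
  let ?f = "\<lambda>m::int. 1 / (1 + \<bar>real_of_int m\<bar>) ^ 2"
  have nat: "(\<lambda>n::nat. 1 / (1 + real n) ^ 2) summable_on UNIV"
  proof -
    have "summable (\<lambda>n::nat. inverse (real (Suc n) ^ 2))"
      using inverse_power_summable[of 2, where ?'a = real] by (subst summable_Suc_iff) simp
    then show ?thesis
      by (subst summable_on_UNIV_nonneg_real_iff) (auto simp: inverse_eq_divide add.commute)
  qed
  have nat2: "(\<lambda>n::nat. 1 / (1 + (real n + 1)) ^ 2) summable_on UNIV"
    by (rule summable_on_comparison_test[OF nat]) (auto intro!: divide_left_mono power_mono mult_pos_pos)
  have "?f summable_on range int"
    using nat by (subst summable_on_reindex) (auto simp: o_def inj_on_def)
  moreover have "?f summable_on range (\<lambda>n. - int n - 1)"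
  proof (subst summable_on_reindex)
    have eq: "\<bar>real_of_int (- int n - 1)\<bar> = real n + 1" for n by simp
    show "(?f \<circ> (\<lambda>n. - int n - 1)) summable_on UNIV" unfolding o_def eq by (rule nat2)
  qed (auto simp: inj_on_def)
  ultimately have "?f summable_on (range int \<union> range (\<lambda>n. - int n - 1))"
    by (rule summable_on_Un_disjoint) auto
  moreover have "range int \<union> range (\<lambda>n. - int n - 1) = UNIV"
  proof -
    have "m \<in> range int \<union> range (\<lambda>n. - int n - 1)" for m :: int
    proof (cases "m \<ge> 0")
      case True then have "m = int (nat m)" by simp
      then show ?thesis by blast
    next
      case False then have "m = - int (nat (- m - 1)) - 1" by simp
      then show ?thesis by blast
    qed
    then show ?thesis by blast
  qed
  ultimately show ?thesis by simp
qed

text \<open>The added 1 keeps the value positive at the pair (0, 0), so that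
  \<open>1 / height p ^ 4\<close> is a majorant at every lattice point, the origin included.\<close>

definition height :: "int \<times> int \<Rightarrow> real" where
  "height p = 1 + max \<bar>real_of_int (fst p)\<bar> \<bar>real_of_int (snd p)\<bar>"

lemma height_ge_1: "height p \<ge> 1" by (simp add: height_def)

text \<open>The squares of \<open>1 + |a|\<close> and \<open>1 + |b|\<close> are both at most the
  square of the height, so the fourth power reduces the double sum to a product of two convergent
  single sums.\<close>

lemma summable_height: "(\<lambda>p. 1 / height p ^ 4) summable_on UNIV"
proof -
  let ?f = "\<lambda>m::int. 1 / (1 + \<bar>real_of_int m\<bar>) ^ 2"
  obtain s where s: "(?f has_sum s) UNIV" using summable_inverse_square_int by (auto simp: summable_on_def)
  have "(\<lambda>p. ?f (fst p) * ?f (snd p)) summable_on Sigma UNIV (\<lambda>_. UNIV)"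
  proof (rule summable_on_SigmaI)
    show "((\<lambda>y. ?f (fst (x, y)) * ?f (snd (x, y))) has_sum ?f x * s) UNIV" for x
      using has_sum_cmult_right[OF s, of "?f x"] by simp
    show "(\<lambda>x. ?f x * s) summable_on UNIV"
      using summable_on_cmult_left[OF summable_inverse_square_int] .
  qed auto
  then have *: "(\<lambda>p. ?f (fst p) * ?f (snd p)) summable_on UNIV" by simp
  show ?thesis
  proof (rule summable_on_comparison_test[OF *])
    fix p :: "int \<times> int"
    let ?x = "\<bar>real_of_int (fst p)\<bar>" and ?y = "\<bar>real_of_int (snd p)\<bar>"
    have "(1 + ?x)^2 * (1 + ?y)^2 \<le> height p ^ 2 * height p ^ 2"
      by (intro mult_mono power_mono) (auto simp: height_def)
    also have "\<dots> = height p ^ 4" by (simp flip: power_add)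
    finally have "1 / height p ^ 4 \<le> 1 / ((1 + ?x)^2 * (1 + ?y)^2)"
      by (intro divide_left_mono) (auto intro!: mult_pos_pos zero_less_power add_pos_nonneg simp: height_def)
    then show "1 / height p ^ 4 \<le> ?f (fst p) * ?f (snd p)" by simp
  qed (auto simp: height_def)
qed

section \<open>Plane lattices in real coordinates\<close>

locale plane_lattice =
  fixes \<omega>1 \<omega>2 :: complex
  assumes nondegenerate: "Im (cnj \<omega>1 * \<omega>2) \<noteq> 0"
begin

text \<open>Cramer's rule for the real coordinates in the basis of the two periods; the denominator
  is the oriented area of the period parallelogram and may have either sign.\<close>

definition coord1 :: "complex \<Rightarrow> real" where "coord1 z = Im (cnj z * \<omega>2) / Im (cnj \<omega>1 * \<omega>2)"
definition coord2 :: "complex \<Rightarrow> real" where "coord2 z = Im (cnj \<omega>1 * z) / Im (cnj \<omega>1 * \<omega>2)"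

definition lat :: "int \<times> int \<Rightarrow> complex" where
  "lat p = of_int (fst p) * \<omega>1 + of_int (snd p) * \<omega>2"

abbreviation L :: "complex set" where "L \<equiv> range lat"

lemma coord_decomposition: "z = of_real (coord1 z) * \<omega>1 + of_real (coord2 z) * \<omega>2"
  using nondegenerate unfolding coord1_def coord2_def
  by (simp add: complex_eq_iff divide_simps) (simp add: algebra_simps)

lemma coord_combination:
  "coord1 (of_real x * \<omega>1 + of_real y * \<omega>2) = x" "coord2 (of_real x * \<omega>1 + of_real y * \<omega>2) = y"
  using nondegenerate unfolding coord1_def coord2_def
  by (simp_all add: divide_simps) (simp_all add: algebra_simps)

lemma coord_lat [simp]: "coord1 (lat p) = of_int (fst p)" "coord2 (lat p) = of_int (snd p)"
  using coord_combination[of "of_int (fst p)" "of_int (snd p)"] by (simp_all add: lat_def)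

lemma coord_linear:
  "coord1 (x + y) = coord1 x + coord1 y" "coord2 (x + y) = coord2 x + coord2 y"
  "coord1 (of_real t * x) = t * coord1 x" "coord2 (of_real t * x) = t * coord2 x"
  using nondegenerate unfolding coord1_def coord2_def
  by (simp_all add: divide_simps) (simp_all add: algebra_simps)

lemma lat_add: "lat (p + q) = lat p + lat q"
  by (simp add: lat_def algebra_simps)

lemma lat_uminus: "lat (- p) = - lat p"
  by (simp add: lat_def)

lemma lat_zero [simp]: "lat 0 = 0"
  by (simp add: lat_def)

lemma inj_lat: "inj lat"
proof (rule injI)
  fix p q assume eq: "lat p = lat q"
  have "coord1 (lat p) = coord1 (lat q)" "coord2 (lat p) = coord2 (lat q)" by (simp_all only: eq)
  then show "p = q" by (simp add: prod_eq_iff)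
qed

lemma L_add: "x \<in> L \<Longrightarrow> y \<in> L \<Longrightarrow> x + y \<in> L"
  by (auto simp flip: lat_add)

lemma L_uminus: "x \<in> L \<Longrightarrow> - x \<in> L"
  by (auto simp flip: lat_uminus)

lemma L_diff: "x \<in> L \<Longrightarrow> y \<in> L \<Longrightarrow> x - y \<in> L"
  using L_add[OF _ L_uminus] by fastforce

lemma L_add_lat_iff: "w + lat q \<in> L \<longleftrightarrow> w \<in> L"
  using L_add[of w "lat q"] L_diff[of "w + lat q" "lat q"] by auto

text \<open>By Cramer's rule each real coordinate is bounded by a multiple of the modulus. The
  summand \<open>c\<close> on the right absorbs the 1 in \<open>height\<close>.\<close>

lemma lat_norm_ge: "\<exists>c>0. \<forall>p. c * height p \<le> cmod (lat p) + c"
proof -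
  define A where "A = 1 + cmod \<omega>1 + cmod \<omega>2"
  define D where "D = \<bar>Im (cnj \<omega>1 * \<omega>2)\<bar>"
  have A: "A > 0" and D: "D > 0" using nondegenerate by (auto simp: A_def D_def add_pos_nonneg)
  have 1: "D * \<bar>coord1 z\<bar> \<le> A * cmod z" for z
  proof -
    have "D * \<bar>coord1 z\<bar> = \<bar>Im (cnj z * \<omega>2)\<bar>" using D by (simp add: D_def coord1_def abs_divide)
    also have "\<dots> \<le> cmod (cnj z * \<omega>2)" by (rule abs_Im_le_cmod)
    also have "\<dots> \<le> A * cmod z" by (simp add: norm_mult A_def algebra_simps)
    finally show ?thesis .
  qed
  have 2: "D * \<bar>coord2 z\<bar> \<le> A * cmod z" for z
  proof -
    have "D * \<bar>coord2 z\<bar> = \<bar>Im (cnj \<omega>1 * z)\<bar>" using D by (simp add: D_def coord2_def abs_divide)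
    also have "\<dots> \<le> cmod (cnj \<omega>1 * z)" by (rule abs_Im_le_cmod)
    also have "\<dots> \<le> A * cmod z" by (simp add: norm_mult A_def algebra_simps)
    finally show ?thesis .
  qed
  have "D / A * height p \<le> cmod (lat p) + D / A" for p
  proof -
    have "D * max \<bar>real_of_int (fst p)\<bar> \<bar>real_of_int (snd p)\<bar> \<le> A * cmod (lat p)"
      using 1[of "lat p"] 2[of "lat p"] by (simp add: max_def)
    then show ?thesis using A by (simp add: height_def field_simps)
  qed
  then show ?thesis using A D by (intro exI[of _ "D / A"]) auto
qed

lemma finite_lat_bounded: "finite {p. cmod (lat p) \<le> R}"
proof -
  obtain c where c: "c > 0" "\<And>p. c * height p \<le> cmod (lat p) + c" using lat_norm_ge by blast
  define m where "m = \<lceil>R / c\<rceil>"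
  have "{p. cmod (lat p) \<le> R} \<subseteq> {-m..m} \<times> {-m..m}"
  proof
    fix p assume "p \<in> {p. cmod (lat p) \<le> R}"
    then have "c * height p \<le> R + c" using c(2)[of p] by simp
    then have "height p - 1 \<le> R / c" using c(1) by (simp add: field_simps)
    then have "max \<bar>real_of_int (fst p)\<bar> \<bar>real_of_int (snd p)\<bar> \<le> real_of_int m"
      unfolding m_def height_def by linarith
    then have "\<bar>fst p\<bar> \<le> m" "\<bar>snd p\<bar> \<le> m" by linarith+
    then show "p \<in> {-m..m} \<times> {-m..m}" by (auto simp: mem_Times_iff abs_le_iff)
  qed
  then show ?thesis by (rule finite_subset) auto
qed

text \<open>Only finitely many lattice points are near \<open>z\<close>. The index set
  \<open>A\<close> is kept general so that \<open>z\<close> may be a lattice point whose own index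
  is left out. The factor 2 leaves distance \<open>r\<close> for all points within \<open>r\<close>
  of \<open>z\<close>.\<close>

lemma lat_avoid:
  assumes "z \<notin> lat ` A"
  shows "\<exists>r>0. \<forall>p\<in>A. 2 * r \<le> cmod (z - lat p)"
proof -
  have "finite (lat ` (A \<inter> {p. cmod (lat p) \<le> cmod z + 1}))" using finite_lat_bounded by blast
  then obtain d where d: "d > 0" "\<And>x. x \<in> lat ` (A \<inter> {p. cmod (lat p) \<le> cmod z + 1}) \<Longrightarrow> x \<noteq> z \<Longrightarrow> d \<le> dist z x"
    using finite_set_avoid by metis
  have "min d 1 \<le> cmod (z - lat p)" if "p \<in> A" for p
  proof (cases "cmod (lat p) \<le> cmod z + 1")
    case True
    moreover have "lat p \<noteq> z" using that assms by blast
    ultimately show ?thesis using d(2)[of "lat p"] that by (auto simp: dist_norm)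
  next
    case False
    then show ?thesis using norm_triangle_ineq2[of "lat p" z] by (simp add: norm_minus_commute)
  qed
  then show ?thesis using d(1) by (intro exI[of _ "min d 1 / 2"]) auto
qed

lemma open_Compl_lat: "open (- lat ` A)"
proof (rule openI)
  fix z assume "z \<in> - lat ` A"
  then have "z \<notin> lat ` A" by simp
  from lat_avoid[OF this] obtain r where r: "r > 0" "\<forall>p\<in>A. 2 * r \<le> cmod (z - lat p)" by blast
  show "\<exists>r>0. ball z r \<subseteq> - lat ` A"
  proof (intro exI conjI subsetI)
    fix w assume w: "w \<in> ball z r"
    have "w \<noteq> lat p" if "p \<in> A" for p
    proof
      assume "w = lat p"
      moreover have "2 * r \<le> cmod (z - lat p)" using r(2) that by (rule bspec)
      ultimately show False using w r(1) by (simp add: dist_norm)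
    qed
    then show "w \<in> - lat ` A" by blast
  qed (rule r(1))
qed

text \<open>For coefficients 1 and \<open>k >= 4\<close> this is, up to a constant factor, the
  derivative of order \<open>k - 2\<close> of the Weierstrass p-function; for a character it is the
  twisted analogue. For \<open>k > 0\<close> a term with \<open>w = lat p\<close> is 0 by the
  convention for division, so values at poles carry no meaning.\<close>

definition esum :: "(int \<times> int \<Rightarrow> complex) \<Rightarrow> nat \<Rightarrow> complex \<Rightarrow> complex" where
  "esum a k w = (\<Sum>\<^sub>\<infinity>p. a p / (w - lat p) ^ k)"

abbreviation eis :: "nat \<Rightarrow> complex \<Rightarrow> complex" where "eis \<equiv> esum (\<lambda>_. 1)"

text \<open>One radius serves all exponents, so that a sum and the sum of its derivatives can be
  controlled on the same disc.\<close>

lemma esum_local_bound: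
  assumes a: "\<And>p. cmod (a p) \<le> 1" and z: "z \<notin> lat ` {p. a p \<noteq> 0}"
  shows "\<exists>r>0. (\<forall>w\<in>cball z r. w \<notin> lat ` {p. a p \<noteq> 0}) \<and>
     (\<forall>k\<ge>4. \<exists>C. \<forall>w\<in>cball z r. \<forall>p. cmod (a p / (w - lat p) ^ k) \<le> C * (1 / height p ^ 4))"
proof -
  let ?A = "{p. a p \<noteq> 0}"
  obtain r where r: "r > 0" "\<And>p. p \<in> ?A \<Longrightarrow> 2 * r \<le> cmod (z - lat p)" using lat_avoid[OF z] by blast
  obtain c where c: "c > 0" "\<And>p. c * height p \<le> cmod (lat p) + c" using lat_norm_ge by blast
  define R where "R = c + cmod z + r"
  have R: "R > 0" using c r by (simp add: R_def add_pos_nonneg)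
  \<comment> \<open>\<open>r\<close> times the far estimate \<open>c * height p - R\<close> plus
    \<open>R\<close> times the near estimate \<open>r\<close> cancels the constant terms; division
    by \<open>R + r\<close> leaves this factor of the height.\<close>
  define c' where "c' = r * c / (R + r)"
  have c': "c' > 0" using r c R by (simp add: c'_def)
  have low: "c' * height p \<le> cmod (w - lat p)" "r \<le> cmod (w - lat p)" if "w \<in> cball z r" "p \<in> ?A" for w p
  proof -
    have zw: "cmod (z - w) \<le> r" using that by (simp add: dist_norm)
    have "cmod (z - lat p) \<le> cmod (z - w) + cmod (w - lat p)"
      using norm_triangle_ineq[of "z - w" "w - lat p"] by simp
    then show 1: "r \<le> cmod (w - lat p)" using r(2)[OF that(2)] zw by linarith
    have "cmod (lat p) \<le> cmod z + cmod (z - w) + cmod (w - lat p)"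
      using norm_triangle_ineq4[of z "z - lat p"] norm_triangle_ineq[of "z - w" "w - lat p"] by simp
    then have "c * height p - R \<le> cmod (w - lat p)" using c(2)[of p] zw by (simp add: R_def)
    then have "r * (c * height p - R) \<le> r * cmod (w - lat p)" using r by (intro mult_left_mono) auto
    moreover have "R * r \<le> R * cmod (w - lat p)" using R 1 by (intro mult_left_mono) auto
    ultimately have "r * c * height p \<le> (R + r) * cmod (w - lat p)" by (simp add: algebra_simps)
    then show "c' * height p \<le> cmod (w - lat p)" using R r by (simp add: c'_def field_simps)
  qed
  have "\<exists>C. \<forall>w\<in>cball z r. \<forall>p. cmod (a p / (w - lat p) ^ k) \<le> C * (1 / height p ^ 4)" if k: "k \<ge> 4" for k
  proof (intro exI ballI allI)
    fix w p assume w: "w \<in> cball z r"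
    have h: "height p > 0" using height_ge_1[of p] by linarith
    show "cmod (a p / (w - lat p) ^ k) \<le> 1 / c' ^ k * (1 / height p ^ 4)"
    proof (cases "a p = 0")
      case True
      then show ?thesis using c' h by simp
    next
      case False
      have "c' ^ k * height p ^ 4 \<le> c' ^ k * height p ^ k"
        using c' k height_ge_1 by (intro mult_left_mono power_increasing) auto
      also have "\<dots> = (c' * height p) ^ k" by (simp add: power_mult_distrib)
      also have "\<dots> \<le> cmod (w - lat p) ^ k" using c' h low(1)[OF w, of p] False by (intro power_mono) auto
      finally have *: "c' ^ k * height p ^ 4 \<le> cmod (w - lat p) ^ k" .
      have "cmod (a p / (w - lat p) ^ k) \<le> 1 / cmod (w - lat p) ^ k"
        using a[of p] by (simp add: norm_divide norm_power divide_right_mono)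
      also have "\<dots> \<le> 1 / (c' ^ k * height p ^ 4)"
        using * c' h by (intro divide_left_mono) (auto intro!: mult_pos_pos less_le_trans[OF _ *])
      finally show ?thesis by simp
    qed
  qed
  moreover have "w \<notin> lat ` ?A" if "w \<in> cball z r" for w
    using low(2)[OF that] r(1) by fastforce
  ultimately show ?thesis using r(1) by blast
qed

lemma esum_summable:
  assumes "\<And>p. cmod (a p) \<le> 1" "z \<notin> lat ` {p. a p \<noteq> 0}" "k \<ge> 4"
  shows "(\<lambda>p. a p / (z - lat p) ^ k) summable_on UNIV"
proof -
  obtain r where "r > 0" and r: "\<And>k. k \<ge> 4 \<Longrightarrow> \<exists>C. \<forall>w\<in>cball z r. \<forall>p. cmod (a p / (w - lat p) ^ k) \<le> C * (1 / height p ^ 4)"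
    using esum_local_bound[OF assms(1,2)] by blast
  obtain C where C: "\<And>p. cmod (a p / (z - lat p) ^ k) \<le> C * (1 / height p ^ 4)"
    using r[OF assms(3)] \<open>r > 0\<close> by (meson centre_in_cball less_imp_le)
  show ?thesis
    by (rule abs_summable_summable,
        rule Infinite_Sum.abs_summable_on_comparison_test'[OF summable_on_cmult_right[OF summable_height] C])
qed

lemma power_inverse_derivative:
  fixes u :: complex
  assumes "u \<noteq> 0" "k \<ge> 1"
  shows "a * - (inverse (u ^ k) * (of_nat k * u ^ (k - 1)) * inverse (u ^ k)) = - of_nat k * (a / u ^ Suc k)"
proof -
  obtain m where m: "k = Suc m" using assms(2) by (cases k) auto
  have *: "a * - (inverse (u * v) * (c * v) * inverse (u * v)) = - c * (a / (u * (u * v)))" if "v \<noteq> 0" for v c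
    using assms(1) that by (simp add: field_simps)
  show ?thesis using *[of "u ^ m" "of_nat k"] assms(1) by (simp add: m)
qed

text \<open>The finite partial sums converge uniformly on a disc by the Weierstrass M-test, so their
  derivatives converge to the derivative of the limit; up to the factor \<open>- of_nat k\<close>
  these derivatives are partial sums with exponent \<open>Suc k\<close>.\<close>

lemma esum_has_derivative:
  assumes a: "\<And>p. cmod (a p) \<le> 1" and z: "z \<notin> lat ` {p. a p \<noteq> 0}" and k: "k \<ge> 4"
  shows "(esum a k has_field_derivative - of_nat k * esum a (Suc k) z) (at z)"
proof -
  obtain r where r: "r > 0" and avoid: "\<And>w. w \<in> cball z r \<Longrightarrow> w \<notin> lat ` {p. a p \<noteq> 0}"
    and C: "\<And>k. k \<ge> 4 \<Longrightarrow> \<exists>C. \<forall>w\<in>cball z r. \<forall>p. cmod (a p / (w - lat p) ^ k) \<le> C * (1 / height p ^ 4)"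
    using esum_local_bound[OF a z] by blast
  define F where "F = finite_subsets_at_top (UNIV :: (int \<times> int) set)"
  have ul: "uniform_limit (cball z r) (\<lambda>X w. \<Sum>p\<in>X. a p / (w - lat p) ^ k) (esum a k) F" if k: "k \<ge> 4" for k
  proof -
    obtain C where "\<And>w p. w \<in> cball z r \<Longrightarrow> cmod (a p / (w - lat p) ^ k) \<le> C * (1 / height p ^ 4)"
      using C[OF k] by blast
    then show ?thesis unfolding F_def esum_def
      by (intro Weierstrass_m_test_general[OF _ summable_on_cmult_right[OF summable_height]]) auto
  qed
  have term_der: "((\<lambda>w. a p / (w - lat p) ^ k) has_field_derivative - of_nat k * (a p / (w - lat p) ^ Suc k)) (at w)"
    if "w \<in> cball z r" for w p
  proof (cases "a p = 0")
    case False
    then have nz: "w - lat p \<noteq> 0" using avoid[OF that] by auto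
    have "((\<lambda>w. a p * inverse ((w - lat p) ^ k)) has_field_derivative
        a p * - (inverse ((w - lat p) ^ k) * (of_nat k * (w - lat p) ^ (k - 1)) * inverse ((w - lat p) ^ k))) (at w)"
      using nz by (auto intro!: derivative_eq_intros)
    moreover have "a p * - (inverse ((w - lat p) ^ k) * (of_nat k * (w - lat p) ^ (k - 1)) * inverse ((w - lat p) ^ k))
      = - of_nat k * (a p / (w - lat p) ^ Suc k)"
      using power_inverse_derivative[OF nz, of k] k by simp
    ultimately show ?thesis by (simp only: divide_inverse)
  qed simp
  have cont: "\<forall>\<^sub>F X in F. continuous_on (cball z r) (\<lambda>w. \<Sum>p\<in>X. a p / (w - lat p) ^ k) \<and>
     (\<forall>w\<in>ball z r. ((\<lambda>w. \<Sum>p\<in>X. a p / (w - lat p) ^ k) has_field_derivative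
        (\<Sum>p\<in>X. - of_nat k * (a p / (w - lat p) ^ Suc k))) (at w))"
  proof (intro always_eventually allI conjI ballI)
    fix X
    show der: "((\<lambda>w. \<Sum>p\<in>X. a p / (w - lat p) ^ k) has_field_derivative
        (\<Sum>p\<in>X. - of_nat k * (a p / (w - lat p) ^ Suc k))) (at w)" if "w \<in> ball z r" for w
      by (rule DERIV_sum, rule term_der) (use that in auto)
    show "continuous_on (cball z r) (\<lambda>w. \<Sum>p\<in>X. a p / (w - lat p) ^ k)"
      by (intro continuous_on_sum continuous_at_imp_continuous_on ballI)
         (use term_der DERIV_isCont in blast)
  qed
  have F: "\<not> trivial_limit F" by (simp add: F_def)
  obtain g' where "\<And>w. w \<in> ball z r \<Longrightarrow> (esum a k has_field_derivative g' w) (at w) \<and>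
     ((\<lambda>X. \<Sum>p\<in>X. - of_nat k * (a p / (w - lat p) ^ Suc k)) \<longlongrightarrow> g' w) F"
    using has_complex_derivative_uniform_limit[OF cont ul[OF k] F r] by blast
  from this[of z] r have g': "(esum a k has_field_derivative g' z) (at z)"
     "((\<lambda>X. \<Sum>p\<in>X. - of_nat k * (a p / (z - lat p) ^ Suc k)) \<longlongrightarrow> g' z) F"
    by simp_all
  have "((\<lambda>X. \<Sum>p\<in>X. a p / (z - lat p) ^ Suc k) \<longlongrightarrow> esum a (Suc k) z) F"
    by (rule tendsto_uniform_limitI[OF ul]) (use k r in auto)
  then have "((\<lambda>X. - of_nat k * (\<Sum>p\<in>X. a p / (z - lat p) ^ Suc k)) \<longlongrightarrow> - of_nat k * esum a (Suc k) z) F"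
    by (rule tendsto_mult_left)
  then have "g' z = - of_nat k * esum a (Suc k) z"
    using tendsto_unique[OF F g'(2)] by (simp add: sum_distrib_left)
  then show ?thesis using g'(1) by simp
qed

lemma esum_isCont:
  assumes "\<And>p. cmod (a p) \<le> 1" "z \<notin> lat ` {p. a p \<noteq> 0}" "k \<ge> 4" shows "isCont (esum a k) z"
  by (rule DERIV_isCont[OF esum_has_derivative]) (use assms in auto)

lemma esum_holomorphic:
  assumes "\<And>p. cmod (a p) \<le> 1" "k \<ge> 4" shows "esum a k holomorphic_on (- lat ` {p. a p \<noteq> 0})"
  unfolding holomorphic_on_open[OF open_Compl_lat]
proof (intro ballI exI)
  fix z assume "z \<in> - lat ` {p. a p \<noteq> 0}"
  then show "(esum a k has_field_derivative - of_nat k * esum a (Suc k) z) (at z)"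
    by (intro esum_has_derivative assms) auto
qed

text \<open>Setting the coefficient at \<open>q\<close> to 0 removes the pole at
  \<open>lat q\<close>, so the second summand is regular there; this isolates the principal
  part.\<close>

lemma esum_split:
  assumes a: "\<And>p. cmod (a p) \<le> 1" and z: "z \<notin> L" and k: "k \<ge> 4"
  shows "esum a k z = a q / (z - lat q) ^ k + esum (a(q := 0)) k z"
proof -
  let ?b = "\<lambda>p. if p = q then a q else 0"
  have zA: "z \<notin> lat ` {p. b p \<noteq> 0}" for b :: "int \<times> int \<Rightarrow> complex" using z by auto
  have 1: "(\<lambda>p. (a(q := 0)) p / (z - lat p) ^ k) summable_on UNIV"
    by (rule esum_summable[OF _ zA k]) (use a in auto)
  have 2: "(\<lambda>p. ?b p / (z - lat p) ^ k) summable_on UNIV"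
    by (rule esum_summable[OF _ zA k]) (use a in auto)
  have "esum a k z = (\<Sum>\<^sub>\<infinity>p. ?b p / (z - lat p) ^ k + (a(q := 0)) p / (z - lat p) ^ k)"
    unfolding esum_def by (rule infsum_cong) auto
  also have "\<dots> = (\<Sum>\<^sub>\<infinity>p. ?b p / (z - lat p) ^ k) + esum (a(q := 0)) k z"
    unfolding esum_def by (rule infsum_add[OF 2 1])
  also have "(\<Sum>\<^sub>\<infinity>p. ?b p / (z - lat p) ^ k) = (\<Sum>\<^sub>\<infinity>p\<in>{q}. ?b p / (z - lat p) ^ k)"
    by (rule infsum_cong_neutral) auto
  finally show ?thesis by (simp del: fun_upd_apply)
qed

lemma eventually_not_L: "\<forall>\<^sub>F w in at z. w \<notin> L"
proof -
  have "z \<in> - lat ` (UNIV - {p. lat p = z})" by auto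
  from eventually_nhds_in_open[OF open_Compl_lat this]
  have "\<forall>\<^sub>F w in at z. w \<in> - lat ` (UNIV - {p. lat p = z})"
    unfolding eventually_at_filter by (rule eventually_mono) simp
  moreover have "\<forall>\<^sub>F w in at z. w \<noteq> z" by (simp add: eventually_at_filter)
  ultimately show ?thesis
  proof eventually_elim
    case (elim w)
    have *: False if "w = lat p" for p
    proof -
      from that elim(2) have "p \<in> UNIV - {p. lat p = z}" by simp
      then have "lat p \<in> lat ` (UNIV - {p. lat p = z})" by (rule imageI)
      with elim(1) that show False by simp
    qed
    show ?case
    proof
      assume "w \<in> L"
      then obtain p where "w = lat p" by (rule rangeE)
      then show False by (rule *)
    qed
  qed
qed

text \<open>After multiplication by the \<open>k\<close>-th power of \<open>w - lat q\<close> the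
  sum tends to \<open>a q\<close>, which is nonzero, while that power tends to 0 through nonzero
  values.\<close>

lemma esum_pole:
  assumes a: "\<And>p. cmod (a p) \<le> 1" and q: "a q \<noteq> 0" and k: "k \<ge> 4"
  shows "filterlim (esum a k) at_infinity (at (lat q))"
proof -
  let ?R = "esum (a(q := 0)) k"
  have "lat q \<notin> lat ` {p. (a(q := 0)) p \<noteq> 0}" using inj_lat by (auto dest: injD)
  then have "isCont ?R (lat q)" by (intro esum_isCont) (use a k in auto)
  then have R: "(?R \<longlongrightarrow> ?R (lat q)) (at (lat q))" by (simp add: isCont_def)
  have d: "((\<lambda>w. w - lat q) \<longlongrightarrow> 0) (at (lat q))" by (auto intro!: tendsto_eq_intros)
  have z: "(0::complex) ^ k = 0" using k by (intro zero_power) simp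
  have "((\<lambda>w. a q + (w - lat q) ^ k * ?R w) \<longlongrightarrow> a q + 0 ^ k * ?R (lat q)) (at (lat q))"
    by (intro tendsto_intros d R)
  then have num: "((\<lambda>w. a q + (w - lat q) ^ k * ?R w) \<longlongrightarrow> a q) (at (lat q))"
    unfolding z mult_zero_left add_0_right .
  have "((\<lambda>w. (w - lat q) ^ k) \<longlongrightarrow> 0 ^ k) (at (lat q))" by (intro tendsto_intros d)
  then have "((\<lambda>w. (w - lat q) ^ k) \<longlongrightarrow> 0) (at (lat q))" unfolding z .
  moreover have "\<forall>\<^sub>F w in at (lat q). (w - lat q) ^ k \<noteq> 0"
    unfolding eventually_at_filter by (intro always_eventually) simp
  ultimately have den: "filterlim (\<lambda>w. (w - lat q) ^ k) (at 0) (at (lat q))" by (rule filterlim_atI)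
  have "filterlim (\<lambda>w. (a q + (w - lat q) ^ k * ?R w) / (w - lat q) ^ k) at_infinity (at (lat q))"
    by (rule filterlim_divide_at_infinity[OF num den q])
  moreover have "\<forall>\<^sub>F w in at (lat q). (a q + (w - lat q) ^ k * ?R w) / (w - lat q) ^ k = esum a k w"
    using eventually_not_L[of "lat q"]
  proof eventually_elim
    case (elim w)
    then have "w - lat q \<noteq> 0" by auto
    then show ?case using esum_split[where a = a and q = q, OF a elim k] by (simp add: add_divide_distrib)
  qed
  ultimately show ?thesis by (simp add: filterlim_cong)
qed

section \<open>Unitary characters and quasi-periodicity\<close>

definition character :: "(int \<times> int \<Rightarrow> complex) \<Rightarrow> bool" where
  "character \<chi>' \<longleftrightarrow> (\<forall>p q. \<chi>' (p + q) = \<chi>' p * \<chi>' q) \<and> (\<forall>p. cmod (\<chi>' p) = 1)"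

lemma character_add: "character e \<Longrightarrow> e (p + q) = e p * e q"
  unfolding character_def by blast

lemma character_norm: "character e \<Longrightarrow> cmod (e p) = 1"
  unfolding character_def by blast

text \<open>Translation by a period permutes the lattice, and the character turns the shift of the
  summation index into a factor.\<close>

lemma esum_quasi_periodic:
  assumes "character e"
  shows "esum e k (w + lat q) = e q * esum e k w"
proof -
  have "bij_betw (\<lambda>p. p + q) UNIV (UNIV :: (int \<times> int) set)"
    by (rule bij_betwI[of _ _ _ "\<lambda>p. p - q"]) auto
  then have "esum e k (w + lat q) = (\<Sum>\<^sub>\<infinity>p. e (p + q) / (w + lat q - lat (p + q)) ^ k)"
    unfolding esum_def by (subst infsum_reindex_bij_betw[symmetric]) auto
  also have "\<dots> = (\<Sum>\<^sub>\<infinity>p. e q * (e p / (w - lat p) ^ k))"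
    by (simp add: character_add[OF assms] lat_add mult.commute)
  also have "\<dots> = e q * esum e k w" unfolding esum_def by (rule infsum_cmult_right')
  finally show ?thesis .
qed

lemma connected_Compl_L: "connected (- L)" "open (- L)"
proof -
  have "connected (UNIV - L :: complex set)" by (rule connected_open_diff_countable) auto
  then show "connected (- L)" unfolding Compl_eq_Diff_UNIV .
qed (rule open_Compl_lat)

lemma character_facts:
  assumes "character e" shows "cmod (e p) \<le> 1" "e p \<noteq> 0" "{p. e p \<noteq> 0} = UNIV"
proof -
  have 1: "cmod (e p) = 1" for p using assms by (rule character_norm)
  have 2: "e p \<noteq> 0" for p using 1[of p] by auto
  show "cmod (e p) \<le> 1" "e p \<noteq> 0" "{p. e p \<noteq> 0} = UNIV" using 1[of p] 2 by (auto simp del: split_paired_All)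
qed

lemma character_one: "character (\<lambda>_. 1)" by (simp add: character_def)

lemma character_deriv:
  assumes "character e" "w \<notin> L" "k \<ge> 4"
  shows "(esum e k has_field_derivative - of_nat k * esum e (Suc k) w) (at w)"
  by (rule esum_has_derivative) (use assms character_facts in auto)

lemma character_isCont: "character e \<Longrightarrow> w \<notin> L \<Longrightarrow> k \<ge> 4 \<Longrightarrow> isCont (esum e k) w"
  by (rule DERIV_isCont[OF character_deriv])

lemma character_pole: "character e \<Longrightarrow> p \<in> L \<Longrightarrow> k \<ge> 4 \<Longrightarrow> filterlim (esum e k) at_infinity (at p)"
  using esum_pole[of e _ k] character_facts by auto

text \<open>If all exponents from \<open>k0\<close> on gave 0 at \<open>w\<close>, the derivative
  chain would make \<open>esum e k0\<close> vanish on the connected set \<open>- L\<close>, against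
  the pole at 0. The start \<open>k0\<close> is variable because local coordinates will call for
  exponents from 5 on.\<close>

lemma esum_nonvanishing:
  assumes e: "character e" and w: "w \<notin> L" and k0: "k0 \<ge> 4"
  shows "\<exists>k\<ge>k0. esum e k w \<noteq> 0"
proof (rule ccontr)
  assume "\<not> ?thesis"
  then have zero: "\<And>k. k \<ge> k0 \<Longrightarrow> esum e k w = 0" by blast
  have "esum e k0 s = 0" if "s \<in> - L" for s
    by (rule identity_theorem_derivative_chain[OF connected_Compl_L(2,1), of w, where c = "\<lambda>k. - of_nat k"])
       (use w that zero character_deriv[OF e] k0 in auto)
  then have "\<forall>\<^sub>F s in at 0. esum e k0 s = 0" using eventually_not_L[of 0] by (auto elim!: eventually_mono)
  then have "(esum e k0 \<longlongrightarrow> 0) (at 0)" by (simp add: tendsto_eventually)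
  moreover have "filterlim (esum e k0) at_infinity (at 0)"
    using character_pole[OF e _ k0, of 0] by (metis lat_zero rangeI)
  ultimately show False using not_tendsto_and_filterlim_at_infinity[of "at (0::complex)"] by auto
qed

text \<open>The difference of the translates \<open>eis k (w + s)\<close> and
  \<open>eis k (w' + s)\<close> vanishes at \<open>s = 0\<close> for all exponents, hence
  identically for exponent 4. As \<open>s\<close> tends to \<open>- w\<close> the first has a pole,
  while the second converges unless \<open>w' - w\<close> is a period.\<close>

lemma esum_separation:
  assumes w: "w \<notin> L" "w' \<notin> L" and eq: "\<And>k. k \<ge> 4 \<Longrightarrow> eis k w = eis k w'"
  shows "w - w' \<in> L"
proof (rule ccontr)
  assume notL: "w - w' \<notin> L"
  define S where "S = UNIV - ((\<lambda>l. l - w) ` L \<union> (\<lambda>l. l - w') ` L)"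
  have shift: "s \<in> (\<lambda>l. l - u) ` L \<longleftrightarrow> u + s \<in> L" for s u
  proof
    assume "u + s \<in> L"
    then show "s \<in> (\<lambda>l. l - u) ` L" by (rule image_eqI[rotated]) simp
  qed auto
  then have Siff: "s \<in> S \<longleftrightarrow> w + s \<notin> L \<and> w' + s \<notin> L" for s
    by (simp add: S_def shift)
  have conn: "connected S" unfolding S_def by (rule connected_open_diff_countable) auto
  have "S = (\<lambda>s. w + s) -` (- L) \<inter> (\<lambda>s. w' + s) -` (- L)" using Siff by auto
  moreover have "open ((\<lambda>s. w + s) -` (- L) \<inter> (\<lambda>s. w' + s) -` (- L))"
    by (intro open_Int open_vimage connected_Compl_L continuous_intros)
  ultimately have opS: "open S" by simp
  have eq0: "eis 4 (w + s) = eis 4 (w' + s)" if "s \<in> S" for s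
  proof -
    have "eis 4 (w + s) - eis 4 (w' + s) = 0"
    proof (rule identity_theorem_derivative_chain[OF opS conn, of 0 s 4 "\<lambda>(k::nat) s. eis k (w + s) - eis k (w' + s)" "\<lambda>k. - of_nat k"])
      fix k :: nat and s assume k: "4 \<le> k" and "s \<in> S"
      then have s: "w + s \<notin> L" "w' + s \<notin> L" using Siff by auto
      have "((\<lambda>s. eis k (w + s)) has_field_derivative - of_nat k * eis (Suc k) (w + s)) (at s)"
        "((\<lambda>s. eis k (w' + s)) has_field_derivative - of_nat k * eis (Suc k) (w' + s)) (at s)"
        using character_deriv[OF character_one s(1) k] character_deriv[OF character_one s(2) k]
        by (simp_all add: DERIV_shift add.commute)
      from DERIV_diff[OF this]
      show "((\<lambda>s. eis k (w + s) - eis k (w' + s)) has_field_derivative - of_nat k * (eis (Suc k) (w + s) - eis (Suc k) (w' + s))) (at s)"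
        by (simp add: algebra_simps)
    qed (use that w eq Siff in auto)
    then show ?thesis by simp
  qed
  have notL': "w' - w \<notin> L" using notL L_uminus[of "w' - w"] by auto
  have flt: "filterlim (\<lambda>s. w + s) (at 0) (at (- w))"
    by (auto simp: filterlim_at eventually_at_filter add_eq_0_iff intro!: tendsto_eq_intros)
  have "filterlim (eis 4) at_infinity (at 0)"
    using character_pole[OF character_one, of 0 4] by (metis lat_zero rangeI order_refl)
  then have inf: "filterlim (\<lambda>s. eis 4 (w + s)) at_infinity (at (- w))"
    using flt by (rule filterlim_compose)
  have "isCont (eis 4) (w' - w)" by (rule character_isCont[OF character_one notL']) simp
  moreover have "((\<lambda>s. w' + s) \<longlongrightarrow> w' - w) (at (- w))" by (auto intro!: tendsto_eq_intros)
  ultimately have lim: "((\<lambda>s. eis 4 (w' + s)) \<longlongrightarrow> eis 4 (w' - w)) (at (- w))"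
    by (rule isCont_tendsto_compose)
  have "\<forall>\<^sub>F s in at (- w). w + s \<notin> L"
    using eventually_compose_filterlim[OF eventually_not_L flt] .
  moreover have "\<forall>\<^sub>F s in at (- w). w' + s \<in> - L"
    by (rule topological_tendstoD[OF \<open>((\<lambda>s. w' + s) \<longlongrightarrow> w' - w) (at (- w))\<close> connected_Compl_L(2)]) (use notL' in auto)
  ultimately have "\<forall>\<^sub>F s in at (- w). eis 4 (w' + s) = eis 4 (w + s)"
    by eventually_elim (use eq0 Siff in auto)
  then have "((\<lambda>s. eis 4 (w + s)) \<longlongrightarrow> eis 4 (w' - w)) (at (- w))"
    using lim by (simp add: tendsto_cong)
  with inf show False using not_tendsto_and_filterlim_at_infinity[of "at (- w)"] by auto
qed

section \<open>Bounding the exponents by compactness\<close>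

definition period_cell :: "complex set" where
  "period_cell = (\<lambda>(x, y). of_real x * \<omega>1 + of_real y * \<omega>2) ` ({0..1} \<times> {0..1})"

lemma compact_period_cell: "compact period_cell"
  unfolding period_cell_def case_prod_unfold
  by (intro compact_continuous_image compact_Times compact_Icc continuous_intros)

lemma reduce_to_period_cell: "\<exists>q. w - lat q \<in> period_cell"
proof
  let ?q = "(\<lfloor>coord1 w\<rfloor>, \<lfloor>coord2 w\<rfloor>)"
  have "w - lat ?q = of_real (frac (coord1 w)) * \<omega>1 + of_real (frac (coord2 w)) * \<omega>2"
    by (subst coord_decomposition[of w]) (simp add: lat_def frac_def algebra_simps)
  moreover have "frac (coord1 w) \<in> {0..1}" "frac (coord2 w) \<in> {0..1}"
    using frac_lt_1 less_imp_le by auto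
  ultimately show "w - lat ?q \<in> period_cell"
    unfolding period_cell_def by (auto intro!: image_eqI[of _ _ "(frac (coord1 w), frac (coord2 w))"])
qed

text \<open>At a lattice point the pole itself keeps \<open>esum e k0\<close> away from 0 nearby;
  elsewhere one nonvanishing exponent persists in a neighbourhood. A character has no zeros, so
  nonvanishing transfers from the compact period cell to all its translates.\<close>

lemma esum_nonvanishing_uniform:
  assumes e: "character e" and k0: "k0 \<ge> 4"
  shows "\<exists>K. \<forall>w. w \<notin> L \<longrightarrow> (\<exists>k\<in>{k0..K}. esum e k w \<noteq> 0)"
proof -
  have "\<exists>K. \<forall>w\<in>period_cell. w \<notin> L \<longrightarrow> (\<exists>k\<in>{k0..K}. esum e k w \<noteq> 0)"
  proof (rule compact_uniform_bound[OF compact_period_cell])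
    fix p
    show "\<exists>K. \<forall>\<^sub>F w in nhds p. w \<notin> L \<longrightarrow> (\<exists>k\<in>{k0..K}. esum e k w \<noteq> 0)"
    proof (cases "p \<in> L")
      case True
      then have "\<forall>\<^sub>F w in at p. 1 \<le> cmod (esum e k0 w)"
        using character_pole[OF e True k0] by (simp add: filterlim_at_infinity[of 0])
      then have "\<forall>\<^sub>F w in nhds p. w \<notin> L \<longrightarrow> (\<exists>k\<in>{k0..k0}. esum e k w \<noteq> 0)"
        unfolding eventually_at_filter by eventually_elim (use True in auto)
      then show ?thesis by blast
    next
      case False
      then obtain k where k: "k \<ge> k0" "esum e k p \<noteq> 0" using esum_nonvanishing[OF e _ k0] by blast
      then have "isCont (esum e k) p" using k0 by (intro character_isCont[OF e False]) auto
      then have "(esum e k \<longlongrightarrow> esum e k p) (nhds p)" by (simp add: continuous_at_imp_continuous_at_within isCont_def tendsto_nhds_iff)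
      then have "\<forall>\<^sub>F w in nhds p. esum e k w \<noteq> 0" by (rule tendsto_imp_eventually_ne) (rule k)
      then have "\<forall>\<^sub>F w in nhds p. w \<notin> L \<longrightarrow> (\<exists>k\<in>{k0..k}. esum e k w \<noteq> 0)"
        by eventually_elim (use k in auto)
      then show ?thesis by blast
    qed
  next
    fix K K' w assume "K \<le> K'" "w \<notin> L \<longrightarrow> (\<exists>k\<in>{k0..K}. esum e k w \<noteq> 0)"
    then show "w \<notin> L \<longrightarrow> (\<exists>k\<in>{k0..K'}. esum e k w \<noteq> 0)" by (meson atLeastAtMost_iff order_trans)
  qed
  then obtain K where K: "\<And>w. w \<in> period_cell \<Longrightarrow> w \<notin> L \<Longrightarrow> \<exists>k\<in>{k0..K}. esum e k w \<noteq> 0" by metis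
  show ?thesis
  proof (intro exI allI impI)
    fix w assume w: "w \<notin> L"
    obtain q where q: "w - lat q \<in> period_cell" using reduce_to_period_cell by blast
    have "w - lat q \<notin> L" using w L_add_lat_iff[of "w - lat q" q] by simp
    with K[OF q] obtain k where k: "k \<in> {k0..K}" "esum e k (w - lat q) \<noteq> 0" by blast
    then have "esum e k w \<noteq> 0"
      using esum_quasi_periodic[OF e, of k "w - lat q" q] character_facts(2)[OF e] by simp
    then show "\<exists>k\<in>{k0..K}. esum e k w \<noteq> 0" using k by blast
  qed
qed

lemma not_L_nonzero: "x \<notin> L \<Longrightarrow> x \<noteq> 0"
  using rangeI[of lat 0] by auto

text \<open>Near a pole the quotient of the sums of exponents 4 and 5 is a local coordinate.\<close>

lemma esum_injective_near_0:
  "\<exists>\<delta>>0. \<forall>x y. cmod x < \<delta> \<and> cmod y < \<delta> \<and> x \<notin> L \<and> y \<notin> L \<and>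
     eis 4 x = eis 4 y \<and> eis 5 x = eis 5 y \<longrightarrow> x = y"
proof -
  let ?a = "(\<lambda>_. 1)(0 := 0) :: int \<times> int \<Rightarrow> complex"
  \<comment> \<open>\<open>H k\<close> is \<open>x ^ k * eis k x\<close> continued holomorphically
    over the pole, with value 1 at 0; the quotient \<open>h\<close> below therefore equals
    \<open>eis 4 / eis 5\<close> off the lattice and has derivative 1 at 0.\<close>
  define H where "H k x = 1 + x ^ k * esum ?a k x" for k x
  have 0: "0 \<in> - lat ` {p. ?a p \<noteq> 0}"
    using inj_lat lat_zero by (auto dest: injD) (metis injD lat_zero)
  have hol: "H k holomorphic_on (- lat ` {p. ?a p \<noteq> 0})" if "k \<ge> 4" for k
    unfolding H_def by (intro holomorphic_intros esum_holomorphic that) auto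
  define U where "U = {x \<in> - lat ` {p. ?a p \<noteq> 0}. H 5 x \<noteq> 0}"
  have "U = - lat ` {p. ?a p \<noteq> 0} \<inter> H 5 -` (- {0})" by (auto simp: U_def)
  moreover have "open (- lat ` {p. ?a p \<noteq> 0} \<inter> H 5 -` (- {0}))"
    by (intro continuous_open_preimage holomorphic_on_imp_continuous_on[OF hol] open_Compl_lat) auto
  ultimately have U: "open U" by simp
  have "0 \<in> U" using 0 by (auto simp: U_def H_def)
  define h where "h x = x * H 4 x / H 5 x" for x
  have holh: "h holomorphic_on U"
    unfolding h_def by (intro holomorphic_intros holomorphic_on_subset[OF hol]) (auto simp: U_def)
  have "(h has_field_derivative 1) (at 0)"
  proof -
    have "\<exists>D. (H k has_field_derivative D) (at 0)" if "k \<ge> 4" for k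
      using hol[OF that] 0 open_Compl_lat by (auto simp: holomorphic_on_open)
    from this[of 4] this[of 5] obtain D4 D5 where
      D: "(H 4 has_field_derivative D4) (at 0)" "(H 5 has_field_derivative D5) (at 0)" by auto
    have "H k 0 = 1" if "k \<ge> 4" for k using that by (simp add: H_def)
    then have H0: "H 4 0 = 1" "H 5 0 = 1" by simp_all
    show ?thesis
      using DERIV_divide[OF DERIV_mult[OF DERIV_ident D(1)] D(2)] unfolding h_def H0 by (simp add: H0)
  qed
  then have "deriv h 0 \<noteq> 0" by (simp add: DERIV_imp_deriv)
  from has_complex_derivative_locally_injective[OF holh \<open>0 \<in> U\<close> U this]
  obtain r where r: "r > 0" "ball 0 r \<subseteq> U" "inj_on h (ball 0 r)" .
  have fH: "eis k x = H k x / x ^ k" if "x \<notin> L" "k \<ge> 4" for x k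
  proof -
    have "x \<noteq> 0" using that not_L_nonzero by blast
    then show ?thesis using esum_split[OF _ that, of "\<lambda>_. 1" 0] by (simp add: H_def add_divide_distrib)
  qed
  have h: "h x = eis 4 x / eis 5 x" if "x \<notin> L" for x
  proof -
    have "x \<noteq> 0" using that not_L_nonzero by blast
    then show ?thesis unfolding fH[OF that, of 4, simplified] fH[OF that, of 5, simplified] h_def
      by (simp add: field_simps eval_nat_numeral)
  qed
  show ?thesis
  proof (intro exI conjI allI impI)
    fix x y assume *: "cmod x < r \<and> cmod y < r \<and> x \<notin> L \<and> y \<notin> L \<and> eis 4 x = eis 4 y \<and> eis 5 x = eis 5 y"
    then have "h x = h y" by (simp add: h)
    then show "x = y" using * r(3) by (auto simp: inj_on_def)
  qed (rule r(1))
qed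

text \<open>Compactness is applied to pairs in the period cell. Near a pair of lattice points the
  exponents 4 and 5 suffice after translation to 0; near a mixed pair \<open>eis 4\<close> is large
  at one point and bounded at the other; near inequivalent points off the lattice some exponent
  differs; near equivalent ones some \<open>eis j\<close> is locally injective.\<close>

lemma esum_separation_uniform:
  "\<exists>K. \<forall>w w'. w \<notin> L \<and> w' \<notin> L \<and> (\<forall>k\<in>{4..K}. eis k w = eis k w') \<longrightarrow> w - w' \<in> L"
proof -
  define Q where "Q K z \<longleftrightarrow> fst z \<notin> L \<and> snd z \<notin> L \<and> (\<forall>k\<in>{4..K}. eis k (fst z) = eis k (snd z)) \<longrightarrow> fst z - snd z \<in> L"
    for K :: nat and z
  note one = character_one
  have lim: "(eis k \<longlongrightarrow> eis k p) (nhds p)" if "p \<notin> L" "k \<ge> 4" for p k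
    using character_isCont[OF one that] by (simp add: isCont_def tendsto_nhds_iff)
  have per: "eis k (w + lat q) = eis k w" for k w q using esum_quasi_periodic[OF one, of k w q] by simp
  have limfst: "filterlim fst (nhds p) (nhds (p, p'))" and limsnd: "filterlim snd (nhds p') (nhds (p, p'))" for p p' :: complex
    by (auto intro!: tendsto_eq_intros filterlim_ident simp: nhds_prod filterlim_fst filterlim_snd)
  have mixed: "\<forall>\<^sub>F z in nhds (p, p'). fst z \<notin> L \<longrightarrow> eis 4 (fst z) \<noteq> eis 4 (snd z)"
    "\<forall>\<^sub>F z in nhds (p', p). snd z \<notin> L \<longrightarrow> eis 4 (fst z) \<noteq> eis 4 (snd z)"
    if p: "p \<in> L" and p': "p' \<notin> L" for p p'
  proof -
    define B where "B = cmod (eis 4 p') + 1"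
    have B: "B > 0" by (simp add: B_def add_nonneg_pos)
    have "\<forall>\<^sub>F w in at p. B \<le> cmod (eis 4 w)"
      using character_pole[OF one p, of 4] B unfolding filterlim_at_infinity[OF order_refl] by simp
    then have 1: "\<forall>\<^sub>F w in nhds p. w \<notin> L \<longrightarrow> B \<le> cmod (eis 4 w)"
      unfolding eventually_at_filter by eventually_elim (use p in auto)
    have 2: "\<forall>\<^sub>F w in nhds p'. cmod (eis 4 w) < B"
      by (rule order_tendstoD(2)[OF tendsto_norm[OF lim[OF p']]]) (auto simp: B_def)
    show "\<forall>\<^sub>F z in nhds (p, p'). fst z \<notin> L \<longrightarrow> eis 4 (fst z) \<noteq> eis 4 (snd z)"
      using eventually_compose_filterlim[OF 1 limfst] eventually_compose_filterlim[OF 2 limsnd]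
      by eventually_elim auto
    show "\<forall>\<^sub>F z in nhds (p', p). snd z \<notin> L \<longrightarrow> eis 4 (fst z) \<noteq> eis 4 (snd z)"
      using eventually_compose_filterlim[OF 1 limsnd] eventually_compose_filterlim[OF 2 limfst]
      by eventually_elim auto
  qed
  have "\<exists>K. \<forall>z\<in>period_cell \<times> period_cell. Q K z"
  proof (rule compact_uniform_bound[OF compact_Times[OF compact_period_cell compact_period_cell]])
    fix z :: "complex \<times> complex"
    obtain p p' where z: "z = (p, p')" by fastforce
    show "\<exists>K. \<forall>\<^sub>F z in nhds z. Q K z"
    proof (cases "p \<in> L"; cases "p' \<in> L")
      assume p: "p \<in> L" and p': "p' \<in> L"
      obtain q q' where q: "p = lat q" "p' = lat q'" using p p' by blast
      obtain \<delta> where \<delta>: "\<delta> > 0" and \<delta>inj: "\<forall>x y. cmod x < \<delta> \<and> cmod y < \<delta> \<and> x \<notin> L \<and> y \<notin> L \<and>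
          eis 4 x = eis 4 y \<and> eis 5 x = eis 5 y \<longrightarrow> x = y"
        using esum_injective_near_0 by (elim exE conjE)
      have inj: "x = y" if "cmod x < \<delta>" "cmod y < \<delta>" "x \<notin> L" "y \<notin> L" "eis 4 x = eis 4 y" "eis 5 x = eis 5 y" for x y
        using \<delta>inj[rule_format, of x y] that by simp
      have near: "\<forall>\<^sub>F w in nhds p. cmod (w - p) < \<delta>" for p
        using \<delta> by (auto simp: eventually_nhds_metric dist_norm)
      have "\<forall>\<^sub>F z in nhds z. Q 5 z"
        unfolding z using eventually_compose_filterlim[OF near limfst] eventually_compose_filterlim[OF near limsnd]
      proof eventually_elim
        case (elim z)
        show ?case unfolding Q_def
        proof
          assume *: "fst z \<notin> L \<and> snd z \<notin> L \<and> (\<forall>k\<in>{4..5}. eis k (fst z) = eis k (snd z))"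
          have "fst z - p = snd z - p'"
          proof (rule inj)
            have "eis k (fst z - p) = eis k (fst z)" "eis k (snd z - p') = eis k (snd z)" for k
              using per[of k "fst z - p" q] per[of k "snd z - p'" q'] q by simp_all
            then show "eis 4 (fst z - p) = eis 4 (snd z - p')" "eis 5 (fst z - p) = eis 5 (snd z - p')"
              using * by auto
            show "fst z - p \<notin> L" "snd z - p' \<notin> L"
              using * L_add[OF _ p, of "fst z - p"] L_add[OF _ p', of "snd z - p'"] by auto
          qed (use elim in auto)
          then have "fst z - snd z = p - p'" by (simp add: algebra_simps)
          then show "fst z - snd z \<in> L" using L_diff[OF p p'] by simp
        qed
      qed
      then show ?thesis by blast
    next
      assume "p \<in> L" "p' \<notin> L"
      from mixed(1)[OF this] have "\<forall>\<^sub>F z in nhds z. Q 4 z"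
        unfolding z by eventually_elim (auto simp: Q_def)
      then show ?thesis by blast
    next
      assume "p \<notin> L" "p' \<in> L"
      from mixed(2)[OF this(2,1)] have "\<forall>\<^sub>F z in nhds z. Q 4 z"
        unfolding z by eventually_elim (auto simp: Q_def)
      then show ?thesis by blast
    next
      assume p: "p \<notin> L" and p': "p' \<notin> L"
      show ?thesis
      proof (cases "p - p' \<in> L")
        case False
        have "\<exists>k\<ge>4. eis k p \<noteq> eis k p'"
        proof (rule ccontr)
          assume "\<not> ?thesis"
          then have "p - p' \<in> L" by (intro esum_separation p p') simp
          with False show False ..
        qed
        then obtain k where k: "k \<ge> 4" "eis k p \<noteq> eis k p'" by (elim exE conjE)
        have "((\<lambda>z. eis k (fst z) - eis k (snd z)) \<longlongrightarrow> eis k p - eis k p') (nhds z)"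
          unfolding z using filterlim_compose[OF lim[OF p k(1)] limfst] filterlim_compose[OF lim[OF p' k(1)] limsnd]
          by (intro tendsto_diff)
        then have "\<forall>\<^sub>F z in nhds z. eis k (fst z) - eis k (snd z) \<noteq> 0"
          by (rule tendsto_imp_eventually_ne) (use k in auto)
        then have "\<forall>\<^sub>F z in nhds z. Q k z"
          by eventually_elim (use k in \<open>auto simp: Q_def\<close>)
        then show ?thesis by blast
      next
        case True
        then obtain q where q: "p - p' = lat q" by blast
        \<comment> \<open>Starting at 5 makes \<open>j = k - 1\<close> an admissible exponent, and
          \<open>eis k p\<close> is, up to a nonzero factor, the derivative of \<open>eis j\<close>
          at \<open>p\<close>.\<close>
        obtain k where k: "k \<ge> 5" "eis k p \<noteq> 0" using esum_nonvanishing[OF one p, of 5] by auto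
        define j where "j = k - 1"
        have j: "j \<ge> 4" "k = Suc j" using k by (auto simp: j_def)
        have "deriv (eis j) p = - of_nat j * eis k p"
          using character_deriv[OF one p j(1)] j(2) by (simp add: DERIV_imp_deriv)
        then have "deriv (eis j) p \<noteq> 0" using k j by simp
        moreover have "eis j holomorphic_on - L" using esum_holomorphic[of "\<lambda>_. 1" j] j by simp
        ultimately obtain r where r: "r > 0" "ball p r \<subseteq> - L" "inj_on (eis j) (ball p r)"
          using has_complex_derivative_locally_injective[of "eis j" "- L" p] p connected_Compl_L(2) by auto
        have near: "\<forall>\<^sub>F w in nhds p. cmod (w - p) < r" for p
          using r by (auto simp: eventually_nhds_metric dist_norm)
        have "\<forall>\<^sub>F z in nhds z. Q j z"
          unfolding z using eventually_compose_filterlim[OF near limfst] eventually_compose_filterlim[OF near limsnd]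
        proof eventually_elim
          case (elim z)
          show ?case unfolding Q_def
          proof
            assume *: "fst z \<notin> L \<and> snd z \<notin> L \<and> (\<forall>k\<in>{4..j}. eis k (fst z) = eis k (snd z))"
            \<comment> \<open>Shifting the second point by the period \<open>p - p'\<close> brings
              it into the disc around \<open>p\<close> without changing
              \<open>eis j\<close>.\<close>
            have eq: "p - (snd z + lat q) = p' - snd z" using q by (simp add: algebra_simps)
            have "fst z \<in> ball p r" "snd z + lat q \<in> ball p r"
              unfolding mem_ball dist_norm eq using elim by (simp_all add: norm_minus_commute)
            moreover have "eis j (fst z) = eis j (snd z + lat q)" using * j per by auto
            ultimately have "fst z = snd z + lat q" using r(3) by (auto simp: inj_on_def)
            then show "fst z - snd z \<in> L" by simp
          qed
        qed
        then show ?thesis by blast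
      qed
    qed
  qed (auto simp: Q_def)
  then obtain K where K: "\<And>w w'. w \<in> period_cell \<Longrightarrow> w' \<in> period_cell \<Longrightarrow> Q K (w, w')" by auto
  show ?thesis
  proof (intro exI allI impI)
    fix w w' assume *: "w \<notin> L \<and> w' \<notin> L \<and> (\<forall>k\<in>{4..K}. eis k w = eis k w')"
    obtain q q' where q: "w - lat q \<in> period_cell" "w' - lat q' \<in> period_cell" using reduce_to_period_cell by meson
    have "eis k (w - lat q) = eis k w" "eis k (w' - lat q') = eis k w'" for k
      using per[of k "w - lat q" q] per[of k "w' - lat q'" q'] by simp_all
    moreover have "w - lat q \<notin> L" "w' - lat q' \<notin> L"
      using * L_add_lat_iff[of "w - lat q" q] L_add_lat_iff[of "w' - lat q'" q'] by auto
    ultimately have "(w - lat q) - (w' - lat q') \<in> L" using K[OF q] * by (auto simp: Q_def)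
    moreover have "w - w' = ((w - lat q) - (w' - lat q')) + (lat q - lat q')" by simp
    ultimately show "w - w' \<in> L" by (metis L_add L_diff rangeI)
  qed
qed

end

section \<open>Matrices of full column rank\<close>

text \<open>Gaussian elimination by induction on \<open>n\<close>. If every form ignores the last
  variable, the last unit vector is a common zero; otherwise a form with nonzero last coefficient
  serves as pivot.\<close>

lemma common_zero_or_basis:
  fixes R :: "(nat \<Rightarrow> 'a::field) set"
  shows "(\<exists>v. (\<exists>j<n. v j \<noteq> 0) \<and> (\<forall>\<rho>\<in>R. (\<Sum>j<n. \<rho> j * v j) = 0)) \<or>
    (\<exists>r C. (\<forall>i<n. r i \<in> R) \<and> (\<forall>j<n. \<forall>l<n. (\<Sum>i<n. C j i * r i l) = (if j = l then 1 else 0)))"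
proof (induction n arbitrary: R)
  case 0
  then show ?case by simp
next
  case (Suc n)
  show ?case
  proof (cases "\<forall>\<rho>\<in>R. \<rho> n = 0")
    case True
    then have "\<forall>\<rho>\<in>R. (\<Sum>j<Suc n. \<rho> j * (if j = n then 1 else 0)) = 0" by simp
    then show ?thesis by (intro disjI1 exI[of _ "\<lambda>j. if j = n then 1 else 0"]) auto
  next
    case False
    then obtain \<sigma> where \<sigma>: "\<sigma> \<in> R" "\<sigma> n \<noteq> 0" by blast
    \<comment> \<open>Subtracting a multiple of the pivot \<open>\<sigma>\<close> clears the last
      coefficient, so the induction hypothesis applies to the remaining \<open>n\<close>
      variables.\<close>
    define E where "E \<rho> = (\<lambda>j. \<rho> j - \<rho> n / \<sigma> n * \<sigma> j)" for \<rho> :: "nat \<Rightarrow> 'a"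
    have En: "E \<rho> n = 0" for \<rho> using \<sigma>(2) by (simp add: E_def)
    from Suc.IH[of "E ` R"] show ?thesis
    proof (elim disjE exE conjE)
      fix v j assume j: "j < n" "v j \<noteq> 0" and v: "\<forall>\<rho>\<in>E ` R. (\<Sum>j<n. \<rho> j * v j) = 0"
      \<comment> \<open>The last entry \<open>- t\<close> is chosen so that the pivot vanishes on
        \<open>w\<close>; every other form is its eliminated version plus a multiple of the
        pivot.\<close>
      define t where "t = (\<Sum>j<n. \<sigma> j * v j) / \<sigma> n"
      define w where "w = v(n := - t)"
      have "(\<Sum>j<Suc n. \<rho> j * w j) = 0" if "\<rho> \<in> R" for \<rho>
      proof -
        have "(\<Sum>j<n. \<rho> j * v j) = \<rho> n / \<sigma> n * (\<Sum>j<n. \<sigma> j * v j)"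
          using v that by (simp add: E_def algebra_simps sum_subtractf sum_distrib_left)
        then show ?thesis by (simp add: w_def t_def)
      qed
      moreover have "\<exists>j<Suc n. w j \<noteq> 0" using j by (intro exI[of _ j]) (simp add: w_def)
      ultimately show ?thesis by blast
    next
      fix r' C' assume "\<forall>i<n. r' i \<in> E ` R"
        and C': "\<forall>j<n. \<forall>l<n. (\<Sum>i<n. C' j i * r' i l) = (if j = l then 1 else 0)"
      then have "\<forall>i. \<exists>\<rho>. i < n \<longrightarrow> \<rho> \<in> R \<and> r' i = E \<rho>" by blast
      then obtain \<rho> where \<rho>: "\<And>i. i < n \<Longrightarrow> \<rho> i \<in> R" "\<And>i. i < n \<Longrightarrow> r' i = E (\<rho> i)" by metis
      define r where "r = \<rho>(n := \<sigma>)"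
      \<comment> \<open>Rewriting \<open>E (\<rho> i)\<close> through the original forms subtracts
        \<open>\<sigma>\<close> with total weight \<open>s j\<close>, whence the entry
        \<open>- s j\<close> of \<open>D\<close>. The last row of \<open>C\<close> frees
        \<open>\<sigma>\<close> of its first \<open>n\<close> coefficients by means of
        \<open>D\<close> and divides the rest by \<open>\<sigma> n\<close>.\<close>
      define s where "s j = (\<Sum>i<n. C' j i * (\<rho> i n / \<sigma> n))" for j
      define D where "D j i = (if i < n then C' j i else - s j)" for j i
      define C where "C j i = (if j < n then D j i
        else ((if i < n then 0 else 1) - (\<Sum>l<n. \<sigma> l * D l i)) / \<sigma> n)" for j i
      have D: "(\<Sum>i<Suc n. D j i * r i l) = (if j = l then 1 else 0)" if "j < n" "l < Suc n" for j l
      proof -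
        have "(\<Sum>i<Suc n. D j i * r i l) = (\<Sum>i<n. C' j i * \<rho> i l) - s j * \<sigma> l"
          by (simp add: D_def r_def)
        also have "\<dots> = (\<Sum>i<n. C' j i * E (\<rho> i) l)"
          by (simp add: E_def s_def algebra_simps sum_subtractf sum_distrib_left)
        also have "\<dots> = (\<Sum>i<n. C' j i * r' i l)" using \<rho>(2) by simp
        also have "\<dots> = (if j = l then 1 else 0)"
        proof (cases "l = n")
          case True
          then show ?thesis using that \<rho>(2) En by simp
        qed (use that C' in auto)
        finally show ?thesis .
      qed
      have "(\<Sum>i<Suc n. C j i * r i l) = (if j = l then 1 else 0)" if "j < Suc n" "l < Suc n" for j l
      proof (cases "j < n")
        case True
        then show ?thesis using D[OF True that(2)] by (simp add: C_def)
      next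
        case False
        have "(\<Sum>i<Suc n. (\<Sum>k<n. \<sigma> k * D k i) * r i l) = (\<Sum>k<n. \<sigma> k * (\<Sum>i<Suc n. D k i * r i l))"
          unfolding sum_distrib_left sum_distrib_right by (subst sum.swap) (simp add: mult.assoc)
        also have "\<dots> = (\<Sum>k<n. \<sigma> k * (if k = l then 1 else 0))"
          using D that(2) by (intro sum.cong) auto
        also have "\<dots> = (if l < n then \<sigma> l else 0)"
          by (simp add: if_distrib[of "\<lambda>a. _ * a"] sum.delta' cong: if_cong)
        finally have *: "(\<Sum>i<Suc n. (\<Sum>k<n. \<sigma> k * D k i) * r i l) = (if l < n then \<sigma> l else 0)" .
        have "\<sigma> n * (\<Sum>i<Suc n. C j i * r i l)
            = (\<Sum>i<Suc n. (if i < n then 0 else 1) * r i l - (\<Sum>k<n. \<sigma> k * D k i) * r i l)"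
          using False \<sigma>(2) unfolding sum_distrib_left by (intro sum.cong) (simp_all add: C_def left_diff_distrib)
        also have "\<dots> = \<sigma> l - (if l < n then \<sigma> l else 0)"
          unfolding sum_subtractf * by (simp add: r_def)
        also have "\<dots> = \<sigma> n * (if j = l then 1 else 0)" using False that by (cases "l = n") auto
        finally show ?thesis using \<sigma>(2) by simp
      qed
      moreover have "\<forall>i<Suc n. r i \<in> R" using \<rho>(1) \<sigma>(1) by (simp add: r_def less_Suc_eq)
      ultimately show ?thesis by blast
    qed
  qed
qed

text \<open>Linear independence is stated for the set of columns, so repeated columns must be ruled
  out first: they would leave fewer than \<open>nc\<close> vectors and a smaller rank.\<close>

lemma full_rank_trivial_kernel:
  assumes A: "A \<in> carrier_mat nr nc" and rank: "vec_space.rank nr A = nc"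
    and v: "v \<in> carrier_vec nc" "A *\<^sub>v v = 0\<^sub>v nr"
  shows "v = 0\<^sub>v nc"
proof -
  interpret vec_space "TYPE('a::field)" nr .
  have dist: "distinct (cols A)"
  proof (rule ccontr)
    assume "\<not> distinct (cols A)"
    then have lt: "card (set (cols A)) < nc"
      using A cols_length card_length card_distinct carrier_matD(2)
      by (metis le_neq_implies_less)
    obtain S where S: "maximal S (\<lambda>T. T \<subseteq> set (cols A) \<and> lin_indpt T)"
      using maximal_exists[of "(\<lambda>T. T \<subseteq> set (cols A) \<and> lin_indpt T)" "card (set (cols A))" "{}"]
      by (meson List.finite_set card_mono empty_iff empty_subsetI finite_lin_indpt2 rev_finite_subset)
    then have "card S \<le> card (set (cols A))" by (simp add: card_mono maximal_def)
    then show False using rank_card_indpt[OF A S] rank lt by simp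
  qed
  have "lin_indpt (set (cols A))" by (rule full_rank_lin_indpt[OF A rank dist])
  then show ?thesis using lin_depI[OF A v(1) _ v(2) dist] by blast
qed

text \<open>Full rank means that the rows have no common nonzero zero, so \<open>n\<close> of them
  form an invertible block over the rationals; for a square block the left inverse is also a right
  inverse.\<close>

lemma essential_imp_invertible_rows:
  assumes n: "dim_col A = n" and ess: "essential A"
  shows "\<exists>r C. inj_on r {..<n} \<and> (\<forall>i<n. r i < dim_row A) \<and>
    (\<forall>j<n. \<forall>l<n. (\<Sum>i<n. C j i * of_int (A $$ (r i, l))) = (if j = l then 1 else 0 :: rat)) \<and>
    (\<forall>i<n. \<forall>k<n. (\<Sum>j<n. of_int (A $$ (r i, j)) * C j k) = (if i = k then 1 else 0 :: rat))"
proof -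
  let ?B = "map_mat rat_of_int A"
  have B: "?B \<in> carrier_mat (dim_row A) n" using n by (intro carrier_matI) auto
  \<comment> \<open>\<open>corank\<close> is a truncated difference of naturals, so its vanishing
    only makes \<open>n\<close> a lower bound of the rank; the number of columns gives the upper
    bound.\<close>
  have "vec_space.rank (dim_row A) ?B \<le> n" by (rule vec_space.rank_le_nc[OF B])
  then have rank: "vec_space.rank (dim_row A) ?B = n" using ess n by (simp add: essential_def corank_def)
  define f where "f i = (\<lambda>j. rat_of_int (A $$ (i, j)))" for i
  have "\<not> (\<exists>v. (\<exists>j<n. v j \<noteq> 0) \<and> (\<forall>\<rho>\<in>f ` {..<dim_row A}. (\<Sum>j<n. \<rho> j * v j) = 0))"
  proof
    assume "\<exists>v. (\<exists>j<n. v j \<noteq> 0) \<and> (\<forall>\<rho>\<in>f ` {..<dim_row A}. (\<Sum>j<n. \<rho> j * v j) = 0)"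
    then obtain v j where j: "j < n" "v j \<noteq> 0" and v: "\<And>i. i < dim_row A \<Longrightarrow> (\<Sum>j<n. f i j * v j) = 0"
      by auto
    have "?B *\<^sub>v vec n v = 0\<^sub>v (dim_row A)"
    proof (rule eq_vecI)
      fix i assume "i < dim_vec (0\<^sub>v (dim_row A) :: rat vec)"
      then have i: "i < dim_row A" by simp
      have "(?B *\<^sub>v vec n v) $ i = (\<Sum>j<n. f i j * v j)"
        using i n by (auto intro!: sum.cong simp: scalar_prod_def f_def lessThan_atLeast0)
      then show "(?B *\<^sub>v vec n v) $ i = 0\<^sub>v (dim_row A) $ i" using v[OF i] i by simp
    qed simp
    then have "vec n v = 0\<^sub>v n" by (intro full_rank_trivial_kernel[OF B rank]) auto
    then have "vec n v $ j = 0\<^sub>v n $ j" by simp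
    then show False using j by simp
  qed
  with common_zero_or_basis[of n "f ` {..<dim_row A}"]
  obtain \<rho> C where \<rho>: "\<And>i. i < n \<Longrightarrow> \<rho> i \<in> f ` {..<dim_row A}"
    and C: "\<And>j l. j < n \<Longrightarrow> l < n \<Longrightarrow> (\<Sum>i<n. C j i * \<rho> i l) = (if j = l then 1 else 0)" by blast
  from \<rho> have "\<forall>i. \<exists>k. i < n \<longrightarrow> k < dim_row A \<and> \<rho> i = f k" by blast
  then obtain r where r: "\<And>i. i < n \<Longrightarrow> r i < dim_row A" "\<And>i. i < n \<Longrightarrow> \<rho> i = f (r i)" by metis
  define MC where "MC = mat n n (\<lambda>(j, i). C j i)"
  define MB where "MB = mat n n (\<lambda>(i, l). rat_of_int (A $$ (r i, l)))"
  have c: "MC \<in> carrier_mat n n" "MB \<in> carrier_mat n n" by (auto simp: MC_def MB_def)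
  have CB: "(\<Sum>i<n. C j i * of_int (A $$ (r i, l))) = (if j = l then 1 else 0)" if "j < n" "l < n" for j l
    using C[OF that] r(2) by (simp add: f_def)
  have "MC * MB = 1\<^sub>m n"
    by (rule eq_matI) (auto simp: MC_def MB_def scalar_prod_def CB[unfolded lessThan_atLeast0])
  then have "MB * MC = 1\<^sub>m n" by (rule mat_mult_left_right_inverse[OF c])
  then have BC: "(\<Sum>j<n. of_int (A $$ (r i, j)) * C j k) = (if i = k then 1 else 0)" if "i < n" "k < n" for i k
  proof -
    have "(MB * MC) $$ (i, k) = (\<Sum>j<n. of_int (A $$ (r i, j)) * C j k)"
      using that by (simp add: MC_def MB_def scalar_prod_def lessThan_atLeast0)
    then show ?thesis using \<open>MB * MC = 1\<^sub>m n\<close> that by simp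
  qed
  \<comment> \<open>A repeated row would make the off-diagonal entry at \<open>(i, k)\<close> of the
    product equal to the diagonal entry 1.\<close>
  have "inj_on r {..<n}"
  proof (rule inj_onI)
    fix i k assume ik: "i \<in> {..<n}" "k \<in> {..<n}" "r i = r k"
    then have "(\<Sum>j<n. rat_of_int (A $$ (r i, j)) * C j k) = 1" using BC[of k k] by simp
    then show "i = k" using BC[of i k] ik by (auto split: if_splits)
  qed
  then show ?thesis using r(1) CB BC by blast
qed

section \<open>Powers of an elliptic curve\<close>

lemma second_countable_euclidean: "second_countable (euclidean :: 'a::second_countable_topology topology)"
proof -
  obtain B :: "'a set set" where B: "countable B" "topological_basis B" using ex_countable_basis by blast
  show ?thesis
    unfolding second_countable_def
  proof (intro exI conjI allI impI ballI)
    show "countable B" by (rule B(1))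
    show "openin euclidean V" if "V \<in> B" for V using topological_basis_open[OF B(2) that] by simp
    fix U and x :: 'a assume "openin euclidean U \<and> x \<in> U"
    then obtain V where "V \<in> B" "x \<in> V" "V \<subseteq> U" using topological_basisE[OF B(2), of U x] by auto
    then show "\<exists>V\<in>B. x \<in> V \<and> V \<subseteq> U" by blast
  qed
qed

lemma openin_cspace_vimage:
  assumes "continuous_on W g" "openin (cspace_top m) W" "open T"
  shows "openin (cspace_top m) {x \<in> W. g x \<in> T}"
proof -
  have "openin (top_of_set W) (W \<inter> g -` T)" by (rule continuous_openin_preimage_gen[OF assms(1,3)])
  then have "openin (subtopology (cspace_top m) W) (W \<inter> g -` T)"
    using openin_cspace_subset[OF assms(2)]
    by (simp add: cspace_top_def subtopology_subtopology Int_absorb1)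
  then have "openin (cspace_top m) (W \<inter> g -` T)" using openin_trans_full assms(2) by blast
  moreover have "W \<inter> g -` T = {x \<in> W. g x \<in> T}" by auto
  ultimately show ?thesis by simp
qed

lemma open_cspace_box:
  assumes "openin (cspace_top m) W" "z \<in> W"
  shows "\<exists>X. (\<forall>i. open (X i)) \<and> (\<forall>i. z i \<in> X i) \<and> {x \<in> cspace m. \<forall>i. x i \<in> X i} \<subseteq> W"
proof -
  obtain T where T: "open T" "W = cspace m \<inter> T" using assms(1) by (auto simp: openin_cspace_top)
  have "openin (product_topology (\<lambda>i. euclidean) UNIV) T" using T(1) by (simp add: euclidean_product_topology)
  from product_topology_open_contains_basis[OF this, of z] assms(2) T(2)
  obtain X where X: "z \<in> Pi\<^sub>E UNIV X" "\<forall>i. openin euclidean (X i)" "Pi\<^sub>E UNIV X \<subseteq> T" by blast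
  then show ?thesis using T(2) by (intro exI[of _ X]) (auto simp: PiE_def Pi_iff)
qed

lemma openin_cspace_polydisc:
  assumes "\<And>i. i < n \<Longrightarrow> open (B i)"
  shows "openin (cspace_top n) {x \<in> cspace n. \<forall>i<n. x i \<in> B i}"
proof -
  let ?X = "\<lambda>i. if i < n then B i else UNIV"
  have "(\<forall>i. x i \<in> ?X i) \<longleftrightarrow> (\<forall>i<n. x i \<in> B i)" for x :: cvec by (metis UNIV_I)
  then have "{x \<in> cspace n. \<forall>i<n. x i \<in> B i} = cspace n \<inter> Pi\<^sub>E UNIV ?X"
    unfolding PiE_UNIV_domain Pi_def by blast
  moreover have "open (Pi\<^sub>E UNIV ?X)"
  proof (rule open_PiE)
    show "finite {i. ?X i \<noteq> UNIV}" by (rule finite_subset[of _ "{..<n}"]) auto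
  qed (use assms in auto)
  ultimately show ?thesis by (auto simp: openin_cspace_top)
qed

context plane_lattice begin

section \<open>The covering of E^n by C^n and the quotient topology\<close>

abbreviation proj :: "complex \<Rightarrow> complex set" where "proj \<equiv> curve_proj L"
abbreviation \<pi> :: "nat \<Rightarrow> cvec \<Rightarrow> nat \<Rightarrow> complex set" where "\<pi> \<equiv> power_proj L"
abbreviation curve_top :: "complex set topology" where "curve_top \<equiv> elliptic_curve_top L"
abbreviation power_top :: "nat \<Rightarrow> (nat \<Rightarrow> complex set) topology" where
  "power_top n \<equiv> product_topology (\<lambda>_. curve_top) {..<n}"

lemma proj_eq: "proj z = (\<lambda>l. l + z) ` L"
  by (auto simp: curve_proj_def r_coset_def complex_add_def)

lemma proj_eq_iff: "proj z = proj w \<longleftrightarrow> z - w \<in> L"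
proof
  assume "proj z = proj w"
  moreover have "z \<in> proj z" unfolding proj_eq using rangeI[of lat 0] by (intro image_eqI[of _ _ 0]) auto
  ultimately obtain l where "l \<in> L" "z = l + w" unfolding proj_eq by blast
  then show "z - w \<in> L" by simp
next
  assume zw: "z - w \<in> L"
  have "proj a \<subseteq> proj b" if "a - b \<in> L" for a b
  proof
    fix x assume "x \<in> proj a"
    then obtain l where "l \<in> L" "x = l + a" unfolding proj_eq by blast
    then have "x = (l + (a - b)) + b" "l + (a - b) \<in> L" using L_add[OF _ that] by auto
    then show "x \<in> proj b" unfolding proj_eq by blast
  qed
  from this[OF zw] this[of w z] show "proj z = proj w" using L_uminus[OF zw] by auto
qed

lemma carrier_elliptic_curve: "carrier (elliptic_curve L) = range proj"
  by (auto simp: elliptic_curve_def carrier_FactGroup curve_proj_def complex_add_def)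

lemma topspace_curve_top: "topspace curve_top = range proj"
proof (rule subset_antisym)
  show "topspace curve_top \<subseteq> range proj"
    using openin_topspace[of curve_top] unfolding openin_elliptic_curve_top carrier_elliptic_curve by blast
  have "proj -` range proj = UNIV" by auto
  then show "range proj \<subseteq> topspace curve_top"
    by (intro openin_subset) (simp add: openin_elliptic_curve_top carrier_elliptic_curve)
qed

lemma topspace_power_top: "topspace (power_top n) = (\<Pi>\<^sub>E j\<in>{..<n}. range proj)"
  by (simp add: topspace_curve_top)

text \<open>The preimage of the image is a union of lattice translates of \<open>W\<close>, each of
  them open.\<close>

lemma openin_curve_proj_image:
  assumes "open W" shows "openin curve_top (proj ` W)"
proof -
  have "proj -` (proj ` W) = (\<Union>l\<in>L. (+) l ` W)"
  proof (intro equalityI subsetI)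
    fix x assume "x \<in> proj -` (proj ` W)"
    then obtain w where "w \<in> W" "proj x = proj w" by auto
    then have "x - w \<in> L" "x = (x - w) + w" by (simp_all add: proj_eq_iff)
    with \<open>w \<in> W\<close> show "x \<in> (\<Union>l\<in>L. (+) l ` W)" by blast
  next
    fix x assume "x \<in> (\<Union>l\<in>L. (+) l ` W)"
    then obtain l w where "l \<in> L" "w \<in> W" "x = l + w" by blast
    then have "proj x = proj w" by (simp add: proj_eq_iff)
    with \<open>w \<in> W\<close> show "x \<in> proj -` (proj ` W)" by blast
  qed
  then show ?thesis
    unfolding openin_elliptic_curve_top carrier_elliptic_curve using assms by (auto intro: open_translation)
qed

text \<open>With \<open>2 * r\<close> at most the distance of \<open>z - w\<close> from the lattice,
  a common class of the two balls of radius \<open>r\<close> would produce a period closer to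
  \<open>z - w\<close>.\<close>

lemma Hausdorff_curve_top: "Hausdorff_space curve_top"
  unfolding Hausdorff_space_def
proof (intro allI impI)
  fix x y assume "x \<in> topspace curve_top \<and> y \<in> topspace curve_top \<and> x \<noteq> y"
  then obtain z w where zw: "x = proj z" "y = proj w" "proj z \<noteq> proj w" unfolding topspace_curve_top by blast
  then have "z - w \<notin> lat ` UNIV" by (simp add: proj_eq_iff)
  from lat_avoid[OF this] obtain r where r: "r > 0" "\<And>p. 2 * r \<le> cmod (z - w - lat p)" by auto
  have "disjnt (proj ` ball z r) (proj ` ball w r)"
  proof -
    have False if ab: "a \<in> ball z r" "b \<in> ball w r" "proj a = proj b" for a b
    proof -
      obtain p where p: "a - b = lat p" using ab(3) proj_eq_iff by auto
      have "z - w - lat p = (z - a) - (w - b)" using p by (simp add: algebra_simps)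
      then have "cmod (z - w - lat p) \<le> cmod (z - a) + cmod (w - b)" by (metis norm_triangle_ineq4)
      then show False using r(2)[of p] ab by (simp add: dist_norm)
    qed
    then show ?thesis unfolding disjnt_def by blast
  qed
  then show "\<exists>U V. openin curve_top U \<and> openin curve_top V \<and> x \<in> U \<and> y \<in> V \<and> disjnt U V"
    using r(1) zw by (intro exI[of _ "proj ` ball z r"] exI[of _ "proj ` ball w r"]) (auto intro: openin_curve_proj_image)
qed

lemma continuous_map_proj: "continuous_map euclidean curve_top proj"
  unfolding continuous_map_def by (auto simp: topspace_curve_top openin_elliptic_curve_top vimage_def)

lemma \<pi>_apply: "j < n \<Longrightarrow> \<pi> n z j = proj (z j)"
  by (simp add: power_proj_def)

lemma \<pi>_eq_iff: "\<pi> n z = \<pi> n w \<longleftrightarrow> (\<forall>j<n. z j - w j \<in> L)"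
proof
  assume "\<pi> n z = \<pi> n w"
  then have "\<pi> n z j = \<pi> n w j" for j by simp
  then show "\<forall>j<n. z j - w j \<in> L" by (metis \<pi>_apply proj_eq_iff)
next
  assume "\<forall>j<n. z j - w j \<in> L"
  then show "\<pi> n z = \<pi> n w" unfolding power_proj_def by (intro restrict_ext) (simp add: proj_eq_iff)
qed

lemma \<pi>_image: "\<pi> n ` cspace n = topspace (power_top n)"
proof (intro equalityI subsetI)
  fix x assume "x \<in> \<pi> n ` cspace n"
  then show "x \<in> topspace (power_top n)" unfolding topspace_power_top by (auto simp: power_proj_def)
next
  fix x assume x: "x \<in> topspace (power_top n)"
  then have "\<forall>j. \<exists>z. j < n \<longrightarrow> x j = proj z" unfolding topspace_power_top by (auto simp: PiE_iff)
  then obtain z where z: "\<And>j. j < n \<Longrightarrow> x j = proj (z j)" by metis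
  have "x = \<pi> n (\<lambda>j. if j < n then z j else 0)"
    using x z unfolding topspace_power_top power_proj_def
    by (intro ext) (auto simp: PiE_iff extensional_def)
  then show "x \<in> \<pi> n ` cspace n" by (intro image_eqI) (auto simp: cspace_def)
qed

lemma continuous_map_\<pi>: "continuous_map (cspace_top n) (power_top n) (\<pi> n)"
proof -
  have "continuous_map (cspace_top n) curve_top (\<lambda>z. \<pi> n z j)" if "j \<in> {..<n}" for j
  proof -
    have "continuous_map (cspace_top n) euclidean (\<lambda>z. z j)"
      unfolding cspace_top_def by (auto intro: continuous_on_product_coordinates continuous_on_subset)
    from continuous_map_compose[OF this continuous_map_proj]
    show ?thesis using that by (simp add: o_def \<pi>_apply)
  qed
  then show ?thesis
    by (intro continuous_map_coordinatewise_then_product) (auto simp: power_proj_def)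
qed

text \<open>Boxes suffice: the image of a box contains the product of the images of its first
  \<open>n\<close> sides, since the other sides contain 0.\<close>

lemma open_map_\<pi>: "open_map (cspace_top n) (power_top n) (\<pi> n)"
  unfolding open_map_def
proof (intro allI impI)
  fix W assume W: "openin (cspace_top n) W"
  show "openin (power_top n) (\<pi> n ` W)"
  proof (subst openin_subopen, rule ballI)
    fix x assume "x \<in> \<pi> n ` W"
    then obtain z where z: "z \<in> W" "x = \<pi> n z" by blast
    from open_cspace_box[OF W z(1)] obtain X where X: "\<And>i. open (X i)" "\<And>i. z i \<in> X i"
      "{x \<in> cspace n. \<forall>i. x i \<in> X i} \<subseteq> W" by blast
    have zn: "z \<in> cspace n" using z(1) openin_cspace_subset[OF W] by blast
    let ?B = "\<Pi>\<^sub>E i\<in>{..<n}. proj ` X i"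
    have "openin (power_top n) ?B"
      by (subst openin_PiE_gen) (auto intro: openin_curve_proj_image X(1))
    moreover have "x \<in> ?B" using X(2) by (auto simp: z(2) power_proj_def)
    moreover have "?B \<subseteq> \<pi> n ` W"
    proof
      fix y assume y: "y \<in> ?B"
      then have "\<forall>i. \<exists>u. i < n \<longrightarrow> u \<in> X i \<and> y i = proj u" by (auto simp: PiE_iff)
      then obtain u where u: "\<And>i. i < n \<Longrightarrow> u i \<in> X i" "\<And>i. i < n \<Longrightarrow> y i = proj (u i)" by metis
      let ?u = "\<lambda>i. if i < n then u i else 0"
      have "?u i \<in> X i" for i using u(1) X(2)[of i] zn by (auto simp: cspace_def)
      then have "?u \<in> W" using X(3) by (auto simp: cspace_def)
      moreover have "y = \<pi> n ?u"
        using y u(2) unfolding power_proj_def by (intro ext) (auto simp: PiE_iff extensional_def)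
      ultimately show "y \<in> \<pi> n ` W" by blast
    qed
    ultimately show "\<exists>T. openin (power_top n) T \<and> x \<in> T \<and> T \<subseteq> \<pi> n ` W" by blast
  qed
qed

lemma second_countable_power_top: "second_countable (power_top n)"
proof (rule second_countable_open_map_image[OF continuous_map_\<pi> open_map_\<pi>])
  show "\<pi> n ` topspace (cspace_top n) = topspace (power_top n)" by (simp only: topspace_cspace_top \<pi>_image)
  show "second_countable (cspace_top n)"
    unfolding cspace_top_def by (intro second_countable_subtopology second_countable_euclidean)
qed

lemma L_discrete: "\<exists>r>0. \<forall>l\<in>L. cmod l < r \<longrightarrow> l = 0"
proof -
  have "0 \<notin> lat ` {p. lat p \<noteq> 0}" by auto
  from lat_avoid[OF this] obtain r where r: "r > 0" "\<And>p. lat p \<noteq> 0 \<Longrightarrow> 2 * r \<le> cmod (lat p)" by auto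
  then show ?thesis by (intro exI[of _ r]) fastforce
qed

lemma \<pi>_inj_on_small:
  assumes "z \<in> cspace n"
  shows "\<exists>V. openin (cspace_top n) V \<and> z \<in> V \<and> inj_on (\<pi> n) V"
proof -
  obtain r where r: "r > 0" "\<And>l. l \<in> L \<Longrightarrow> cmod l < r \<Longrightarrow> l = 0" using L_discrete by blast
  define V where "V = {x \<in> cspace n. \<forall>i<n. x i \<in> ball (z i) (r / 2)}"
  have "openin (cspace_top n) V" unfolding V_def by (rule openin_cspace_polydisc) simp
  moreover have "inj_on (\<pi> n) V"
  proof (rule inj_onI)
    fix x y assume xy: "x \<in> V" "y \<in> V" "\<pi> n x = \<pi> n y"
    have "x i = y i" if i: "i < n" for i
    proof -
      have "dist (z i) (x i) < r / 2" "dist (z i) (y i) < r / 2" using xy i by (auto simp: V_def)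
      then have "dist (x i) (y i) < r" using dist_triangle_half_r by blast
      moreover have "x i - y i \<in> L" using xy(3) i by (simp add: \<pi>_eq_iff)
      ultimately show ?thesis using r(2)[of "x i - y i"] by (simp add: dist_norm)
    qed
    then show "x = y" using cspace_eq_iff xy(1,2) V_def by blast
  qed
  ultimately show ?thesis using r(1) assms by (intro exI[of _ V]) (auto simp: V_def)
qed

text \<open>Charts are local inverses of the covering. A change of charts is continuous and differs
  from the identity by periods; since these are discrete, it is locally a translation.\<close>

lemma complex_manifold_open_in_elliptic_power:
  assumes S: "openin (power_top n) S"
  shows "complex_manifold (open_submanifold (elliptic_power L n) S)"
proof -
  let ?X = "subtopology (power_top n) S"
  let ?M = "open_submanifold (elliptic_power L n) S"
  have M: "mtop ?M = ?X" "mdim ?M = n"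
    "atlas ?M = {(\<pi> n ` V \<inter> S, inv_into V (\<pi> n)) |V. openin (cspace_top n) V \<and> inj_on (\<pi> n) V}"
    by (simp_all add: open_submanifold_def elliptic_power_def setcompr_eq_image image_image)
  have Ssub: "S \<subseteq> topspace (power_top n)" using openin_subset[OF S] .
  have preS: "openin (cspace_top n) {z \<in> cspace n. \<pi> n z \<in> S}"
    using openin_continuous_map_preimage[OF continuous_map_\<pi> S] by simp
  have chart: "is_chart ?X n (\<pi> n ` V \<inter> S, inv_into V (\<pi> n))"
    and img: "inv_into V (\<pi> n) ` (\<pi> n ` V \<inter> S) = {z \<in> V. \<pi> n z \<in> S}"
    if V: "openin (cspace_top n) V" "inj_on (\<pi> n) V" for V
  proof -
    define V' where "V' = {z \<in> V. \<pi> n z \<in> S}"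
    have Vn: "V \<subseteq> cspace n" using openin_cspace_subset[OF V(1)] .
    have "V' = V \<inter> {z \<in> cspace n. \<pi> n z \<in> S}" using Vn by (auto simp: V'_def)
    then have V'o: "openin (cspace_top n) V'" using V(1) preS by auto
    have \<pi>V': "\<pi> n ` V' = \<pi> n ` V \<inter> S" by (auto simp: V'_def)
    have injV': "inj_on (\<pi> n) V'" using V(2) by (rule inj_on_subset) (auto simp: V'_def)
    have V'n: "V' \<subseteq> cspace n" using openin_cspace_subset[OF V'o] .
    have inv: "inv_into V (\<pi> n) (\<pi> n z) = z" if "z \<in> V" for z using V(2) that by simp
    show img: "inv_into V (\<pi> n) ` (\<pi> n ` V \<inter> S) = V'"
      unfolding \<pi>V'[symmetric] image_image using inv by (auto simp: V'_def)
    have top: "subtopology ?X (\<pi> n ` V') = subtopology (power_top n) (\<pi> n ` V')"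
      by (simp add: subtopology_subtopology \<pi>V' Int_absorb1 Int_commute)
    have "homeomorphic_map (subtopology (cspace_top n) V') (subtopology (power_top n) (\<pi> n ` V')) (\<pi> n)"
    proof (rule bijective_open_imp_homeomorphic_map)
      show "continuous_map (subtopology (cspace_top n) V') (subtopology (power_top n) (\<pi> n ` V')) (\<pi> n)"
        by (auto simp: continuous_map_in_subtopology continuous_map_from_subtopology[OF continuous_map_\<pi>])
      show "open_map (subtopology (cspace_top n) V') (subtopology (power_top n) (\<pi> n ` V')) (\<pi> n)"
        using open_map_\<pi>[of n] V'o unfolding open_map_def
        by (metis imageI image_mono image_subset_iff openin_imp_subset openin_subset_topspace_eq openin_subtopology_Int2 openin_trans_full inf.absorb_iff2)
      show "\<pi> n ` topspace (subtopology (cspace_top n) V') = topspace (subtopology (power_top n) (\<pi> n ` V'))"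
      proof -
        have "\<pi> n ` V' \<subseteq> topspace (power_top n)" using V'n \<pi>_image by blast
        then show ?thesis using V'n unfolding topspace_subtopology topspace_cspace_top by (simp add: Int_absorb1)
      qed
      show "inj_on (\<pi> n) (topspace (subtopology (cspace_top n) V'))"
        by (rule inj_on_subset[OF injV']) auto
    qed
    then obtain g where g: "homeomorphic_maps (subtopology (cspace_top n) V') (subtopology (power_top n) (\<pi> n ` V')) (\<pi> n) g"
      by (auto simp: homeomorphic_map_maps)
    then have "homeomorphic_map (subtopology (power_top n) (\<pi> n ` V')) (subtopology (cspace_top n) V') g"
      by (simp add: homeomorphic_maps_map)
    then have "homeomorphic_map (subtopology (power_top n) (\<pi> n ` V')) (subtopology (cspace_top n) V') (inv_into V (\<pi> n))"
    proof (rule homeomorphic_map_eq)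
      fix x assume "x \<in> topspace (subtopology (power_top n) (\<pi> n ` V'))"
      then obtain z where z: "z \<in> V'" "x = \<pi> n z" by auto
      have "g (\<pi> n z) = z" using g z(1) V'n by (auto simp: homeomorphic_maps_def)
      then show "g x = inv_into V (\<pi> n) x" using z inv by (simp add: V'_def)
    qed
    moreover have "openin ?X (\<pi> n ` V')"
    proof -
      have "openin (power_top n) (\<pi> n ` V')" using open_map_\<pi>[of n] V'o by (simp add: open_map_def)
      moreover have "\<pi> n ` V' \<subseteq> S" by (auto simp: V'_def)
      ultimately show ?thesis by (metis inf.absorb_iff2 inf_commute openin_subtopology_Int2)
    qed
    ultimately show "is_chart ?X n (\<pi> n ` V \<inter> S, inv_into V (\<pi> n))"
      using V'o unfolding is_chart_def prod.case img unfolding \<pi>V'[symmetric] top by blast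
  qed
  have trans: "holomorphic_vec n n (inv_into V' (\<pi> n) \<circ> inv_into (\<pi> n ` V \<inter> S) (inv_into V (\<pi> n)))
      (inv_into V (\<pi> n) ` ((\<pi> n ` V \<inter> S) \<inter> (\<pi> n ` V' \<inter> S)))"
    if V: "openin (cspace_top n) V" "inj_on (\<pi> n) V" and V': "openin (cspace_top n) V'" "inj_on (\<pi> n) V'" for V V'
  proof -
    define O' where "O' = inv_into V (\<pi> n) ` ((\<pi> n ` V \<inter> S) \<inter> (\<pi> n ` V' \<inter> S))"
    have open1: "openin ?X (\<pi> n ` V \<inter> S)" "openin ?X (\<pi> n ` V' \<inter> S)"
      using chart[OF V] chart[OF V'] by (auto simp: is_chart_def)
    have O'o: "openin (cspace_top n) O'"
      unfolding O'_def by (rule chart_openin[OF chart[OF V] openin_Int[OF open1]]) blast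
    have O'V: "x \<in> V" "\<pi> n x \<in> S" "\<pi> n x \<in> \<pi> n ` V'" if "x \<in> O'" for x
    proof -
      from that[unfolded O'_def] obtain u where x: "x = inv_into V (\<pi> n) u"
        and u: "u \<in> (\<pi> n ` V \<inter> S) \<inter> (\<pi> n ` V' \<inter> S)" by (rule imageE)
      from u have uV: "u \<in> \<pi> n ` V" by simp
      show "x \<in> V" unfolding x by (rule inv_into_into[OF uV])
      have "\<pi> n x = u" unfolding x by (rule f_inv_into_f[OF uV])
      with u show "\<pi> n x \<in> S" "\<pi> n x \<in> \<pi> n ` V'" by simp_all
    qed
    define G where "G x = inv_into V' (\<pi> n) (\<pi> n x)" for x
    have G: "G x \<in> V'" "\<pi> n (G x) = \<pi> n x" if "x \<in> O'" for x
      using O'V(3)[OF that] by (auto simp: G_def inv_into_into f_inv_into_f)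
    have "continuous_map (subtopology (cspace_top n) O') (cspace_top n) G"
    proof -
      have "continuous_map (subtopology (cspace_top n) O') (subtopology ?X (\<pi> n ` V' \<inter> S)) (\<pi> n)"
        using O'V by (auto simp: continuous_map_in_subtopology continuous_map_from_subtopology[OF continuous_map_\<pi>])
      moreover have "continuous_map (subtopology ?X (\<pi> n ` V' \<inter> S)) (cspace_top n) (inv_into V' (\<pi> n))"
        using chart[OF V'] unfolding is_chart_def prod.case
        by (meson continuous_map_in_subtopology homeomorphic_imp_continuous_map)
      ultimately have "continuous_map (subtopology (cspace_top n) O') (cspace_top n) (inv_into V' (\<pi> n) \<circ> \<pi> n)"
        by (rule continuous_map_compose)
      then show ?thesis by (simp add: G_def[abs_def] o_def)
    qed
    moreover have "subtopology (cspace_top n) O' = top_of_set O'"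
      using openin_cspace_subset[OF O'o] by (simp add: cspace_top_def subtopology_subtopology Int_absorb1)
    ultimately have contG: "continuous_on O' G" by (simp add: cspace_top_def continuous_map_in_subtopology)
    obtain r where r: "r > 0" "\<And>l. l \<in> L \<Longrightarrow> cmod l < r \<Longrightarrow> l = 0" using L_discrete by blast
    have "holomorphic_vec n n G O'"
      unfolding holomorphic_vec_def
    proof (intro conjI allI impI O'o)
      show "G ` O' \<subseteq> cspace n" using G(1) openin_cspace_subset[OF V'(1)] by blast
      fix j assume j: "j < n"
      show "holomorphic_fun n (\<lambda>x. G x j) O'"
      proof (rule holomorphic_fun_local[OF O'o])
        fix p assume p: "p \<in> O'"
        let ?c = "G p j - p j"
        \<comment> \<open>\<open>G x j - x j\<close> is a period for every \<open>x\<close>; on this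
          neighbourhood it stays closer to its value at \<open>p\<close> than distinct periods are
          to each other, so it is constant.\<close>
        define N where "N = {x \<in> O'. G x j - x j \<in> ball ?c r}"
        have "continuous_on O' (\<lambda>x. G x j - x j)"
          by (intro continuous_on_diff continuous_on_product_then_coordinatewise[OF contG]
              continuous_on_subset[OF continuous_on_product_coordinates]) auto
        then have N: "openin (cspace_top n) N" unfolding N_def by (rule openin_cspace_vimage[OF _ O'o open_ball])
        have "G x j = x j + ?c" if "x \<in> N" for x
        proof -
          have "G x j - x j \<in> L" if "x \<in> O'" for x using G(2)[OF that] j by (simp add: \<pi>_eq_iff)
          then have "?c - (G x j - x j) \<in> L" using p that by (intro L_diff[where x = "?c"]) (auto simp: N_def)
          moreover have "cmod (?c - (G x j - x j)) < r" using that by (simp add: N_def dist_norm)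
          ultimately have "?c - (G x j - x j) = 0" by (rule r(2))
          then show ?thesis by (simp add: algebra_simps)
        qed
        moreover have "holomorphic_fun n (\<lambda>x. x j + ?c) N"
          by (intro holomorphic_fun_add holomorphic_fun_coord holomorphic_fun_const N)
        moreover have "p \<in> N" "N \<subseteq> O'" using p r(1) by (auto simp: N_def)
        ultimately show "\<exists>V f. p \<in> V \<and> V \<subseteq> O' \<and> holomorphic_fun n f V \<and> (\<forall>x\<in>V. G x j = f x)" by blast
      qed
    qed
    moreover have "inv_into (\<pi> n ` V \<inter> S) (inv_into V (\<pi> n)) x = \<pi> n x" if "x \<in> O'" for x
    proof (rule inv_into_f_eq)
      show "inj_on (inv_into V (\<pi> n)) (\<pi> n ` V \<inter> S)" by (rule inj_on_inv_into) auto
    qed (use O'V[OF that] V(2) in auto)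
    ultimately show ?thesis
      unfolding O'_def[symmetric] by (elim holomorphic_vec_cong) (simp add: G_def)
  qed
  have "Hausdorff_space ?X"
    by (intro Hausdorff_space_subtopology) (simp add: Hausdorff_space_product_topology Hausdorff_curve_top)
  moreover have "second_countable ?X" by (intro second_countable_subtopology second_countable_power_top)
  moreover have "(\<Union>(U, \<phi>)\<in>atlas ?M. U) = topspace ?X"
  proof (intro equalityI subsetI)
    fix x assume "x \<in> (\<Union>(U, \<phi>)\<in>atlas ?M. U)"
    then show "x \<in> topspace ?X" using Ssub unfolding M by auto
  next
    fix x assume "x \<in> topspace ?X"
    then have x: "x \<in> S" "x \<in> \<pi> n ` cspace n" unfolding \<pi>_image by auto
    then obtain z where z: "z \<in> cspace n" "x = \<pi> n z" by blast
    from \<pi>_inj_on_small[OF z(1)] obtain V where V: "openin (cspace_top n) V" "z \<in> V" "inj_on (\<pi> n) V" by blast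
    then have "(\<pi> n ` V \<inter> S, inv_into V (\<pi> n)) \<in> atlas ?M" unfolding M by blast
    moreover have "x \<in> \<pi> n ` V \<inter> S" using V z x by blast
    ultimately show "x \<in> (\<Union>(U, \<phi>)\<in>atlas ?M. U)" by blast
  qed
  ultimately show ?thesis
    unfolding complex_manifold_def M(1,2)
  proof (intro conjI ballI)
    fix c assume "c \<in> atlas ?M"
    then show "is_chart ?X n c" unfolding M(3) using chart by blast
    show "case c of (U, \<phi>) \<Rightarrow> \<forall>(V, \<psi>)\<in>atlas ?M. holomorphic_vec n n (\<psi> \<circ> inv_into U \<phi>) (\<phi> ` (U \<inter> V))"
      using \<open>c \<in> atlas ?M\<close> trans unfolding M(3) by auto
  qed
qed

end

section \<open>Embedding the complement of an arrangement\<close>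

lemma finite_uniform_bound:
  assumes "finite X" and ex: "\<And>x. x \<in> X \<Longrightarrow> \<exists>K::nat. P K x"
    and mono: "\<And>K K' x. K \<le> K' \<Longrightarrow> P K x \<Longrightarrow> P K' x"
  shows "\<exists>K. \<forall>x\<in>X. P K x"
proof -
  from ex have "\<forall>x\<in>X. \<exists>K. P K x" by blast
  from bchoice[OF this] obtain f where f: "\<forall>x\<in>X. P (f x) x" by blast
  have "P (Max (insert 0 (f ` X))) x" if "x \<in> X" for x
  proof (rule mono)
    show "f x \<le> Max (insert 0 (f ` X))" using assms(1) that by (intro Max_ge) auto
    show "P (f x) x" using f that by (rule bspec)
  qed
  then show ?thesis by blast
qed

lemma prod_cis: "(\<Prod>i\<in>I. cis (f i)) = cis (\<Sum>i\<in>I. f i)"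
  by (induction I rule: infinite_finite_induct) (simp_all add: cis_mult)

lemma cis_eq_1_imp_Ints:
  assumes "cis (2 * pi * x) = 1" shows "x \<in> \<int>"
proof -
  have "cos (2 * pi * x) = 1" using assms by (metis cis.sel(1) one_complex.sel(1))
  then obtain k :: int where "2 * pi * x = of_int k * 2 * pi" by (auto simp: cos_one_2pi_int)
  then have "x = of_int k" by simp
  then show ?thesis by simp
qed

lemma openin_holomorphic_polydisc:
  fixes k :: nat
  assumes W: "openin (cspace_top n) W" and f: "\<And>i. i < k \<Longrightarrow> holomorphic_fun n (f i) W"
    and B: "\<And>i. i < k \<Longrightarrow> open (B i)"
  shows "openin (cspace_top n) {z \<in> W. \<forall>i<k. f i z \<in> B i}"
proof -
  let ?F = "\<lambda>z i. if i < k then f i z else 0"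
  have "holomorphic_vec n k ?F W"
    using W f by (auto simp: holomorphic_vec_def cspace_def)
  from holomorphic_vec_openin_vimage[OF this openin_cspace_polydisc[of k B, OF B]]
  have "openin (cspace_top n) {z \<in> W. ?F z \<in> {x \<in> cspace k. \<forall>i<k. x i \<in> B i}}" by simp
  moreover have "{z \<in> W. ?F z \<in> {x \<in> cspace k. \<forall>i<k. x i \<in> B i}} = {z \<in> W. \<forall>i<k. f i z \<in> B i}"
    by (auto simp: cspace_def)
  ultimately show ?thesis by simp
qed

context plane_lattice begin

section \<open>The group law of E in terms of lifts\<close>

lemma mult_proj: "proj z \<otimes>\<^bsub>elliptic_curve L\<^esub> proj w = proj (z + w)"
proof -
  have "proj z \<otimes>\<^bsub>elliptic_curve L\<^esub> proj w = {x + y |x y. x \<in> proj z \<and> y \<in> proj w}"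
    by (auto simp: elliptic_curve_def FactGroup_def set_mult_def complex_add_def)
  also have "\<dots> = proj (z + w)"
  proof (intro equalityI subsetI)
    fix x assume "x \<in> {x + y |x y. x \<in> proj z \<and> y \<in> proj w}"
    then obtain l l' where "l \<in> L" "l' \<in> L" "x = (l + z) + (l' + w)" unfolding proj_eq by blast
    then have "x = (l + l') + (z + w)" "l + l' \<in> L" using L_add by auto
    then show "x \<in> proj (z + w)" unfolding proj_eq by blast
  next
    fix x assume "x \<in> proj (z + w)"
    then obtain l where "l \<in> L" "x = l + (z + w)" unfolding proj_eq by blast
    then have "l + z \<in> proj z" "0 + w \<in> proj w" "x = (l + z) + (0 + w)"
      unfolding proj_eq using rangeI[of lat 0] by (auto intro!: image_eqI[of w _ 0])
    then show "x \<in> {x + y |x y. x \<in> proj z \<and> y \<in> proj w}" by blast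
  qed
  finally show ?thesis .
qed

lemma one_elliptic_curve: "\<one>\<^bsub>elliptic_curve L\<^esub> = proj 0"
  unfolding proj_eq by (simp add: elliptic_curve_def FactGroup_def)

lemma int_pow_proj:
  assumes "is_lattice L"
  shows "proj z [^]\<^bsub>elliptic_curve L\<^esub> (a::int) = proj (of_int a * z)"
proof -
  interpret E: comm_group "elliptic_curve L" by (rule comm_group_elliptic_curve[OF assms])
  have nat: "proj z [^]\<^bsub>elliptic_curve L\<^esub> (k::nat) = proj (of_nat k * z)" for k
    by (induction k) (simp_all add: one_elliptic_curve mult_proj algebra_simps)
  have inv: "inv\<^bsub>elliptic_curve L\<^esub> (proj x) = proj (- x)" for x
    by (rule E.inv_equality) (simp_all add: mult_proj one_elliptic_curve carrier_elliptic_curve)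
  show ?thesis
    unfolding int_pow_def2 nat inv by (cases "a < 0") auto
qed

lemma finprod_proj:
  assumes "is_lattice L"
  shows "finprod (elliptic_curve L) (\<lambda>j. proj (g j)) {..<n::nat} = proj (\<Sum>j<n. g j)"
proof -
  interpret E: comm_group "elliptic_curve L" by (rule comm_group_elliptic_curve[OF assms])
  show ?thesis
  proof (induction n)
    case 0 then show ?case by (simp add: one_elliptic_curve)
  next
    case (Suc n)
    have "finprod (elliptic_curve L) (\<lambda>j. proj (g j)) (insert n {..<n}) =
        proj (g n) \<otimes>\<^bsub>elliptic_curve L\<^esub> finprod (elliptic_curve L) (\<lambda>j. proj (g j)) {..<n}"
      by (rule E.finprod_insert) (auto simp: carrier_elliptic_curve)
    then show ?case using Suc by (simp add: lessThan_Suc mult_proj add.commute)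
  qed
qed

lemma arrangement_hom_\<pi>:
  assumes "is_lattice L" "dim_col A = n"
  shows "arrangement_hom L A i (\<pi> n z) = proj (\<Sum>j<n. of_int (A $$ (i, j)) * z j)"
proof -
  interpret E: comm_group "elliptic_curve L" by (rule comm_group_elliptic_curve[OF assms(1)])
  have "arrangement_hom L A i (\<pi> n z) = finprod (elliptic_curve L) (\<lambda>j. proj (of_int (A $$ (i, j)) * z j)) {..<n}"
    unfolding arrangement_hom_def assms(2)
    by (rule E.finprod_cong') (auto simp: \<pi>_apply int_pow_proj[OF assms(1)] carrier_elliptic_curve)
  then show ?thesis by (simp add: finprod_proj[OF assms(1)])
qed

end

text \<open>The data of an essential arrangement after lifting: \<open>b\<close> is the full matrix,
  \<open>\<zeta>\<close> consists of lifts of the constants, \<open>r\<close> lists \<open>n\<close>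
  independent rows and \<open>C\<close> inverts their block. The left inverse recovers
  \<open>z\<close> from the forms and governs the twists; the right inverse shows that prescribed
  values of the forms are attained.\<close>

locale lattice_arrangement = plane_lattice +
  fixes n m :: nat and b :: "nat \<Rightarrow> nat \<Rightarrow> int" and \<zeta> :: "nat \<Rightarrow> complex"
    and r :: "nat \<Rightarrow> nat" and C :: "nat \<Rightarrow> nat \<Rightarrow> real"
  assumes r_less: "i < n \<Longrightarrow> r i < m" and inj_r: "inj_on r {..<n}"
    and left_inverse: "j < n \<Longrightarrow> l < n \<Longrightarrow> (\<Sum>i<n. C j i * of_int (b (r i) l)) = (if j = l then 1 else 0)"
    and right_inverse: "i < n \<Longrightarrow> k < n \<Longrightarrow> (\<Sum>j<n. of_int (b (r i) j) * C j k) = (if i = k then 1 else 0)"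
begin

text \<open>The lift of \<open>f\<^sub>i - \<zeta>\<^sub>i\<close> to the universal covering \<open>\<complex>\<^sup>n\<close>.\<close>

definition lform :: "nat \<Rightarrow> cvec \<Rightarrow> complex" where
  "lform i z = (\<Sum>j<n. of_int (b i j) * z j) - \<zeta> i"

definition complement_cover :: "cvec set" where
  "complement_cover = {z \<in> cspace n. \<forall>i<m. lform i z \<notin> L}"

definition coord :: "bool \<Rightarrow> complex \<Rightarrow> real" where
  "coord q z = (if q then coord1 z else coord2 z)"

text \<open>The entries of \<open>C\<close> need not be integers, so a single twist is in general a
  nontrivial character. The index \<open>i\<close> belongs to a row, while \<open>j\<close> and
  \<open>q\<close> name the component and the real coordinate of \<open>z' - z\<close> that the
  product over \<open>i\<close> is to detect.\<close>

definition twist :: "nat \<Rightarrow> bool \<Rightarrow> nat \<Rightarrow> int \<times> int \<Rightarrow> complex" where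
  "twist j q i p = cis (2 * pi * (C j i * coord q (lat p)))"

lemma coord_add: "coord q (x + y) = coord q x + coord q y"
  by (simp add: coord_def coord_linear)

lemma coord_of_int_mult: "coord q (of_int a * x) = of_int a * coord q x"
  using coord_linear(3,4)[of "of_int a" x] by (simp add: coord_def)

lemma coord_zero: "coord q 0 = 0" by (simp add: coord_def coord1_def coord2_def)

lemma coord_sum: "coord q (\<Sum>l\<in>I. of_int (c l) * d l) = (\<Sum>l\<in>I. of_int (c l) * coord q (d l))"
  by (induction I rule: infinite_finite_induct) (simp_all add: coord_zero coord_add coord_of_int_mult)

lemma L_iff_coord: "(\<And>q. coord q z \<in> \<int>) \<Longrightarrow> z \<in> L"
proof -
  assume *: "\<And>q. coord q z \<in> \<int>"
  from *[of True] *[of False] obtain x y where "coord1 z = of_int x" "coord2 z = of_int y"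
    by (auto simp: coord_def elim!: Ints_cases)
  then have "z = lat (x, y)" by (subst coord_decomposition[of z]) (simp add: lat_def)
  then show "z \<in> L" by blast
qed

lemma character_twist: "character (twist j q i)"
  unfolding character_def twist_def by (simp add: lat_add coord_add distrib_left cis_mult)

lemma lform_diff: "lform i z' - lform i z = (\<Sum>l<n. of_int (b i l) * (z' l - z l))"
  by (simp add: lform_def right_diff_distrib sum_subtractf)

text \<open>The twists are chosen such that their product sees the coordinates of \<open>z'\<^sub>j - z\<^sub>j\<close>: it is trivial
  when this difference is a period, and detects when it is not.\<close>

lemma prod_twist:
  assumes j: "j < n" and \<mu>: "\<And>i. i < n \<Longrightarrow> lform (r i) z' = lform (r i) z + lat (\<mu> i)"
  shows "(\<Prod>i<n. twist j q i (\<mu> i)) = cis (2 * pi * coord q (z' j - z j))"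
proof -
  let ?d = "\<lambda>l. coord q (z' l - z l)"
  have *: "coord q (lat (\<mu> i)) = (\<Sum>l<n. of_int (b (r i) l) * ?d l)" if "i < n" for i
  proof -
    have "lat (\<mu> i) = (\<Sum>l<n. of_int (b (r i) l) * (z' l - z l))"
      using \<mu>[OF that] by (simp flip: lform_diff)
    then show ?thesis by (simp add: coord_sum)
  qed
  have "(\<Sum>i<n. C j i * coord q (lat (\<mu> i))) = (\<Sum>i<n. \<Sum>l<n. C j i * of_int (b (r i) l) * ?d l)"
    by (intro sum.cong) (simp_all add: * sum_distrib_left mult.assoc)
  also have "\<dots> = (\<Sum>l<n. (\<Sum>i<n. C j i * of_int (b (r i) l)) * ?d l)"
    by (subst sum.swap) (simp add: sum_distrib_right)
  also have "\<dots> = (\<Sum>l<n. (if j = l then 1 else 0) * ?d l)"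
    by (intro sum.cong) (simp_all add: left_inverse j)
  also have "\<dots> = ?d j" using j by (simp add: if_distrib[of "\<lambda>a. a * _"] cong: if_cong)
  finally have "(\<Sum>i<n. C j i * coord q (lat (\<mu> i))) = ?d j" .
  then show ?thesis unfolding twist_def prod_cis by (simp flip: sum_distrib_left)
qed

text \<open>The three clauses serve local coordinates, nonzero twisted factors and separation. The
  first begins at 5 because nonvanishing of \<open>eis k\<close> is used as nonvanishing of the
  derivative of \<open>eis (k - 1)\<close>, whose exponent has to be at least 4.\<close>

definition sufficient_exponent :: "nat \<Rightarrow> bool" where
  "sufficient_exponent K \<longleftrightarrow> (\<forall>w. w \<notin> L \<longrightarrow> (\<exists>k\<in>{5..K}. eis k w \<noteq> 0)) \<and>
     (\<forall>j<n. \<forall>q. \<forall>i<n. \<forall>w. w \<notin> L \<longrightarrow> (\<exists>k\<in>{4..K}. esum (twist j q i) k w \<noteq> 0)) \<and>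
     (\<forall>w w'. w \<notin> L \<and> w' \<notin> L \<and> (\<forall>k\<in>{4..K}. eis k w = eis k w') \<longrightarrow> w - w' \<in> L)"

lemma exponent_bound_exists:
  "\<exists>K. sufficient_exponent K"
proof -
  let ?P = "\<lambda>K e. \<forall>w. w \<notin> L \<longrightarrow> (\<exists>k\<in>{4..K}. esum e k w \<noteq> 0)"
  have mono: "\<exists>k\<in>{c..K'}. esum e k w \<noteq> 0" if "\<exists>k\<in>{c..K}. esum e k w \<noteq> 0" "K \<le> K'" for c K K' :: nat and e w
    using that by (meson atLeastAtMost_iff order_trans)
  obtain K1 where K1: "\<forall>w. w \<notin> L \<longrightarrow> (\<exists>k\<in>{5..K1}. eis k w \<noteq> 0)"
    using esum_nonvanishing_uniform[OF character_one, of 5] by auto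
  have "\<exists>K. \<forall>e\<in>(\<lambda>(j, q, i). twist j q i) ` ({..<n} \<times> UNIV \<times> {..<n}). ?P K e"
  proof (rule finite_uniform_bound)
    fix e assume "e \<in> (\<lambda>(j, q, i). twist j q i) ` ({..<n} \<times> UNIV \<times> {..<n})"
    then have "character e" using character_twist by auto
    then show "\<exists>K. ?P K e" by (rule esum_nonvanishing_uniform) simp
  next
    fix K K' e assume "K \<le> K'" "?P K e"
    then show "?P K' e" using mono[of 4 K _ _ K'] by blast
  qed auto
  then obtain K2 where K2: "\<forall>e\<in>(\<lambda>(j, q, i). twist j q i) ` ({..<n} \<times> UNIV \<times> {..<n}). ?P K2 e" by (rule exE)
  have K2': "?P K2 (twist j q i)" if "j < n" "i < n" for j q i
    by (rule bspec[OF K2]) (use that in \<open>auto intro!: image_eqI[of _ _ "(j, q, i)"]\<close>)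
  obtain K3 where K3: "\<forall>w w'. w \<notin> L \<and> w' \<notin> L \<and> (\<forall>k\<in>{4..K3}. eis k w = eis k w') \<longrightarrow> w - w' \<in> L"
    using esum_separation_uniform by (rule exE)
  let ?K = "max K1 (max K2 K3)"
  show ?thesis
    unfolding sufficient_exponent_def
  proof (intro exI[of _ ?K] conjI allI impI)
    fix w assume "w \<notin> L"
    then have "\<exists>k\<in>{5..K1}. eis k w \<noteq> 0" by (rule K1[rule_format])
    then show "\<exists>k\<in>{5..?K}. eis k w \<noteq> 0" by (rule mono) simp
  next
    fix j q i w assume "j < n" "i < n" "w \<notin> L"
    then have "\<exists>k\<in>{4..K2}. esum (twist j q i) k w \<noteq> 0" by (intro K2'[rule_format])
    then show "\<exists>k\<in>{4..?K}. esum (twist j q i) k w \<noteq> 0" by (rule mono) simp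
  next
    fix w w' assume *: "w \<notin> L \<and> w' \<notin> L \<and> (\<forall>k\<in>{4..?K}. eis k w = eis k w')"
    show "w - w' \<in> L" by (rule K3[rule_format]) (use * in auto)
  qed
qed

definition exponent_bound :: nat where
  "exponent_bound = (SOME K. sufficient_exponent K)"

lemma exponent_bound:
  shows exponent_bound_regular: "w \<notin> L \<Longrightarrow> \<exists>k\<in>{5..exponent_bound}. eis k w \<noteq> 0"
    and exponent_bound_twist: "j < n \<Longrightarrow> i < n \<Longrightarrow> w \<notin> L \<Longrightarrow> \<exists>k\<in>{4..exponent_bound}. esum (twist j q i) k w \<noteq> 0"
    and exponent_bound_separation: "w \<notin> L \<Longrightarrow> w' \<notin> L \<Longrightarrow>
      (\<And>k. k \<in> {4..exponent_bound} \<Longrightarrow> eis k w = eis k w') \<Longrightarrow> w - w' \<in> L"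
proof -
  note * = someI_ex[OF exponent_bound_exists, folded exponent_bound_def, unfolded sufficient_exponent_def]
  show "w \<notin> L \<Longrightarrow> \<exists>k\<in>{5..exponent_bound}. eis k w \<noteq> 0"
    by (rule *[THEN conjunct1, rule_format])
  show "j < n \<Longrightarrow> i < n \<Longrightarrow> w \<notin> L \<Longrightarrow> \<exists>k\<in>{4..exponent_bound}. esum (twist j q i) k w \<noteq> 0"
    by (rule *[THEN conjunct2, THEN conjunct1, rule_format])
  show "w \<notin> L \<Longrightarrow> w' \<notin> L \<Longrightarrow>
      (\<And>k. k \<in> {4..exponent_bound} \<Longrightarrow> eis k w = eis k w') \<Longrightarrow> w - w' \<in> L"
    by (rule *[THEN conjunct2, THEN conjunct2, rule_format]) auto
qed

text \<open>The left summand gives the untwisted components of all \<open>m\<close> rows, so that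
  every hypersurface contributes a pole. The right one runs over all exponent functions, because
  which twisted factors are nonzero depends on the point; their extensionality keeps the set
  finite.\<close>

definition index_set :: "(nat \<times> nat + nat \<times> bool \<times> (nat \<Rightarrow> nat)) set" where
  "index_set = Inl ` ({..<m} \<times> {4..exponent_bound}) \<union>
     Inr ` ({..<n} \<times> UNIV \<times> ({..<n} \<rightarrow>\<^sub>E {4..exponent_bound}))"

definition emb :: "nat \<times> nat + nat \<times> bool \<times> (nat \<Rightarrow> nat) \<Rightarrow> cvec \<Rightarrow> complex" where
  "emb \<iota> z = (case \<iota> of Inl (i, k) \<Rightarrow> eis k (lform i z)
     | Inr (j, q, \<kappa>) \<Rightarrow> (\<Prod>i<n. esum (twist j q i) (\<kappa> i) (lform (r i) z)))"

lemma finite_index_set: "finite index_set"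
  unfolding index_set_def by (intro finite_UnI finite_imageI finite_cartesian_product finite_PiE) auto

text \<open>The integer matrix maps periods to periods. Untwisted sums do not notice this; in a
  product the factors pick up the twists, whose product is \<open>cis\<close> of
  \<open>2 * pi\<close> times an integer, the coordinate of a period.\<close>

lemma emb_periodic:
  assumes \<pi>: "\<pi> n z = \<pi> n z'" and \<iota>: "\<iota> \<in> index_set"
  shows "emb \<iota> z' = emb \<iota> z"
proof -
  have "\<forall>l. \<exists>p. l < n \<longrightarrow> z' l - z l = lat p" using \<pi>[symmetric] unfolding \<pi>_eq_iff by blast
  then obtain p where p: "\<And>l. l < n \<Longrightarrow> z' l - z l = lat (p l)" by metis
  define \<mu> where "\<mu> i = (\<Sum>l<n. b i l * fst (p l), \<Sum>l<n. b i l * snd (p l))" for i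
  have \<mu>: "lform i z' = lform i z + lat (\<mu> i)" for i
  proof -
    have "lform i z' - lform i z = (\<Sum>l<n. of_int (b i l) * lat (p l))"
      unfolding lform_diff using p by (intro sum.cong) auto
    also have "\<dots> = lat (\<mu> i)"
      by (simp add: lat_def \<mu>_def sum_distrib_right distrib_left sum.distrib mult.assoc)
    finally show ?thesis by (simp add: algebra_simps)
  qed
  show ?thesis
  proof (cases \<iota>)
    case (Inl a)
    then show ?thesis
      by (cases a) (simp add: emb_def \<mu> esum_quasi_periodic[OF character_one])
  next
    case (Inr a)
    obtain j q \<kappa> where a: "a = (j, q, \<kappa>)" by (cases a) auto
    have j: "j < n" using \<iota> Inr a by (auto simp: index_set_def)
    have "emb \<iota> z' = (\<Prod>i<n. twist j q i (\<mu> (r i))) * emb \<iota> z"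
      unfolding Inr a emb_def by (simp add: \<mu> esum_quasi_periodic[OF character_twist] prod.distrib)
    also have "(\<Prod>i<n. twist j q i (\<mu> (r i))) = cis (2 * pi * coord q (z' j - z j))"
      by (rule prod_twist[OF j \<mu>])
    also have "\<dots> = 1"
      unfolding p[OF j] by (rule cis_multiple_2pi) (auto simp: coord_def)
    finally show ?thesis by simp
  qed
qed

section \<open>Holomorphy of the embedding functions and separation of points\<close>

lemma holomorphic_lform: "openin (cspace_top n) W \<Longrightarrow> holomorphic_fun n (lform i) W"
  unfolding lform_def[abs_def]
  by (intro holomorphic_fun_diff holomorphic_fun_sum holomorphic_fun_cmult holomorphic_fun_coord holomorphic_fun_const)

lemma openin_complement_cover: "openin (cspace_top n) complement_cover"
  using openin_holomorphic_polydisc[OF openin_cspace holomorphic_lform[OF openin_cspace], of m "\<lambda>_. - L"] connected_Compl_L(2)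
  by (simp add: complement_cover_def)

lemma holomorphic_esum_lform:
  assumes e: "character e" and k: "k \<ge> 4" and i: "i < m"
  shows "holomorphic_fun n (\<lambda>z. esum e k (lform i z)) complement_cover"
proof (rule holomorphic_fun_compose1[OF holomorphic_lform[OF openin_complement_cover]])
  fix z assume "z \<in> complement_cover"
  then have "lform i z \<notin> L" using i by (simp add: complement_cover_def)
  from character_deriv[OF e this k] show "esum e k field_differentiable at (lform i z)"
    by (auto simp: field_differentiable_def)
qed

lemma holomorphic_emb:
  assumes "\<iota> \<in> index_set" shows "holomorphic_fun n (emb \<iota>) complement_cover"
proof (cases \<iota>)
  case (Inl a)
  obtain i k where a: "a = (i, k)" by (cases a) auto
  have "i < m" "k \<ge> 4" using assms Inl a by (auto simp: index_set_def)
  then show ?thesis unfolding emb_def[abs_def] Inl a sum.case prod.case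
    by (intro holomorphic_esum_lform character_one)
next
  case (Inr a)
  obtain j q \<kappa> where a: "a = (j, q, \<kappa>)" by (cases a) auto
  have "\<kappa> \<in> {..<n} \<rightarrow>\<^sub>E {4..exponent_bound}" using assms Inr a by (auto simp: index_set_def)
  then have "\<kappa> i \<ge> 4" if "i < n" for i using that by (auto simp: PiE_iff)
  then show ?thesis unfolding emb_def[abs_def] Inr a sum.case prod.case
    by (intro holomorphic_fun_prod holomorphic_esum_lform character_twist openin_complement_cover) (auto simp: r_less)
qed

text \<open>Equality of the untwisted components makes all differences of the forms periods. For
  fixed \<open>j\<close> and \<open>q\<close>, exponents are then chosen so that every twisted
  factor is nonzero at \<open>z\<close>; cancelling the product leaves a twist product equal to 1,
  which says that coordinate \<open>q\<close> of \<open>z' j - z j\<close> is an integer.\<close>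

lemma emb_separates:
  assumes z: "z \<in> complement_cover" and z': "z' \<in> complement_cover"
    and eq: "\<And>\<iota>. \<iota> \<in> index_set \<Longrightarrow> emb \<iota> z = emb \<iota> z'"
  shows "\<pi> n z = \<pi> n z'"
proof -
  have "lform i z' - lform i z \<in> L" if i: "i < m" for i
  proof (rule exponent_bound_separation)
    show "lform i z' \<notin> L" "lform i z \<notin> L" using z z' i by (auto simp: complement_cover_def)
    fix k assume "k \<in> {4..exponent_bound}"
    then have "Inl (i, k) \<in> index_set" using i by (auto simp: index_set_def)
    from eq[OF this] show "eis k (lform i z') = eis k (lform i z)" by (simp add: emb_def)
  qed
  then have "\<forall>i. \<exists>p. i < n \<longrightarrow> lform (r i) z' - lform (r i) z = lat p" using r_less by blast
  then obtain \<mu> where "\<And>i. i < n \<Longrightarrow> lform (r i) z' - lform (r i) z = lat (\<mu> i)" by metis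
  then have \<mu>: "\<And>i. i < n \<Longrightarrow> lform (r i) z' = lform (r i) z + lat (\<mu> i)" by (simp add: algebra_simps)
  have "z' j - z j \<in> L" if j: "j < n" for j
  proof (rule L_iff_coord, rule cis_eq_1_imp_Ints)
    fix q
    have "\<forall>i\<in>{..<n}. \<exists>k\<in>{4..exponent_bound}. esum (twist j q i) k (lform (r i) z) \<noteq> 0"
    proof
      fix i assume "i \<in> {..<n}"
      then have i: "i < n" by simp
      then have "lform (r i) z \<notin> L" using z r_less[OF i] by (simp add: complement_cover_def)
      then show "\<exists>k\<in>{4..exponent_bound}. esum (twist j q i) k (lform (r i) z) \<noteq> 0"
        by (rule exponent_bound_twist[OF j i])
    qed
    then have "\<forall>i\<in>{..<n}. \<exists>k. k \<in> {4..exponent_bound} \<and> esum (twist j q i) k (lform (r i) z) \<noteq> 0" by blast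
    from bchoice[OF this] obtain \<kappa>0 where \<kappa>0: "\<And>i. i < n \<Longrightarrow> \<kappa>0 i \<in> {4..exponent_bound}"
      "\<And>i. i < n \<Longrightarrow> esum (twist j q i) (\<kappa>0 i) (lform (r i) z) \<noteq> 0" by auto
    define \<kappa> where "\<kappa> = restrict \<kappa>0 {..<n}"
    have \<iota>: "Inr (j, q, \<kappa>) \<in> index_set" using j \<kappa>0(1) by (auto simp: index_set_def \<kappa>_def)
    have nz: "emb (Inr (j, q, \<kappa>)) z \<noteq> 0" using \<kappa>0(2) by (simp add: emb_def \<kappa>_def)
    have "emb (Inr (j, q, \<kappa>)) z' = (\<Prod>i<n. twist j q i (\<mu> i) * esum (twist j q i) (\<kappa> i) (lform (r i) z))"
      unfolding emb_def sum.case prod.case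
      by (intro prod.cong) (auto simp: \<mu> esum_quasi_periodic[OF character_twist])
    also have "\<dots> = (\<Prod>i<n. twist j q i (\<mu> i)) * emb (Inr (j, q, \<kappa>)) z"
      by (simp add: prod.distrib emb_def)
    also have "(\<Prod>i<n. twist j q i (\<mu> i)) = cis (2 * pi * coord q (z' j - z j))"
      by (rule prod_twist[OF j]) (rule \<mu>)
    finally show "cis (2 * pi * coord q (z' j - z j)) = 1" using eq[OF \<iota>] nz by simp
  qed
  then show ?thesis unfolding \<pi>_eq_iff using L_uminus by fastforce
qed

text \<open>Changing \<open>z\<close> by periods changes each form by a period, so avoiding the
  hypersurfaces depends only on the class of \<open>z\<close>.\<close>

lemma complement_cover_saturated:
  assumes zn: "z \<in> cspace n" and zS: "\<pi> n z \<in> \<pi> n ` complement_cover"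
  shows "z \<in> complement_cover"
proof -
  obtain z' where z': "z' \<in> complement_cover" "\<pi> n z = \<pi> n z'" using zS by auto
  have "lform i z \<notin> L" if i: "i < m" for i
  proof
    assume "lform i z \<in> L"
    moreover have "lform i z' - lform i z \<in> L"
    proof -
      have d: "z' l - z l \<in> L" if "l < n" for l using z'(2)[symmetric] that unfolding \<pi>_eq_iff by blast
      have sum_L: "(\<Sum>l\<in>I. of_int (b i l) * (z' l - z l)) \<in> L" if "I \<subseteq> {..<n}" for I
        using finite_subset[OF that finite_lessThan] that
      proof (induction I rule: finite_induct)
        case empty
        then show ?case using rangeI[of lat 0] by simp
      next
        case (insert l I)
        have "z' l - z l \<in> L" using d insert.prems by simp
        then obtain p where "z' l - z l = lat p" by (rule rangeE)
        then have "of_int (b i l) * (z' l - z l) = lat (b i l * fst p, b i l * snd p)"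
          by (simp add: lat_def algebra_simps)
        then show ?case using insert by (simp add: L_add)
      qed
      show ?thesis unfolding lform_diff by (rule sum_L) simp
    qed
    ultimately have "lform i z + (lform i z' - lform i z) \<in> L" by (rule L_add)
    then show False using z'(1) i by (simp add: complement_cover_def)
  qed
  then show ?thesis using zn by (simp add: complement_cover_def)
qed

text \<open>The range from 5 to \<open>exponent_bound\<close> contains a suitable exponent for some
  point off the lattice, hence is nonempty. The exponent 4 thus occurs among the components, which
  the dimension count and the pole argument use.\<close>

lemma exponent_bound_ge: "4 \<le> exponent_bound"
proof -
  obtain w where "w \<notin> L"
    using eventually_happens'[OF trivial_limit_at[where ?'a = complex] eventually_not_L[of 0]] by blast
  from exponent_bound_regular[OF this] show ?thesis by auto
qed

text \<open>Exponent, radius and inverse are bundled in one predicate so that they can be chosen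
  simultaneously for all rows.\<close>

definition local_inverse :: "complex \<Rightarrow> nat \<Rightarrow> real \<Rightarrow> (complex \<Rightarrow> complex) \<Rightarrow> bool" where
  "local_inverse w k \<rho> h \<longleftrightarrow> k \<in> {4..exponent_bound} \<and> \<rho> > 0 \<and> open (eis k ` ball w \<rho>) \<and>
     h holomorphic_on (eis k ` ball w \<rho>) \<and> (\<forall>x\<in>ball w \<rho>. h (eis k x) = x)"

lemma local_inverse_exists:
  assumes w: "w \<notin> L"
  shows "\<exists>k \<rho> h. local_inverse w k \<rho> h"
proof -
  obtain k' where k': "k' \<in> {5..exponent_bound}" "eis k' w \<noteq> 0"
    using exponent_bound_regular[OF w] by blast
  \<comment> \<open>The exponent goes down by one because the derivative of \<open>eis k\<close> is
    a nonzero multiple of \<open>eis (Suc k)\<close>.\<close>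
  define k where "k = k' - 1"
  have k: "k \<ge> 4" "k' = Suc k" "k \<in> {4..exponent_bound}" using k' by (auto simp: k_def)
  have "deriv (eis k) w = - of_nat k * eis k' w"
    using character_deriv[OF character_one w k(1)] k(2) by (simp add: DERIV_imp_deriv)
  then have d: "deriv (eis k) w \<noteq> 0" using k' k by simp
  have hol: "eis k holomorphic_on - L" using esum_holomorphic[of "\<lambda>_. 1" k] k(1) by simp
  obtain \<rho> where \<rho>: "\<rho> > 0" "ball w \<rho> \<subseteq> - L" "inj_on (eis k) (ball w \<rho>)"
    by (rule has_complex_derivative_locally_injective[OF hol _ connected_Compl_L(2) d]) (use w in simp)
  have hol': "eis k holomorphic_on ball w \<rho>" using hol \<rho>(2) by (rule holomorphic_on_subset)
  obtain h where h: "h holomorphic_on (eis k ` ball w \<rho>)" "\<And>x. x \<in> ball w \<rho> \<Longrightarrow> h (eis k x) = x"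
    by (rule holomorphic_has_inverse[OF hol' open_ball \<rho>(3)]) blast
  have "open (eis k ` ball w \<rho>)" by (rule open_mapping_thm3[OF hol' open_ball \<rho>(3)])
  then show ?thesis unfolding local_inverse_def using k(3) \<rho>(1) h by (intro exI[of _ k] exI[of _ \<rho>] exI[of _ h]) simp
qed

text \<open>The finitely many \<open>emb\<close> functions, pushed down to E^n, satisfy
  \<open>stein_criterion\<close>: periodicity makes them well defined, separation gives injectivity,
  the poles give closedness, and \<open>n\<close> untwisted components, one for each row
  \<open>r i\<close>, give local coordinates.\<close>

lemma stein_complement:
  "stein_manifold (open_submanifold (elliptic_power L n) (\<pi> n ` complement_cover))"
proof -
  define S where "S = \<pi> n ` complement_cover"
  let ?M = "open_submanifold (elliptic_power L n) S"
  let ?X = "subtopology (power_top n) S"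
  note oU = openin_complement_cover
  have Un: "complement_cover \<subseteq> cspace n" by (auto simp: complement_cover_def)
  have S: "openin (power_top n) S" using open_map_\<pi>[of n] oU by (simp add: open_map_def S_def)
  have Ssub: "S \<subseteq> topspace (power_top n)" using openin_subset[OF S] .
  have M: "mtop ?M = ?X" "mdim ?M = n"
    "atlas ?M = {(\<pi> n ` V \<inter> S, inv_into V (\<pi> n)) |V. openin (cspace_top n) V \<and> inj_on (\<pi> n) V}"
    by (simp_all add: open_submanifold_def elliptic_power_def setcompr_eq_image image_image)
  have topX: "topspace ?X = S" using Ssub by auto
  note saturated = complement_cover_saturated[folded S_def]
  define N where "N = card index_set"
  obtain idx where idx: "bij_betw idx {..<N} index_set"
    using ex_bij_betw_nat_finite[OF finite_index_set] unfolding N_def lessThan_atLeast0 by blast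
  have idx_in: "idx c \<in> index_set" if "c < N" for c using idx that by (auto simp: bij_betw_def)
  have idx_surj: "\<exists>c. c < N \<and> idx c = \<iota>" if "\<iota> \<in> index_set" for \<iota>
    using that unfolding bij_betw_imp_surj_on[OF idx, symmetric] by auto
  define G where "G z = (\<lambda>c. if c < N then emb (idx c) z else 0)" for z
  have G_eq_iff: "G z = G z' \<longleftrightarrow> (\<forall>\<iota>\<in>index_set. emb \<iota> z = emb \<iota> z')" for z z'
  proof
    assume eq: "G z = G z'"
    show "\<forall>\<iota>\<in>index_set. emb \<iota> z = emb \<iota> z'"
    proof
      fix \<iota> assume "\<iota> \<in> index_set"
      from idx_surj[OF this] obtain c where "c < N" "idx c = \<iota>" by blast
      then show "emb \<iota> z = emb \<iota> z'" using fun_cong[OF eq, of c] by (simp add: G_def)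
    qed
  qed (auto simp: G_def idx_in)
  have G_hol: "holomorphic_vec n N G complement_cover"
    unfolding holomorphic_vec_def
  proof (intro conjI allI impI oU)
    fix j assume "j < N"
    then show "holomorphic_fun n (\<lambda>x. G x j) complement_cover"
      using holomorphic_emb[OF idx_in[of j]] by (simp add: G_def)
  qed (auto simp: G_def cspace_def)
  have G_per: "G z = G z'" if "\<pi> n z = \<pi> n z'" for z z'
    unfolding G_eq_iff using emb_periodic[OF that] by simp
  have G_sep: "\<pi> n z = \<pi> n z'" if "z \<in> complement_cover" "z' \<in> complement_cover" "G z = G z'" for z z'
    by (rule emb_separates[OF that(1,2)]) (use that(3) in \<open>simp add: G_eq_iff\<close>)
  define \<Phi> where "\<Phi> x = G (inv_into complement_cover (\<pi> n) x)" for x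
  have \<Phi>\<pi>: "\<Phi> (\<pi> n z) = G z" if "z \<in> complement_cover" for z
    unfolding \<Phi>_def by (rule G_per) (use that in \<open>simp add: f_inv_into_f\<close>)
  have "stein_manifold ?M"
  proof (rule stein_criterion[where N = N and \<Phi> = \<Phi>])
    show "complex_manifold ?M" by (rule complex_manifold_open_in_elliptic_power[OF S])
    show "mdim ?M \<le> N"
    proof -
      have "inj_on (\<lambda>i. Inl (r i, 4)) {..<n}" using inj_r by (auto simp: inj_on_def)
      moreover have "(\<lambda>i. Inl (r i, 4)) ` {..<n} \<subseteq> index_set"
        using r_less exponent_bound_ge by (auto simp: index_set_def)
      ultimately have "card {..<n} \<le> card index_set" using card_inj_on_le finite_index_set by blast
      then show ?thesis by (simp add: M N_def)
    qed
    show "inj_on \<Phi> (topspace (mtop ?M))"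
    proof (rule inj_onI)
      fix x y assume xy: "x \<in> topspace (mtop ?M)" "y \<in> topspace (mtop ?M)" "\<Phi> x = \<Phi> y"
      then obtain z w where "z \<in> complement_cover" "x = \<pi> n z" "w \<in> complement_cover" "y = \<pi> n w"
        unfolding M topX unfolding S_def by blast
      then show "x = y" using G_sep[of z w] xy(3) \<Phi>\<pi> by simp
    qed
    fix U \<phi> assume "(U, \<phi>) \<in> atlas ?M"
    then obtain V where V: "U = \<pi> n ` V \<inter> S" "\<phi> = inv_into V (\<pi> n)" "openin (cspace_top n) V" "inj_on (\<pi> n) V"
      unfolding M by blast
    have Vn: "V \<subseteq> cspace n" using openin_cspace_subset[OF V(3)] .
    have \<phi>U: "\<phi> ` U = V \<inter> complement_cover"
    proof (intro equalityI subsetI)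
      fix x assume "x \<in> \<phi> ` U"
      then obtain z where z: "z \<in> V" "\<pi> n z \<in> S" "x = inv_into V (\<pi> n) (\<pi> n z)" unfolding V(1,2) by blast
      then have "x = z" using V(4) by simp
      then show "x \<in> V \<inter> complement_cover" using z saturated Vn by auto
    next
      fix x assume x: "x \<in> V \<inter> complement_cover"
      then have "x = \<phi> (\<pi> n x)" "\<pi> n x \<in> U" using V by (auto simp: S_def)
      then show "x \<in> \<phi> ` U" by blast
    qed
    have "openin (cspace_top n) (V \<inter> complement_cover)" using V(3) oU by blast
    then have "holomorphic_vec n N G (V \<inter> complement_cover)" by (intro holomorphic_vec_subset[OF G_hol]) auto
    moreover have "\<Phi> (inv_into U \<phi> x) = G x" if x: "x \<in> V \<inter> complement_cover" for x
    proof -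
      have "inv_into U \<phi> x = \<pi> n x"
      proof (rule inv_into_f_eq)
        show "inj_on \<phi> U" unfolding V(1,2) by (rule inj_on_inv_into) auto
      qed (use x V in \<open>auto simp: S_def\<close>)
      then show ?thesis using \<Phi>\<pi> x by simp
    qed
    ultimately show "holomorphic_vec (mdim ?M) N (\<lambda>x. \<Phi> (inv_into U \<phi> x)) (\<phi> ` U)"
      unfolding M \<phi>U by (rule holomorphic_vec_cong)
  next
    show "closed_map (mtop ?M) (cspace_top N) \<Phi>"
      unfolding closed_map_def M(1)
    proof (intro allI impI)
      fix Q assume Q: "closedin ?X Q"
      have QS: "Q \<subseteq> S" using closedin_subset[OF Q] topX by simp
      have "openin (power_top n) (S - Q)"
      proof -
        have "openin ?X (S - Q)" using Q topX by (metis closedin_def)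
        then show ?thesis using openin_trans_full S by blast
      qed
      then have preQ: "openin (cspace_top n) {z \<in> cspace n. \<pi> n z \<in> S - Q}"
        using openin_continuous_map_preimage[OF continuous_map_\<pi>] by fastforce
      \<comment> \<open>A sequence is lifted to the period cell, where a subsequence of the lifts
        converges. The limit lies off all hypersurfaces: otherwise the component of that row with
        exponent 4 would tend to infinity, although the image sequence converges.\<close>
      have "closed (\<Phi> ` Q)"
        unfolding closed_sequential_limits
      proof (intro allI impI, elim conjE)
        fix y l assume y: "\<forall>k. y k \<in> \<Phi> ` Q" and lim: "y \<longlonglongrightarrow> l"
        have "\<forall>k. \<exists>z. z \<in> complement_cover \<and> \<pi> n z \<in> Q \<and> y k = G z \<and> (\<forall>i<n. z i \<in> period_cell)"
        proof
          fix k
          obtain x where x: "x \<in> Q" "y k = \<Phi> x" using y by blast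
          then obtain z where z: "z \<in> complement_cover" "x = \<pi> n z" using QS unfolding S_def by blast
          have "\<forall>i. \<exists>q. z i - lat q \<in> period_cell" using reduce_to_period_cell by blast
          then obtain q where q: "\<And>i. z i - lat (q i) \<in> period_cell" by metis
          define z' where "z' i = (if i < n then z i - lat (q i) else 0)" for i
          have \<pi>z': "\<pi> n z' = \<pi> n z" unfolding \<pi>_eq_iff using L_uminus by (auto simp: z'_def)
          have "z' \<in> complement_cover"
            by (rule saturated) (use z \<pi>z' in \<open>auto simp: z'_def cspace_def S_def\<close>)
          moreover have "G z' = G z" by (rule G_per[OF \<pi>z'])
          ultimately show "\<exists>z. z \<in> complement_cover \<and> \<pi> n z \<in> Q \<and> y k = G z \<and> (\<forall>i<n. z i \<in> period_cell)"
            using x z \<pi>z' \<Phi>\<pi>[OF z(1)] q by (intro exI[of _ z']) (simp add: z'_def)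
        qed
        from choice[OF this] obtain z where z: "\<And>k. z k \<in> complement_cover" "\<And>k. \<pi> n (z k) \<in> Q" "\<And>k. y k = G (z k)"
            "\<And>k i. i < n \<Longrightarrow> z k i \<in> period_cell" by auto
        \<comment> \<open>The factor \<open>{0}\<close> from index \<open>n\<close> on confines the
          vectors to \<open>cspace n\<close> and keeps the infinite product compact.\<close>
        let ?P = "Pi\<^sub>E UNIV (\<lambda>i. if i < n then period_cell else {0})"
        have "compactin (product_topology (\<lambda>i::nat. euclidean) UNIV) ?P"
          by (auto simp: compactin_PiE compact_period_cell)
        then have "compact ?P" by (simp add: euclidean_product_topology)
        then have "seq_compact ?P" by (rule compact_imp_seq_compact)
        moreover have "z k \<in> ?P" for k
          using z(1)[of k] z(4)[of _ k] Un by (auto simp: cspace_def)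
        ultimately obtain z0 \<sigma> where z0: "z0 \<in> ?P" and \<sigma>: "strict_mono \<sigma>" and zlim: "(z \<circ> \<sigma>) \<longlonglongrightarrow> z0"
          unfolding seq_compact_def by metis
        have z0n: "z0 \<in> cspace n" using z0 by (auto simp: cspace_def PiE_iff) (metis leD singletonD)
        have ylim: "(y \<circ> \<sigma>) \<longlonglongrightarrow> l" using LIMSEQ_subseq_LIMSEQ[OF lim \<sigma>] .
        have coordlim: "(\<lambda>k. (z \<circ> \<sigma>) k i) \<longlonglongrightarrow> z0 i" for i
          by (rule tendsto_cvec_coord[OF zlim])
        have lformlim: "(\<lambda>k. lform i ((z \<circ> \<sigma>) k)) \<longlonglongrightarrow> lform i z0" for i
          unfolding lform_def by (intro tendsto_intros coordlim)
        have "lform i z0 \<notin> L" if i: "i < m" for i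
        proof
          assume inL: "lform i z0 \<in> L"
          have "Inl (i, 4) \<in> index_set" using i exponent_bound_ge by (auto simp: index_set_def)
          from idx_surj[OF this] obtain c where c: "c < N" "idx c = Inl (i, 4)" by blast
          have "(\<lambda>k. (y \<circ> \<sigma>) k c) \<longlonglongrightarrow> l c"
            by (rule tendsto_cvec_coord[OF ylim])
          then have fin: "(\<lambda>k. eis 4 (lform i ((z \<circ> \<sigma>) k))) \<longlonglongrightarrow> l c"
            using c by (simp add: z(3) G_def emb_def)
          have flt: "filterlim (\<lambda>k. lform i ((z \<circ> \<sigma>) k)) (at (lform i z0)) sequentially"
          proof (rule filterlim_atI[OF lformlim])
            have "lform i ((z \<circ> \<sigma>) k) \<notin> L" for k using z(1) i by (simp add: complement_cover_def)
            then show "\<forall>\<^sub>F k in sequentially. lform i ((z \<circ> \<sigma>) k) \<noteq> lform i z0"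
              using inL by (intro always_eventually) metis
          qed
          have "filterlim (\<lambda>k. eis 4 (lform i ((z \<circ> \<sigma>) k))) at_infinity sequentially"
            by (rule filterlim_compose[OF character_pole[OF character_one inL order_refl] flt])
          with fin show False using not_tendsto_and_filterlim_at_infinity[of sequentially] by auto
        qed
        then have z0U: "z0 \<in> complement_cover" using z0n by (simp add: complement_cover_def)
        have "continuous_on complement_cover G" by (rule holomorphic_vec_continuous[OF G_hol])
        then have "(\<lambda>k. G ((z \<circ> \<sigma>) k)) \<longlonglongrightarrow> G z0"
          by (rule continuous_on_tendsto_compose[OF _ zlim z0U]) (simp add: z(1))
        then have "(y \<circ> \<sigma>) \<longlonglongrightarrow> G z0" by (simp add: o_def z(3))
        then have l: "l = G z0" using ylim LIMSEQ_unique by blast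
        have "\<pi> n z0 \<in> Q"
        proof (rule ccontr)
          assume "\<pi> n z0 \<notin> Q"
          then have "z0 \<in> {z \<in> cspace n. \<pi> n z \<in> S - Q}" using z0U z0n by (simp add: S_def)
          moreover obtain T where T: "open T" "{z \<in> cspace n. \<pi> n z \<in> S - Q} = cspace n \<inter> T"
            using preQ by (auto simp: openin_cspace_top)
          ultimately have "z0 \<in> T" by blast
          then have "\<forall>\<^sub>F k in sequentially. (z \<circ> \<sigma>) k \<in> T" by (rule topological_tendstoD[OF zlim T(1)])
          then obtain k where "(z \<circ> \<sigma>) k \<in> T" using eventually_happens'[OF sequentially_bot] by blast
          moreover have "(z \<circ> \<sigma>) k \<in> cspace n" using z(1) Un by auto
          ultimately have "(z \<circ> \<sigma>) k \<in> {z \<in> cspace n. \<pi> n z \<in> S - Q}" unfolding T(2) by simp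
          then show False using z(2) by simp
        qed
        then show "l \<in> \<Phi> ` Q" unfolding l using \<Phi>\<pi>[OF z0U] by (metis imageI)
      qed
      moreover have "\<Phi> ` Q \<subseteq> cspace N" by (auto simp: \<Phi>_def G_def cspace_def)
      ultimately show "closedin (cspace_top N) (\<Phi> ` Q)"
        unfolding cspace_top_def by (simp add: closed_subset)
    qed
  next
    fix p assume "p \<in> topspace (mtop ?M)"
    then obtain z0 where z0: "z0 \<in> complement_cover" "p = \<pi> n z0" unfolding M topX unfolding S_def by blast
      let ?w = "\<lambda>i. lform (r i) z0"
    have w: "?w i \<notin> L" if "i < n" for i using z0(1) r_less[OF that] by (simp add: complement_cover_def)
    have "\<forall>i. \<exists>k \<rho> h. i < n \<longrightarrow> local_inverse (?w i) k \<rho> h" using local_inverse_exists[OF w] by blast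
    then obtain k \<rho> h where *: "\<And>i. i < n \<Longrightarrow> local_inverse (?w i) (k i) (\<rho> i) (h i)" by metis
    define B where "B i = ball (?w i) (\<rho> i)" for i
    define D1 where "D1 i = eis (k i) ` B i" for i
    have k: "k i \<in> {4..exponent_bound}" and \<rho>: "\<rho> i > 0" and D1: "open (D1 i)"
      and h: "h i holomorphic_on D1 i" and hf: "\<And>x. x \<in> B i \<Longrightarrow> h i (eis (k i) x) = x" if "i < n" for i
      using *[OF that] unfolding B_def D1_def local_inverse_def by auto
    define c where "c i = (SOME c. c < N \<and> idx c = Inl (r i, k i))" for i
    have \<iota>: "Inl (r i, k i) \<in> index_set" if "i < n" for i
      using that r_less[OF that] k[OF that] by (auto simp: index_set_def)
    have c: "c i < N" "idx (c i) = Inl (r i, k i)" if "i < n" for i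
      using someI_ex[OF idx_surj[OF \<iota>[OF that]]] unfolding c_def by simp_all
    define Y where "Y z = coord_proj n c (G z)" for z
    have Y: "Y z i = eis (k i) (lform (r i) z)" if "i < n" for z i
      using c[OF that] that by (simp add: Y_def coord_proj_def G_def emb_def)
    define V where "V = {z \<in> complement_cover. \<forall>i<n. lform (r i) z \<in> B i}"
    have V: "openin (cspace_top n) V"
      unfolding V_def by (rule openin_holomorphic_polydisc[OF oU holomorphic_lform[OF oU]]) (simp add: B_def)
    \<comment> \<open>One-variable inverses recover the values of the forms from the selected
      components, adding \<open>\<zeta>\<close> undoes the shift, and \<open>C\<close> solves the
      linear system for \<open>z\<close>.\<close>
    define T where "T y = (\<lambda>j. if j < n then \<Sum>i<n. of_real (C j i) * (h i (y i) + \<zeta> (r i)) else 0)" for y :: cvec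
    have TY: "T (Y z) = z" if z: "z \<in> V" for z
    proof
      fix j
      show "T (Y z) j = z j"
      proof (cases "j < n")
        case True
        have "T (Y z) j = (\<Sum>i<n. of_real (C j i) * (lform (r i) z + \<zeta> (r i)))"
          using True z Y hf by (auto simp: T_def V_def intro!: sum.cong)
        also have "\<dots> = (\<Sum>i<n. \<Sum>l<n. of_real (C j i) * of_int (b (r i) l) * z l)"
          by (simp add: lform_def sum_distrib_left mult.assoc)
        also have "\<dots> = (\<Sum>l<n. of_real (\<Sum>i<n. C j i * of_int (b (r i) l)) * z l)"
          by (subst sum.swap) (simp add: sum_distrib_right)
        also have "\<dots> = (\<Sum>l<n. (if j = l then 1 else 0) * z l)"
          by (intro sum.cong) (auto simp: left_inverse True)
        also have "\<dots> = z j" using True by (simp add: if_distrib[of "\<lambda>a. a * _"] cong: if_cong)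
        finally show ?thesis .
      next
        case False
        then show ?thesis using z Un by (auto simp: T_def V_def cspace_def)
      qed
    qed
    define D0 where "D0 = {y \<in> cspace n. \<forall>i<n. y i \<in> D1 i}"
    have D0: "openin (cspace_top n) D0" unfolding D0_def by (rule openin_cspace_polydisc[OF D1])
    have T_hol: "holomorphic_vec n n T D0"
      unfolding holomorphic_vec_def
    proof (intro conjI allI impI D0)
      show "T ` D0 \<subseteq> cspace n" by (auto simp: T_def cspace_def)
      fix j assume j: "j < n"
      have "holomorphic_fun n (\<lambda>y. h i (y i)) D0" if "i < n" for i
      proof (rule holomorphic_fun_compose1[OF holomorphic_fun_coord[OF D0]])
        fix y assume "y \<in> D0"
        then have "y i \<in> D1 i" using that by (simp add: D0_def)
        then show "h i field_differentiable at (y i)"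
          using h[OF that] D1[OF that] by (simp add: holomorphic_on_imp_differentiable_at)
      qed
      then show "holomorphic_fun n (\<lambda>y. T y j) D0"
        unfolding T_def using j
        by (simp, intro holomorphic_fun_sum holomorphic_fun_cmult holomorphic_fun_add holomorphic_fun_const D0) auto
    qed
    \<comment> \<open>\<open>T\<close> may leave the complement, as rows outside the range of
      \<open>r\<close> impose further conditions; restricting to \<open>D\<close> gives exactly the
      image of \<open>V\<close>.\<close>
    define D where "D = {y \<in> D0. T y \<in> complement_cover}"
    have D: "openin (cspace_top n) D" unfolding D_def by (rule holomorphic_vec_openin_vimage[OF T_hol oU])
    have lformT: "lform (r i) (T y) = h i (y i)" if "i < n" for i y
    proof -
      have "lform (r i) (T y) + \<zeta> (r i) = (\<Sum>j<n. \<Sum>l<n. of_int (b (r i) j) * of_real (C j l) * (h l (y l) + \<zeta> (r l)))"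
        by (simp add: lform_def T_def sum_distrib_left mult.assoc)
      also have "\<dots> = (\<Sum>l<n. of_real (\<Sum>j<n. of_int (b (r i) j) * C j l) * (h l (y l) + \<zeta> (r l)))"
        by (subst sum.swap) (simp add: sum_distrib_right)
      also have "\<dots> = (\<Sum>l<n. (if i = l then 1 else 0) * (h l (y l) + \<zeta> (r l)))"
        by (intro sum.cong) (auto simp: right_inverse that)
      also have "\<dots> = h i (y i) + \<zeta> (r i)" using that by (simp add: if_distrib[of "\<lambda>a. a * _"] cong: if_cong)
      finally show ?thesis by simp
    qed
    have YV: "Y ` V = D"
    proof (intro equalityI subsetI)
      fix y assume "y \<in> Y ` V"
      then obtain z where z: "z \<in> V" "y = Y z" by blast
      then show "y \<in> D" using TY[OF z(1)] Y by (auto simp: D_def D0_def D1_def V_def) (simp add: Y_def)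
    next
      fix y assume y: "y \<in> D"
      have hB: "h i (y i) \<in> B i" "eis (k i) (h i (y i)) = y i" if "i < n" for i
      proof -
        have "y i \<in> D1 i" using y that by (simp add: D_def D0_def)
        then obtain x where "x \<in> B i" "y i = eis (k i) x" unfolding D1_def by blast
        then show "h i (y i) \<in> B i" "eis (k i) (h i (y i)) = y i" using hf[OF that] by auto
      qed
      have "T y \<in> V" using y hB by (auto simp: V_def D_def lformT)
      moreover have "Y (T y) = y"
      proof (subst cspace_eq_iff[of _ n])
        show "Y (T y) \<in> cspace n" by (simp add: Y_def)
        show "y \<in> cspace n" using y by (simp add: D_def D0_def)
        show "\<forall>i<n. Y (T y) i = y i" using hB by (simp add: Y lformT)
      qed
      ultimately show "y \<in> Y ` V" by (metis imageI)
    qed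
    \<comment> \<open>\<open>Y\<close> is constant on the fibres of the covering and
      \<open>T\<close> inverts it on \<open>V\<close>, so \<open>V\<close> meets each fibre at most
      once and qualifies as a chart domain.\<close>
    have injV: "inj_on (\<pi> n) V"
    proof (rule inj_onI)
      fix x y assume xy: "x \<in> V" "y \<in> V" "\<pi> n x = \<pi> n y"
      then have "Y x = Y y" using G_per[OF xy(3)] by (simp add: Y_def)
      then have "T (Y x) = T (Y y)" by (rule arg_cong)
      then show "x = y" unfolding TY[OF xy(1)] TY[OF xy(2)] .
    qed
    have VU: "V \<subseteq> complement_cover" by (auto simp: V_def)
    have \<pi>V: "\<pi> n ` V \<inter> S = \<pi> n ` V" using VU by (auto simp: S_def)
    show "\<exists>U \<phi> c T. (U, \<phi>) \<in> atlas ?M \<and> p \<in> U \<and>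
      inj_on c {..<mdim ?M} \<and> c ` {..<mdim ?M} \<subseteq> {..<N} \<and>
      holomorphic_vec (mdim ?M) (mdim ?M) T ((\<lambda>u. coord_proj (mdim ?M) c (\<Phi> u)) ` U) \<and>
      (\<forall>u\<in>U. T (coord_proj (mdim ?M) c (\<Phi> u)) = \<phi> u)"
    proof (intro exI conjI)
      show "(\<pi> n ` V \<inter> S, inv_into V (\<pi> n)) \<in> atlas ?M" unfolding M using V injV by blast
      have "z0 \<in> V" using z0(1) \<rho> by (simp add: V_def B_def)
      then show "p \<in> \<pi> n ` V \<inter> S" unfolding \<pi>V z0(2) by blast
      show "inj_on c {..<mdim ?M}"
      proof (rule inj_onI)
        fix i j assume ij: "i \<in> {..<mdim ?M}" "j \<in> {..<mdim ?M}" "c i = c j"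
        then have "Inl (r i, k i) = (Inl (r j, k j) :: nat \<times> nat + nat \<times> bool \<times> (nat \<Rightarrow> nat))"
          using c(2)[of i] c(2)[of j] by (simp add: M)
        then show "i = j" using inj_r ij by (auto simp: M inj_on_def)
      qed
      show "c ` {..<mdim ?M} \<subseteq> {..<N}" using c(1) by (auto simp: M)
      have "(\<lambda>u. coord_proj n c (\<Phi> u)) ` (\<pi> n ` V \<inter> S) = Y ` V"
        unfolding \<pi>V image_image using VU by (intro image_cong) (auto simp: \<Phi>\<pi> Y_def)
      then have im: "(\<lambda>u. coord_proj n c (\<Phi> u)) ` (\<pi> n ` V \<inter> S) = D" by (simp only: YV)
      show "holomorphic_vec (mdim ?M) (mdim ?M) T ((\<lambda>u. coord_proj (mdim ?M) c (\<Phi> u)) ` (\<pi> n ` V \<inter> S))"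
        unfolding M(2) im by (rule holomorphic_vec_subset[OF T_hol D]) (auto simp: D_def)
      show "\<forall>u\<in>\<pi> n ` V \<inter> S. T (coord_proj (mdim ?M) c (\<Phi> u)) = inv_into V (\<pi> n) u"
        unfolding \<pi>V
      proof
        fix u assume "u \<in> \<pi> n ` V"
        then obtain z where z: "z \<in> V" "u = \<pi> n z" by blast
        have "coord_proj n c (\<Phi> u) = Y z" using z VU \<Phi>\<pi>[of z] by (auto simp: Y_def)
        then show "T (coord_proj (mdim ?M) c (\<Phi> u)) = inv_into V (\<pi> n) u" using TY[OF z(1)] z injV by (simp add: M)
      qed
    qed
  qed
  then show ?thesis by (simp add: S_def)
qed

end

section \<open>From the given arrangement to the lifted data\<close>

lemma is_lattice_imp_plane_lattice:
  assumes "is_lattice \<Lambda>"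
  shows "\<exists>\<omega>1 \<omega>2. plane_lattice \<omega>1 \<omega>2 \<and> \<Lambda> = range (plane_lattice.lat \<omega>1 \<omega>2)"
proof -
  obtain \<omega>1 \<omega>2 where ne: "\<omega>1 \<noteq> \<omega>2" and ind: "independent {\<omega>1, \<omega>2}"
    and \<Lambda>: "\<Lambda> = {of_int a * \<omega>1 + of_int b * \<omega>2 |a b. True}"
    using assms unfolding is_lattice_def by blast
  have "Im (cnj \<omega>1 * \<omega>2) \<noteq> 0"
  proof
    assume Im: "Im (cnj \<omega>1 * \<omega>2) = 0"
    have "\<omega>1 \<noteq> 0" using ind dependent_zero[of "{\<omega>1, \<omega>2}"] by auto
    \<comment> \<open>If the imaginary part vanishes, \<open>cnj \<omega>1 * \<omega>2\<close> is
      real; multiplying by \<open>\<omega>1\<close> and dividing by its squared modulus exhibits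
      \<open>\<omega>2\<close> as the real multiple \<open>t\<close> of
      \<open>\<omega>1\<close>.\<close>
    define t where "t = Re (cnj \<omega>1 * \<omega>2) / (cmod \<omega>1)\<^sup>2"
    have "cnj \<omega>1 * \<omega>2 = of_real (Re (cnj \<omega>1 * \<omega>2))" using Im by (simp add: complex_eq_iff)
    then have *: "\<omega>1 * (cnj \<omega>1 * \<omega>2) = \<omega>1 * of_real (Re (cnj \<omega>1 * \<omega>2))" by (rule arg_cong)
    have "of_real ((cmod \<omega>1)\<^sup>2) * \<omega>2 = \<omega>1 * (cnj \<omega>1 * \<omega>2)"
      unfolding complex_norm_square by (rule mult.assoc)
    also have "\<dots> = of_real (Re (cnj \<omega>1 * \<omega>2)) * \<omega>1" unfolding * by (rule mult.commute)
    finally have "of_real ((cmod \<omega>1)\<^sup>2) * \<omega>2 = of_real (Re (cnj \<omega>1 * \<omega>2)) * \<omega>1" .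
    then have "\<omega>2 = t *\<^sub>R \<omega>1"
      using \<open>\<omega>1 \<noteq> 0\<close> by (simp add: t_def scaleR_conv_of_real field_simps)
    then have "\<omega>2 \<in> span {\<omega>1}" by (metis span_base span_scale singletonI)
    then have "dependent {\<omega>1, \<omega>2}"
      using ne by (intro dependent_def[THEN iffD2] bexI[of _ \<omega>2]) (auto simp: insert_Diff_if)
    then show False using ind by simp
  qed
  then have P: "plane_lattice \<omega>1 \<omega>2" by (rule plane_lattice.intro)
  interpret plane_lattice \<omega>1 \<omega>2 by (rule P)
  have "\<Lambda> = range lat"
  proof (intro equalityI subsetI)
    fix x assume "x \<in> \<Lambda>"
    then obtain a b where "x = of_int a * \<omega>1 + of_int b * \<omega>2" unfolding \<Lambda> by blast
    then have "x = lat (a, b)" by (simp add: lat_def)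
    then show "x \<in> range lat" by blast
  next
    fix x assume "x \<in> range lat"
    then obtain p where "x = lat p" by (rule rangeE)
    then show "x \<in> \<Lambda>" unfolding \<Lambda> lat_def by blast
  qed
  then show ?thesis using P by blast
qed

theorem proposition6p1:
  fixes \<Lambda> :: "complex set" and n :: nat
    and A :: "int mat" and \<zeta> :: "nat \<Rightarrow> complex set"
  assumes "is_lattice \<Lambda>"
    and "elliptic_arrangement \<Lambda> n A \<zeta>"
    and "essential A"
  shows "stein_manifold (open_submanifold (elliptic_power \<Lambda> n) (arrangement_complement \<Lambda> n A \<zeta>))"
proof -
  obtain \<omega>1 \<omega>2 where "plane_lattice \<omega>1 \<omega>2" and \<Lambda>: "\<Lambda> = range (plane_lattice.lat \<omega>1 \<omega>2)"
    using is_lattice_imp_plane_lattice[OF assms(1)] by blast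
  then interpret plane_lattice \<omega>1 \<omega>2 by simp
  have lattice: "is_lattice L" using assms(1) \<Lambda> by simp
  have dim: "dim_col A = n" and \<zeta>: "\<And>i. i < dim_row A \<Longrightarrow> \<zeta> i \<in> range proj"
    using assms(2) unfolding elliptic_arrangement_def \<Lambda> carrier_elliptic_curve by auto
  from \<zeta> have "\<forall>i. \<exists>x. i < dim_row A \<longrightarrow> \<zeta> i = proj x" by blast
  then obtain \<zeta>' where \<zeta>': "\<And>i. i < dim_row A \<Longrightarrow> \<zeta> i = proj (\<zeta>' i)" by metis
  obtain r C where inj: "inj_on r {..<n}" and r: "\<forall>i<n. r i < dim_row A"
    and left: "\<forall>j<n. \<forall>l<n. (\<Sum>i<n. C j i * of_int (A $$ (r i, l))) = (if j = l then 1 else 0 :: rat)"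
    and right: "\<forall>i<n. \<forall>k<n. (\<Sum>j<n. of_int (A $$ (r i, j)) * C j k) = (if i = k then 1 else 0 :: rat)"
    using essential_imp_invertible_rows[OF dim assms(3)] by (elim exE conjE)
  have of_rat_if: "real_of_rat (if Q then 1 else 0) = (if Q then 1 else 0)" for Q by simp
  \<comment> \<open>The inverse block is rational since the rank is taken over the rationals; the
    twists need real exponents, hence the embedding by \<open>real_of_rat\<close>.\<close>
  interpret lattice_arrangement \<omega>1 \<omega>2 n "dim_row A" "\<lambda>i j. A $$ (i, j)" \<zeta>' r "\<lambda>j i. real_of_rat (C j i)"
  proof
    show "r i < dim_row A" if "i < n" for i using r that by blast
    show "inj_on r {..<n}" by (rule inj)
    show "(\<Sum>i<n. real_of_rat (C j i) * of_int (A $$ (r i, l))) = (if j = l then 1 else 0)" if "j < n" "l < n" for j l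
      using arg_cong[OF left[rule_format, OF that], of real_of_rat] by (simp add: of_rat_sum of_rat_mult of_rat_if del: of_rat_eq_iff)
    show "(\<Sum>j<n. of_int (A $$ (r i, j)) * real_of_rat (C j k)) = (if i = k then 1 else 0)" if "i < n" "k < n" for i k
      using arg_cong[OF right[rule_format, OF that], of real_of_rat] by (simp add: of_rat_sum of_rat_mult of_rat_if)
  qed
  \<comment> \<open>On a lift \<open>z\<close>, lying on hypersurface \<open>i\<close> means that
    \<open>lform i z\<close> is a period, because \<open>\<zeta>' i\<close> lifts the constant
    \<open>\<zeta> i\<close>.\<close>
  have "arrangement_complement L n A \<zeta> = \<pi> n ` complement_cover"
  proof -
    have top: "topspace (mtop (elliptic_power L n)) = \<pi> n ` cspace n"
      by (simp add: elliptic_power_def \<pi>_image del: topspace_product_topology)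
    have "\<pi> n z \<in> hypersurface L n A \<zeta> i \<longleftrightarrow> lform i z \<in> L" if "z \<in> cspace n" "i < dim_row A" for z i
      using that \<zeta>'[OF that(2)]
      by (simp add: hypersurface_def top arrangement_hom_\<pi>[OF lattice dim] proj_eq_iff lform_def)
    then show ?thesis
      unfolding arrangement_complement_def arrangement_def top by (auto simp: complement_cover_def)
  qed
  then show ?thesis using stein_complement by (simp only: \<Lambda>)
qed

end
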